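(* Let $\{X_k,f_k\}$ be a presentation (as described in the context) of a compact connected orientable branched matchbox manifold, with adjacency matrices $M_k$ ($k\ge1$), and let $n_k$ be the number of edges of $X_k$. Then (1) $$\left(\varinjlim C(\mathcal{E}_k,\mathbb{Z}),\varinjlim C_+(\mathcal{E}_k,\mathbb{Z})\right)\cong\left(\varinjlim(\mathbb{Z}^{n_k},M_k),\varinjlim(\mathbb{Z}^{n_k}_+,M_k)\right)$$ as ordered groups. If moreover the presentation satisfies the Simplicity Condition (for each $k\ge1$ there exists $\kappa(k)\ge k$ such that for every $l\ge\kappa(k)$ and every $e\in\mathcal{E}_l$, $f_{k+1}\circ\cdots\circ f_l(e)=X_k$), then (2) $\left(\varinjlim C(\mathcal{E}_k,\mathbb{Z}),\varinjlim C_+(\mathcal{E}_k,\mathbb{Z})\right)$ and $\left(\varinjlim\mathcal{G}^k,\varinjlim\mathcal{G}^k_+\right)$ are simple dimension groups.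
   Context: **Branched matchbox manifolds.** A branched matchbox is a space homeomorphic to $U=\bigl((S_1\times(-1,0])\cup(S_2\times[0,1))\bigr)/\sim$, where $S_1,S_2$ are (disjoint) zero-dimensional compact separable metrizable spaces and there is a closed equivalence relation $\approx$ on $S_1\cup S_2$ such that: every element of $S_1$ is $\approx$-equivalent to at least one element of $S_2$ and every element of $S_2$ to at least one element of $S_1$; $(S_1\cup S_2)/{\approx}$ is a zero-dimensional metrizable space in the quotient topology; and $(s,i)\sim(s',j)$ iff either $s\approx s'$ and $i=j=0$, or $s=s'$ and $i=j$. Its projection is $p_U\colon U\to(-1,1)$, $[(z,j)]\mapsto j$. A branched matchbox manifold is a separable metrizable space $Y$ with a collection of charts, i.e. homeomorphisms $h\colon V\to U$ from open subsets $V$ of $Y$ onto branched matchboxes, whose domains cover $Y$ and whose changes of coordinates are continuous. $Y$ is orientable if it is covered by domains of charts $h_i\colon V_i\to U_i$ (with projections $p_i$) such that for all $i,j$ and every locally one-to-one curve $\gamma\colon[0,1]\to V_i\cap V_j$, $p_i\circ h_i\circ\gamma$ is increasing iff $p_j\circ h_j\circ\gamma$ is increasing; a maximal such collection of charts is an orientation. A locally one-to-one curve in $Y$ is orientation preserving if $p_i\circ h_i\circ\gamma$ is increasing on each interval that $\gamma$ maps into $V_i$. **Graphs.** A graph is finite, directed and nondegenerate (every vertex has at least one incoming and at least one outgoing edge). A directed edge $e$ is parameterized as $e(t)$, $t\in[0,1]$, with initial vertex $e(0)$ and terminal vertex $e(1)$ (possibly equal). A continuous path $p$ in a directed graph is orientation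 preserving if $e^{-1}\circ p$ is increasing on every interval that $p$ maps into a directed edge $e$. A continuous map of directed graphs is orientation preserving if it sends orientation preserving paths to orientation preserving paths. **Presentation.** The manifold is (homeomorphic to) $\overline{X}=\{(x_0,x_1,\dots)\in\prod_{k\ge0} X_k: f_{k+1}(x_{k+1})=x_k\}$, where each $X_k$ is a graph with a fixed vertex set $\mathcal{V}_k$ and set of directed edges $\mathcal{E}_k$, and each $f_k\colon X_k\to X_{k-1}$ is a continuous onto orientation preserving map with $f_k(\mathcal{V}_k)\subset\mathcal{V}_{k-1}$ and $f_k|_{X_k\setminus\mathcal{V}_k}$ locally one-to-one. The edge directions are induced by an orientation of $\overline{X}$, so the projections $\overline{X}\to X_k$ carry orientation preserving curves to orientation preserving curves. **Adjacency matrices.** For $e_i\in\mathcal{E}_k$, $f_k(e_i)$ is a path of edges in $X_{k-1}$; $M_k$ is the $n_k\times n_{k-1}$ matrix whose $(i,j)$ entry is the number of times this path covers $e_j\in\mathcal{E}_{k-1}$ (ignoring direction). $\varinjlim(\mathbb{Z}^{n_k},M_k)$ is the direct limit of $\mathbb{Z}^{n_0}\xrightarrow{M_1}\mathbb{Z}^{n_1}\xrightarrow{M_2}\cdots$, with positive cone $\varinjlim(\mathbb{Z}_+^{n_k},M_k)$ the union of the images of the cones $\mathbb{Z}_+^{n_k}$ (nonnegative integer vectors). **Graph groups.** $C(\mathcal{E}_k,\mathbb{Z})$ is the group of functions $\mathcal{E}_k\to\mathbb{Z}$ and $C_+(\mathcal{E}_k,\mathbb{Z})$ the nonnegative ones.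 If $f_{k+1}(e)=e_1\cdots e_n$, set $f^*_{k+1}(g)(e)=\sum_i g(e_i)$; $\varinjlim C(\mathcal{E}_k,\mathbb{Z})$ is the direct limit along $f^*_{k+1}\colon C(\mathcal{E}_k,\mathbb{Z})\to C(\mathcal{E}_{k+1},\mathbb{Z})$, with positive cone $\varinjlim C_+(\mathcal{E}_k,\mathbb{Z})$. For a vertex $p_i$ of $X_k$, the vertex function $v_i$ is $1$ on edges from $p_i$ to another vertex, $-1$ on edges from another vertex to $p_i$, and $0$ on all other edges. $V_k\subset C(\mathcal{E}_k,\mathbb{Z})$ is the subgroup generated by the $v_i$, $\mathcal{G}^k=C(\mathcal{E}_k,\mathbb{Z})/V_k$, and $\mathcal{G}^k_+$ is the image of $C_+(\mathcal{E}_k,\mathbb{Z})$. The maps $f^*_{k+1}$ induce $\mathcal{G}^k\to\mathcal{G}^{k+1}$, and $\varinjlim\mathcal{G}^k$ has positive cone $\varinjlim\mathcal{G}^k_+$. **Dimension groups.** A preordered group is $(G,G_+)$ with $G$ abelian and $G_+$ a submonoid generating $G$; it is an ordered group if $G_+\cap(-G_+)=\{0\}$; $a\le b$ means $b-a\in G_+$. A dimension group is an ordered group order isomorphic to the direct limit of a system $\mathbb{Z}^{r(0)}\to\mathbb{Z}^{r(1)}\to\cdots$ of simplicially ordered groups (positive cone $\mathbb{Z}^r_+$) with homomorphisms given by nonnegative integer matrices. An order ideal is a subgroup $H$ that is an ordered group with positive cone $H_+=H\cap G_+$ and such that $0\le a\le b\in H$ implies $a\in H$. A dimension group is simple if it has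 no order ideals other than $\{0\}$ and $G$. *)

theory Defs
  imports "HOL-Analysis.Analysis" "HOL-Algebra.Product_Groups"
begin

section \<open>Branched matchbox manifolds\<close>

definition quotient_topology :: "'a topology \<Rightarrow> ('a \<times> 'a) set \<Rightarrow> 'a set topology" where
  "quotient_topology T R =
     topology (\<lambda>W. W \<subseteq> topspace T // R \<and> openin T (\<Union>W))"

lemma openin_quotient_topology:
  assumes "equiv (topspace T) R"
  shows "openin (quotient_topology T R) W \<longleftrightarrow> W \<subseteq> topspace T // R \<and> openin T (\<Union>W)"
proof -
  have Int: "\<Union>(A \<inter> B) = \<Union>A \<inter> \<Union>B"
    if A: "A \<subseteq> topspace T // R" and B: "B \<subseteq> topspace T // R" for A B
  proof
    show "\<Union>A \<inter> \<Union>B \<subseteq> \<Union>(A \<inter> B)"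
    proof
      fix x assume "x \<in> \<Union>A \<inter> \<Union>B"
      then obtain P Q where PQ: "P \<in> A" "Q \<in> B" "x \<in> P" "x \<in> Q" by blast
      with A B have "P = Q" using quotient_disj[OF assms, of P Q] by blast
      with PQ show "x \<in> \<Union>(A \<inter> B)" by blast
    qed
  qed blast
  have "istopology (\<lambda>W. W \<subseteq> topspace T // R \<and> openin T (\<Union>W))"
    unfolding istopology_def
  proof (intro conjI allI impI)
    fix K assume "\<forall>W\<in>K. W \<subseteq> topspace T // R \<and> openin T (\<Union>W)"
    moreover have "\<Union>(\<Union>K) = (\<Union>W\<in>K. \<Union>W)" by blast
    ultimately show "\<Union>K \<subseteq> topspace T // R" "openin T (\<Union>(\<Union>K))" by auto
  qed (auto simp: Int)
  then show ?thesis by (simp add: quotient_topology_def)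
qed

text \<open>The two pieces are indexed by \<^term>\<open>False\<close> (for \<open>S\<^sub>1\<close>) and \<^term>\<open>True\<close> (for \<open>S\<^sub>2\<close>), so they are
  disjoint by construction. A separable metrizable space has at most continuum many points, hence
  every admissible \<open>S\<^sub>1\<close>, \<open>S\<^sub>2\<close> is homeomorphic to some (arbitrary) topology on a set of reals.\<close>

type_synonym mb_point = "((bool \<times> real) \<times> real) set"

definition ends :: "real topology \<Rightarrow> real topology \<Rightarrow> (bool \<times> real) topology" where
  "ends S1 S2 = sum_topology (\<lambda>i. if i then S2 else S1) UNIV"

definition matchbox_data :: "real topology \<Rightarrow> real topology \<Rightarrow> ((bool \<times> real) \<times> (bool \<times> real)) set \<Rightarrow> bool"
  where
  "matchbox_data S1 S2 R \<longleftrightarrow>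
     (\<forall>S\<in>{S1, S2}. compact_space S \<and> separable_space S \<and> metrizable_space S \<and> S dim_le 0) \<and>
     equiv (topspace (ends S1 S2)) R \<and>
     closedin (prod_topology (ends S1 S2) (ends S1 S2)) R \<and>
     (\<forall>s\<in>topspace S1. \<exists>s'\<in>topspace S2. ((False, s), (True, s')) \<in> R) \<and>
     (\<forall>s'\<in>topspace S2. \<exists>s\<in>topspace S1. ((False, s), (True, s')) \<in> R) \<and>
     metrizable_space (quotient_topology (ends S1 S2) R) \<and>
     quotient_topology (ends S1 S2) R dim_le 0"

definition unglued :: "real topology \<Rightarrow> real topology \<Rightarrow> ((bool \<times> real) \<times> real) topology" where
  "unglued S1 S2 = subtopology (prod_topology (ends S1 S2) euclideanreal)
     {((i, s), t). if i then 0 \<le> t \<and> t < 1 else -1 < t \<and> t \<le> 0}"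

definition glue ::
  "real topology \<Rightarrow> real topology \<Rightarrow> ((bool \<times> real) \<times> (bool \<times> real)) set \<Rightarrow>
   (((bool \<times> real) \<times> real) \<times> ((bool \<times> real) \<times> real)) set" where
  "glue S1 S2 R =
     {((z, t), (z', t')). (z, t) \<in> topspace (unglued S1 S2) \<and> (z', t') \<in> topspace (unglued S1 S2) \<and>
        ((z, z') \<in> R \<and> t = 0 \<and> t' = 0 \<or> z = z' \<and> t = t')}"

definition matchbox_model :: "mb_point topology \<Rightarrow> bool" where
  "matchbox_model U \<longleftrightarrow>
     (\<exists>S1 S2 R. matchbox_data S1 S2 R \<and> U = quotient_topology (unglued S1 S2) (glue S1 S2 R))"

text \<open>All representatives \<open>(z, t)\<close> of a point of a model share the same \<open>t\<close>.\<close>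

definition mb_proj :: "mb_point \<Rightarrow> real" where
  "mb_proj u = the_elem (snd ` u)"

record 'y mb_chart =
  cdom :: "'y set"
  ctarget :: "mb_point topology"
  cmap :: "'y \<Rightarrow> mb_point"

definition is_chart :: "'y topology \<Rightarrow> 'y mb_chart \<Rightarrow> bool" where
  "is_chart Y c \<longleftrightarrow> openin Y (cdom c) \<and> matchbox_model (ctarget c) \<and>
     homeomorphic_map (subtopology Y (cdom c)) (ctarget c) (cmap c)"

definition mb_atlas :: "'y topology \<Rightarrow> 'y mb_chart set \<Rightarrow> bool" where
  "mb_atlas Y A \<longleftrightarrow>
     (\<forall>c\<in>A. is_chart Y c) \<and> (\<Union>c\<in>A. cdom c) = topspace Y \<and>
     (\<forall>c\<in>A. \<forall>d\<in>A. continuous_map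
        (subtopology (ctarget c) (cmap c ` (cdom c \<inter> cdom d))) (ctarget d)
        (cmap d \<circ> inv_into (cdom c) (cmap c)))"

definition branched_matchbox_manifold :: "'y topology \<Rightarrow> bool" where
  "branched_matchbox_manifold Y \<longleftrightarrow>
     separable_space Y \<and> metrizable_space Y \<and> (\<exists>A. mb_atlas Y A)"

definition locally_one_to_one :: "'a topology \<Rightarrow> 'a set \<Rightarrow> ('a \<Rightarrow> 'b) \<Rightarrow> bool" where
  "locally_one_to_one T A g \<longleftrightarrow>
     (\<forall>x\<in>A. \<exists>W. openin (subtopology T A) W \<and> x \<in> W \<and> inj_on g W)"

definition loc_inj_curve :: "'y topology \<Rightarrow> (real \<Rightarrow> 'y) \<Rightarrow> bool" where
  "loc_inj_curve Y \<gamma> \<longleftrightarrow> pathin Y \<gamma> \<and> locally_one_to_one euclideanreal {0..1} \<gamma>"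

definition oriented_atlas :: "'y topology \<Rightarrow> 'y mb_chart set \<Rightarrow> bool" where
  "oriented_atlas Y A \<longleftrightarrow> mb_atlas Y A \<and>
     (\<forall>c\<in>A. \<forall>d\<in>A. \<forall>\<gamma>. loc_inj_curve Y \<gamma> \<and> \<gamma> ` {0..1} \<subseteq> cdom c \<inter> cdom d \<longrightarrow>
        (mono_on {0..1} (mb_proj \<circ> cmap c \<circ> \<gamma>) \<longleftrightarrow> mono_on {0..1} (mb_proj \<circ> cmap d \<circ> \<gamma>)))"

definition orientable :: "'y topology \<Rightarrow> bool" where
  "orientable Y \<longleftrightarrow> (\<exists>A. oriented_atlas Y A)"

definition is_orientation :: "'y topology \<Rightarrow> 'y mb_chart set \<Rightarrow> bool" where
  "is_orientation Y A \<longleftrightarrow> oriented_atlas Y A \<and> (\<forall>B. oriented_atlas Y B \<and> A \<subseteq> B \<longrightarrow> B = A)"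

definition op_curve :: "'y topology \<Rightarrow> 'y mb_chart set \<Rightarrow> (real \<Rightarrow> 'y) \<Rightarrow> bool" where
  "op_curve Y A \<gamma> \<longleftrightarrow> loc_inj_curve Y \<gamma> \<and>
     (\<forall>c\<in>A. \<forall>J. J \<subseteq> {0..1} \<and> is_interval J \<and> \<gamma> ` J \<subseteq> cdom c \<longrightarrow>
        mono_on J (mb_proj \<circ> cmap c \<circ> \<gamma>))"


section \<open>Directed graphs\<close>

text \<open>An edge is its own parameterization, so \<open>e 0\<close> and \<open>e 1\<close> are its initial and terminal
  vertices; values outside \<open>[0, 1]\<close> are irrelevant. Since there are finitely many vertices and
  edges, the Hausdorff condition makes the topology that of the one-dimensional CW complex.\<close>

record 'x digraph =
  gtop :: "'x topology"
  verts :: "'x set"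
  edges :: "(real \<Rightarrow> 'x) set"

definition is_graph :: "'x digraph \<Rightarrow> bool" where
  "is_graph X \<longleftrightarrow>
     Hausdorff_space (gtop X) \<and> finite (verts X) \<and> finite (edges X) \<and>
     (\<forall>e\<in>edges X. pathin (gtop X) e \<and> e 0 \<in> verts X \<and> e 1 \<in> verts X \<and>
        inj_on e {0<..<1} \<and> e ` {0<..<1} \<inter> verts X = {}) \<and>
     (\<forall>e\<in>edges X. \<forall>e'\<in>edges X. e \<noteq> e' \<longrightarrow> e ` {0<..<1} \<inter> e' ` {0<..<1} = {}) \<and>
     topspace (gtop X) = verts X \<union> (\<Union>e\<in>edges X. e ` {0..1}) \<and>
     (\<forall>v\<in>verts X. (\<exists>e\<in>edges X. e 1 = v) \<and> (\<exists>e\<in>edges X. e 0 = v))"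

text \<open>The parameters on which \<open>e\<close> is injective, so that its inverse makes sense: for a loop, the
  inverse is two-valued at the vertex.\<close>

definition edge_params :: "(real \<Rightarrow> 'x) \<Rightarrow> real set" where
  "edge_params e = (if e 0 = e 1 then {0<..<1} else {0..1})"

definition op_path :: "'x digraph \<Rightarrow> (real \<Rightarrow> 'x) \<Rightarrow> bool" where
  "op_path X p \<longleftrightarrow> pathin (gtop X) p \<and>
     (\<forall>e\<in>edges X. \<forall>J. J \<subseteq> {0..1} \<and> is_interval J \<and> p ` J \<subseteq> e ` edge_params e \<longrightarrow>
        mono_on J (inv_into (edge_params e) e \<circ> p))"

definition op_map :: "'x digraph \<Rightarrow> 'x digraph \<Rightarrow> ('x \<Rightarrow> 'x) \<Rightarrow> bool" where
  "op_map X X' g \<longleftrightarrow> continuous_map (gtop X) (gtop X') g \<and>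
     (\<forall>p. op_path X p \<longrightarrow> op_path X' (g \<circ> p))"

text \<open>\<open>p\<close> runs through the edges \<open>es\<close> one after the other, each in either direction.\<close>

definition is_edge_word :: "'x digraph \<Rightarrow> (real \<Rightarrow> 'x) \<Rightarrow> (real \<Rightarrow> 'x) list \<Rightarrow> bool" where
  "is_edge_word X p es \<longleftrightarrow> set es \<subseteq> edges X \<and>
     (\<exists>ts. length ts = Suc (length es) \<and> sorted_wrt (<) ts \<and> hd ts = 0 \<and> last ts = 1 \<and>
        (\<forall>i<length es. \<exists>\<phi>.
           homeomorphic_map (top_of_set {ts ! i..ts ! Suc i}) (top_of_set {0..1}) \<phi> \<and>
           (\<forall>t\<in>{ts ! i..ts ! Suc i}. p t = (es ! i) (\<phi> t))))"

definition edge_word :: "'x digraph \<Rightarrow> (real \<Rightarrow> 'x) \<Rightarrow> (real \<Rightarrow> 'x) list" where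
  "edge_word X p = (THE es. is_edge_word X p es)"


section \<open>Presentations\<close>

text \<open>The bonding map \<open>f k\<close> goes from \<open>X k\<close> to \<open>X (k - 1)\<close>; \<open>f 0\<close> is not used.\<close>

definition inverse_limit :: "(nat \<Rightarrow> 'x digraph) \<Rightarrow> (nat \<Rightarrow> 'x \<Rightarrow> 'x) \<Rightarrow> (nat \<Rightarrow> 'x) topology" where
  "inverse_limit X f = subtopology (product_topology (\<lambda>k. gtop (X k)) UNIV)
     {x. \<forall>k. f (Suc k) (x (Suc k)) = x k}"

definition is_presentation ::
  "'y topology \<Rightarrow> (nat \<Rightarrow> 'x digraph) \<Rightarrow> (nat \<Rightarrow> 'x \<Rightarrow> 'x) \<Rightarrow> bool" where
  "is_presentation Y X f \<longleftrightarrow>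
     (\<forall>k. is_graph (X k)) \<and>
     (\<forall>k. op_map (X (Suc k)) (X k) (f (Suc k)) \<and>
        f (Suc k) ` topspace (gtop (X (Suc k))) = topspace (gtop (X k)) \<and>
        f (Suc k) ` verts (X (Suc k)) \<subseteq> verts (X k) \<and>
        locally_one_to_one (gtop (X (Suc k)))
          (topspace (gtop (X (Suc k))) - verts (X (Suc k))) (f (Suc k))) \<and>
     (\<exists>h A. homeomorphic_map Y (inverse_limit X f) h \<and> is_orientation Y A \<and>
        (\<forall>k \<gamma>. op_curve Y A \<gamma> \<longrightarrow> op_path (X k) (\<lambda>t. h (\<gamma> t) k)))"

definition bond :: "(nat \<Rightarrow> 'x \<Rightarrow> 'x) \<Rightarrow> nat \<Rightarrow> nat \<Rightarrow> 'x \<Rightarrow> 'x" where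
  "bond f k l = foldr (\<lambda>i. (\<circ>) (f i)) [Suc k..<Suc l] id"

definition simplicity_condition :: "(nat \<Rightarrow> 'x digraph) \<Rightarrow> (nat \<Rightarrow> 'x \<Rightarrow> 'x) \<Rightarrow> bool" where
  "simplicity_condition X f \<longleftrightarrow>
     (\<forall>k\<ge>1. \<exists>\<kappa>\<ge>k. \<forall>l\<ge>\<kappa>. \<forall>e\<in>edges (X l). bond f k l ` e ` {0..1} = topspace (gtop (X k)))"


section \<open>Ordered groups, direct limits and dimension groups\<close>

text \<open>Abelian groups are written multiplicatively: \<open>a \<le> b\<close> reads \<open>inv a \<otimes> b \<in> P\<close>.\<close>

definition preordered_group :: "('a, 'c) monoid_scheme \<Rightarrow> 'a set \<Rightarrow> bool" where
  "preordered_group G P \<longleftrightarrow> comm_group G \<and> submonoid P G \<and> generate G P = carrier G"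

definition ordered_group :: "('a, 'c) monoid_scheme \<Rightarrow> 'a set \<Rightarrow> bool" where
  "ordered_group G P \<longleftrightarrow> preordered_group G P \<and> P \<inter> (\<lambda>a. inv\<^bsub>G\<^esub> a) ` P = {\<one>\<^bsub>G\<^esub>}"

definition order_isomorphic ::
  "('a, 'c) monoid_scheme \<Rightarrow> 'a set \<Rightarrow> ('b, 'd) monoid_scheme \<Rightarrow> 'b set \<Rightarrow> bool" where
  "order_isomorphic G P H Q \<longleftrightarrow> (\<exists>h\<in>iso G H. h ` P = Q)"

text \<open>The direct limit of \<open>G 0 \<rightarrow> G 1 \<rightarrow> \<dots>\<close> with maps \<open>\<phi> k : G k \<rightarrow> G (Suc k)\<close>; its elements are the
  classes of pairs \<open>(k, x)\<close> with \<open>x\<close> in \<open>G k\<close>.\<close>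

definition trans_map :: "(nat \<Rightarrow> 'a \<Rightarrow> 'a) \<Rightarrow> nat \<Rightarrow> nat \<Rightarrow> 'a \<Rightarrow> 'a" where
  "trans_map \<phi> k m = fold \<phi> [k..<m]"

definition dlim_rel ::
  "(nat \<Rightarrow> 'a monoid) \<Rightarrow> (nat \<Rightarrow> 'a \<Rightarrow> 'a) \<Rightarrow> ((nat \<times> 'a) \<times> (nat \<times> 'a)) set" where
  "dlim_rel G \<phi> = {((k, x), (l, y)). x \<in> carrier (G k) \<and> y \<in> carrier (G l) \<and>
     (\<exists>m. k \<le> m \<and> l \<le> m \<and> trans_map \<phi> k m x = trans_map \<phi> l m y)}"

definition dlim :: "(nat \<Rightarrow> 'a monoid) \<Rightarrow> (nat \<Rightarrow> 'a \<Rightarrow> 'a) \<Rightarrow> (nat \<times> 'a) set monoid" where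
  "dlim G \<phi> =
     \<lparr>carrier = (SIGMA k:UNIV. carrier (G k)) // dlim_rel G \<phi>,
      monoid.mult = (\<lambda>A B. \<Union>(k, x)\<in>A. \<Union>(l, y)\<in>B. dlim_rel G \<phi> ``
        {(max k l, trans_map \<phi> k (max k l) x \<otimes>\<^bsub>G (max k l)\<^esub> trans_map \<phi> l (max k l) y)}),
      one = dlim_rel G \<phi> `` {(0, \<one>\<^bsub>G 0\<^esub>)}\<rparr>"

definition dlim_cone ::
  "(nat \<Rightarrow> 'a monoid) \<Rightarrow> (nat \<Rightarrow> 'a \<Rightarrow> 'a) \<Rightarrow> (nat \<Rightarrow> 'a set) \<Rightarrow> (nat \<times> 'a) set set" where
  "dlim_cone G \<phi> P = {dlim_rel G \<phi> `` {(k, x)} | k x. x \<in> P k}"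

definition fun_group :: "'i set \<Rightarrow> ('i \<Rightarrow> int) monoid" where
  "fun_group I = product_group I (\<lambda>_. integer_group)"

definition fun_cone :: "'i set \<Rightarrow> ('i \<Rightarrow> int) set" where
  "fun_cone I = {g \<in> carrier (fun_group I). \<forall>i\<in>I. 0 \<le> g i}"

abbreviation Zgroup :: "nat \<Rightarrow> (nat \<Rightarrow> int) monoid" where
  "Zgroup n \<equiv> fun_group {..<n}"

abbreviation Zcone :: "nat \<Rightarrow> (nat \<Rightarrow> int) set" where
  "Zcone n \<equiv> fun_cone {..<n}"

text \<open>Multiplication of column vectors by the \<open>m \<times> n\<close> matrix \<open>M\<close>.\<close>

definition mat_map :: "nat \<Rightarrow> nat \<Rightarrow> (nat \<Rightarrow> nat \<Rightarrow> int) \<Rightarrow> (nat \<Rightarrow> int) \<Rightarrow> (nat \<Rightarrow> int)" where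
  "mat_map m n M x = (\<lambda>i\<in>{..<m}. \<Sum>j<n. M i j * x j)"

definition dimension_group :: "('a, 'c) monoid_scheme \<Rightarrow> 'a set \<Rightarrow> bool" where
  "dimension_group G P \<longleftrightarrow> ordered_group G P \<and>
     (\<exists>(r :: nat \<Rightarrow> nat) (A :: nat \<Rightarrow> nat \<Rightarrow> nat \<Rightarrow> int).
        (\<forall>k. \<forall>i<r (Suc k). \<forall>j<r k. 0 \<le> A k i j) \<and>
        (let \<phi> = (\<lambda>k. mat_map (r (Suc k)) (r k) (A k)) in
         order_isomorphic G P (dlim (\<lambda>k. Zgroup (r k)) \<phi>)
           (dlim_cone (\<lambda>k. Zgroup (r k)) \<phi> (\<lambda>k. Zcone (r k)))))"

definition order_ideal :: "('a, 'c) monoid_scheme \<Rightarrow> 'a set \<Rightarrow> 'a set \<Rightarrow> bool" where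
  "order_ideal G P H \<longleftrightarrow> subgroup H G \<and> ordered_group (G\<lparr>carrier := H\<rparr>) (H \<inter> P) \<and>
     (\<forall>a\<in>carrier G. \<forall>b\<in>H. a \<in> P \<and> inv\<^bsub>G\<^esub> a \<otimes>\<^bsub>G\<^esub> b \<in> P \<longrightarrow> a \<in> H)"

definition simple_dimension_group :: "('a, 'c) monoid_scheme \<Rightarrow> 'a set \<Rightarrow> bool" where
  "simple_dimension_group G P \<longleftrightarrow> dimension_group G P \<and>
     (\<forall>H. order_ideal G P H \<longrightarrow> H = {\<one>\<^bsub>G\<^esub>} \<or> H = carrier G)"


section \<open>The groups of a presentation\<close>

text \<open>\<open>en k\<close> enumerates the edges of \<open>X k\<close> as \<open>en k 0, \<dots>, en k (n - 1)\<close>. The matrix from level \<open>k\<close>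
  to level \<open>Suc k\<close>, classically indexed by \<open>Suc k\<close>, is \<open>adj_matrix X f en k\<close>.\<close>

definition adj_matrix ::
  "(nat \<Rightarrow> 'x digraph) \<Rightarrow> (nat \<Rightarrow> 'x \<Rightarrow> 'x) \<Rightarrow> (nat \<Rightarrow> nat \<Rightarrow> real \<Rightarrow> 'x) \<Rightarrow> nat \<Rightarrow> nat \<Rightarrow> nat \<Rightarrow> int"
  where
  "adj_matrix X f en k i j =
     int (count_list (edge_word (X k) (f (Suc k) \<circ> en (Suc k) i)) (en k j))"

definition adj_map ::
  "(nat \<Rightarrow> 'x digraph) \<Rightarrow> (nat \<Rightarrow> 'x \<Rightarrow> 'x) \<Rightarrow> (nat \<Rightarrow> nat \<Rightarrow> real \<Rightarrow> 'x) \<Rightarrow> nat \<Rightarrow> (nat \<Rightarrow> int) \<Rightarrow> (nat \<Rightarrow> int)"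
  where
  "adj_map X f en k = mat_map (card (edges (X (Suc k)))) (card (edges (X k))) (adj_matrix X f en k)"

definition edge_group :: "'x digraph \<Rightarrow> ((real \<Rightarrow> 'x) \<Rightarrow> int) monoid" where
  "edge_group X = fun_group (edges X)"

definition edge_cone :: "'x digraph \<Rightarrow> ((real \<Rightarrow> 'x) \<Rightarrow> int) set" where
  "edge_cone X = fun_cone (edges X)"

definition pullback ::
  "(nat \<Rightarrow> 'x digraph) \<Rightarrow> (nat \<Rightarrow> 'x \<Rightarrow> 'x) \<Rightarrow> nat \<Rightarrow> ((real \<Rightarrow> 'x) \<Rightarrow> int) \<Rightarrow> ((real \<Rightarrow> 'x) \<Rightarrow> int)" where
  "pullback X f k g = (\<lambda>e\<in>edges (X (Suc k)). sum_list (map g (edge_word (X k) (f (Suc k) \<circ> e))))"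

definition vertex_fun :: "'x digraph \<Rightarrow> 'x \<Rightarrow> (real \<Rightarrow> 'x) \<Rightarrow> int" where
  "vertex_fun X p = (\<lambda>e\<in>edges X.
     if e 0 = p \<and> e 1 \<noteq> p then 1 else if e 0 \<noteq> p \<and> e 1 = p then -1 else 0)"

definition vertex_subgroup :: "'x digraph \<Rightarrow> ((real \<Rightarrow> 'x) \<Rightarrow> int) set" where
  "vertex_subgroup X = generate (edge_group X) (vertex_fun X ` verts X)"

definition graph_group :: "'x digraph \<Rightarrow> ((real \<Rightarrow> 'x) \<Rightarrow> int) set monoid" where
  "graph_group X = edge_group X Mod vertex_subgroup X"

definition graph_cone :: "'x digraph \<Rightarrow> ((real \<Rightarrow> 'x) \<Rightarrow> int) set set" where
  "graph_cone X = (\<lambda>g. vertex_subgroup X #>\<^bsub>edge_group X\<^esub> g) ` edge_cone X"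

text \<open>The map of cosets induced by \<^const>\<open>pullback\<close>; all members of the union coincide.\<close>

definition graph_map ::
  "(nat \<Rightarrow> 'x digraph) \<Rightarrow> (nat \<Rightarrow> 'x \<Rightarrow> 'x) \<Rightarrow> nat \<Rightarrow>
   ((real \<Rightarrow> 'x) \<Rightarrow> int) set \<Rightarrow> ((real \<Rightarrow> 'x) \<Rightarrow> int) set" where
  "graph_map X f k C =
     (\<Union>g\<in>C. vertex_subgroup (X (Suc k)) #>\<^bsub>edge_group (X (Suc k))\<^esub> pullback X f k g)"

definition limC where
  "limC X f = dlim (\<lambda>k. edge_group (X k)) (pullback X f)"

definition limC_cone where
  "limC_cone X f = dlim_cone (\<lambda>k. edge_group (X k)) (pullback X f) (\<lambda>k. edge_cone (X k))"

definition limG where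
  "limG X f = dlim (\<lambda>k. graph_group (X k)) (graph_map X f)"

definition limG_cone where
  "limG_cone X f = dlim_cone (\<lambda>k. graph_group (X k)) (graph_map X f) (\<lambda>k. graph_cone (X k))"

definition limZ where
  "limZ X f en = dlim (\<lambda>k. Zgroup (card (edges (X k)))) (adj_map X f en)"

definition limZ_cone where
  "limZ_cone X f en = dlim_cone (\<lambda>k. Zgroup (card (edges (X k)))) (adj_map X f en)
     (\<lambda>k. Zcone (card (edges (X k))))"

end

theory Submission
  imports Defs
begin

text \<open>A bonding map sends an edge to a path that is locally one-to-one away from its ends, so it meets
  vertices only finitely often: infinitely many visits near an end would enclose infinitely many full
  edges, contradicting continuity. Hence edge words exist, are unique and are directed paths, pulling
  back is a positive homomorphism, and (1) is a reindexing of edges.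

  For \<open>\<G>\<close> under the Simplicity Condition, let every edge \<open>e\<close> of \<open>X\<^sub>l\<close> cover \<open>X\<^sub>k\<close>, and choose a path
  \<open>q\<^sub>v\<close> without repeated edges in \<open>X\<^sub>k\<close> from the image of each vertex \<open>v\<close> of \<open>X\<^sub>l\<close> to a fixed vertex. The chain
  \<open>z\<^sub>e = f(e) - q\<^bsub>e(0)\<^esub> + q\<^bsub>e(1)\<^esub>\<close> is a nonnegative cycle, and \<open>g \<mapsto> (e \<mapsto> \<langle>g, z\<^sub>e\<rangle>)\<close> vanishes on
  coboundaries and differs from the pullback by a coboundary. So \<open>\<G>\<^sup>k \<rightarrow> \<G>\<^sup>l\<close> factors through
  \<open>C(\<E>\<^sub>l, \<int>)\<close> by positive maps, and the limit of the \<open>\<G>\<^sup>k\<close> is a limit of simplicially ordered groups.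
  Simplicity holds because every nonzero positive element becomes strictly positive on all edges.\<close>

section \<open>Direct limits\<close>

text \<open>The quotients by coboundaries carry no visible simplicial order, and pointedness of
  their cones is not checked level by level. Both matters are settled by a ladder between the groups
  \<open>graph_group (X (\<kappa> i))\<close> and the integer vectors indexed by the edges of
  \<open>X (\<kappa> i)\<close>. One family of rungs is the quotient map, the other is the pairing
  with the cycles. One composite is a nonnegative integer matrix, the other is the bonding
  homomorphism, so the limits are order isomorphic and the order is transported back. The same
  ladder with \<open>\<kappa> i = i\<close> and a mere renaming of edges gives the isomorphism in
  (1).

  The correcting paths must not repeat an edge: the image path is known to run through each edge at
  least once, so one copy of each edge is all that may safely be subtracted. Such paths to the base
  vertex exist because every vertex has an outgoing edge, whose image meets every edge below.

  For edge words the ends of the parameter interval need a separate argument, since a bonding map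
  need not be locally one-to-one at vertices. Local injectivity excludes accumulating visits only at
  interior times.\<close>

lemma trans_map_refl [simp]: "trans_map \<phi> k k x = x"
  by (simp add: trans_map_def)

lemma trans_map_Suc: "k \<le> m \<Longrightarrow> trans_map \<phi> k (Suc m) x = \<phi> m (trans_map \<phi> k m x)"
  by (simp add: trans_map_def)

lemma trans_map_trans:
  assumes "k \<le> l" "l \<le> m"
  shows "trans_map \<phi> l m (trans_map \<phi> k l x) = trans_map \<phi> k m x"
  using assms(2,1)
  by (induction m rule: dec_induct) (auto simp: trans_map_Suc)

locale direct_system =
  fixes G :: "nat \<Rightarrow> 'a monoid" and \<phi> :: "nat \<Rightarrow> 'a \<Rightarrow> 'a"
  assumes comm_group_G: "\<And>k. comm_group (G k)"
    and hom_step: "\<And>k. \<phi> k \<in> hom (G k) (G (Suc k))"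
begin

sublocale G: comm_group "G k" for k
  by (rule comm_group_G)

abbreviation "D \<equiv> dlim G \<phi>"

text \<open>The canonical map from level \<open>k\<close> to the limit.\<close>

definition cls :: "nat \<Rightarrow> 'a \<Rightarrow> (nat \<times> 'a) set" where
  "cls k x = dlim_rel G \<phi> `` {(k, x)}"

lemma trans_map_hom: "k \<le> m \<Longrightarrow> trans_map \<phi> k m \<in> hom (G k) (G m)"
proof (induction m rule: dec_induct)
  case (step m)
  have "trans_map \<phi> k (Suc m) = \<phi> m \<circ> trans_map \<phi> k m"
    using step.hyps by (simp add: fun_eq_iff trans_map_Suc)
  then show ?case
    using hom_compose[OF step.IH hom_step] by (simp only:)
qed (auto simp: hom_def)

lemma trans_map_closed [simp]:
  "k \<le> m \<Longrightarrow> x \<in> carrier (G k) \<Longrightarrow> trans_map \<phi> k m x \<in> carrier (G m)"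
  using trans_map_hom hom_in_carrier by metis

lemma trans_map_mult:
  "k \<le> m \<Longrightarrow> x \<in> carrier (G k) \<Longrightarrow> y \<in> carrier (G k) \<Longrightarrow>
   trans_map \<phi> k m (x \<otimes>\<^bsub>G k\<^esub> y) = trans_map \<phi> k m x \<otimes>\<^bsub>G m\<^esub> trans_map \<phi> k m y"
  using trans_map_hom hom_mult by metis

lemma trans_map_one: "k \<le> m \<Longrightarrow> trans_map \<phi> k m \<one>\<^bsub>G k\<^esub> = \<one>\<^bsub>G m\<^esub>"
  by (rule hom_one[OF trans_map_hom]) (auto simp: G.is_group)

lemma equiv_dlim_rel: "equiv (SIGMA k:UNIV. carrier (G k)) (dlim_rel G \<phi>)"
proof (intro equivI)
  show "dlim_rel G \<phi> \<subseteq> (SIGMA k:UNIV. carrier (G k)) \<times> (SIGMA k:UNIV. carrier (G k))"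
    by (auto simp: dlim_rel_def)
  show "refl_on (SIGMA k:UNIV. carrier (G k)) (dlim_rel G \<phi>)"
    by (auto simp: refl_on_def dlim_rel_def)
  show "sym (dlim_rel G \<phi>)"
    unfolding sym_def dlim_rel_def by fastforce
  show "trans (dlim_rel G \<phi>)"
  proof (rule transI, clarsimp simp: dlim_rel_def)
    fix k x l y j z m m'
    assume *: "k \<le> m" "l \<le> m" "trans_map \<phi> k m x = trans_map \<phi> l m y"
      "l \<le> m'" "j \<le> m'" "trans_map \<phi> l m' y = trans_map \<phi> j m' z"
    \<comment> \<open>Both identifications persist from this stage on, so they can be chained
      there.\<close>
    define M where "M = max m m'"
    have M: "m \<le> M" "m' \<le> M" by (auto simp: M_def)
    have "trans_map \<phi> k M x = trans_map \<phi> l M y"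
      using trans_map_trans[of k m M \<phi> x] trans_map_trans[of l m M \<phi> y] * M by simp
    also have "\<dots> = trans_map \<phi> j M z"
      using trans_map_trans[of l m' M \<phi> y] trans_map_trans[of j m' M \<phi> z] * M by simp
    finally show "\<exists>m\<ge>k. j \<le> m \<and> trans_map \<phi> k m x = trans_map \<phi> j m z"
      using * M by (intro exI[of _ M]) auto
  qed
qed

lemma cls_eq_iff:
  assumes "x \<in> carrier (G k)" "y \<in> carrier (G l)"
  shows "cls k x = cls l y \<longleftrightarrow> (\<exists>m. k \<le> m \<and> l \<le> m \<and> trans_map \<phi> k m x = trans_map \<phi> l m y)"
proof -
  have "cls k x = cls l y \<longleftrightarrow> ((k, x), (l, y)) \<in> dlim_rel G \<phi>"
    unfolding cls_def using assms by (intro eq_equiv_class_iff[OF equiv_dlim_rel]) auto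
  then show ?thesis using assms by (simp add: dlim_rel_def)
qed

lemma cls_trans_map:
  "k \<le> m \<Longrightarrow> x \<in> carrier (G k) \<Longrightarrow> cls m (trans_map \<phi> k m x) = cls k x"
  by (subst cls_eq_iff) auto

lemma carrier_dlim: "carrier D = {cls k x | k x. x \<in> carrier (G k)}"
  by (auto simp: dlim_def quotient_def cls_def)

lemma cls_closed [simp]: "x \<in> carrier (G k) \<Longrightarrow> cls k x \<in> carrier D"
  by (auto simp: carrier_dlim)

lemma mem_clsD:
  assumes "(l, y) \<in> cls k x"
  shows "x \<in> carrier (G k)" "y \<in> carrier (G l)" "cls l y = cls k x"
  using assms equiv_class_eq[OF equiv_dlim_rel, of "(k, x)" "(l, y)"]
  by (auto simp: cls_def dlim_rel_def)

text \<open>\<open>dlim\<close> multiplies by a union over all pairs of representatives. All members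
  of that union are one class, because representatives agree at a late stage and the transition maps
  are homomorphisms.\<close>

lemma cls_mult:
  assumes x: "x \<in> carrier (G k)" and y: "y \<in> carrier (G k)"
  shows "cls k x \<otimes>\<^bsub>D\<^esub> cls k y = cls k (x \<otimes>\<^bsub>G k\<^esub> y)"
proof -
  have const: "cls (max i j) (trans_map \<phi> i (max i j) a \<otimes>\<^bsub>G (max i j)\<^esub> trans_map \<phi> j (max i j) b)
      = cls k (x \<otimes>\<^bsub>G k\<^esub> y)" (is "cls ?m (?a \<otimes>\<^bsub>_\<^esub> ?b) = _")
    if a: "(i, a) \<in> cls k x" and b: "(j, b) \<in> cls k y" for i a j b
  proof -
    note a = mem_clsD[OF a] and b = mem_clsD[OF b]
    from a obtain m1 where m1: "i \<le> m1" "k \<le> m1" "trans_map \<phi> i m1 a = trans_map \<phi> k m1 x"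
      by (auto simp: cls_eq_iff)
    from b obtain m2 where m2: "j \<le> m2" "k \<le> m2" "trans_map \<phi> j m2 b = trans_map \<phi> k m2 y"
      by (auto simp: cls_eq_iff)
    define M where "M = max m1 m2"
    have M: "m1 \<le> M" "m2 \<le> M" by (auto simp: M_def)
    have "trans_map \<phi> ?m M ?a = trans_map \<phi> k M x"
      using trans_map_trans[of i m1 M \<phi> a] trans_map_trans[of k m1 M \<phi> x] m1 m2 M
      by (simp add: trans_map_trans)
    moreover have "trans_map \<phi> ?m M ?b = trans_map \<phi> k M y"
      using trans_map_trans[of j m2 M \<phi> b] trans_map_trans[of k m2 M \<phi> y] m1 m2 M
      by (simp add: trans_map_trans)
    ultimately have "trans_map \<phi> ?m M (?a \<otimes>\<^bsub>G ?m\<^esub> ?b) = trans_map \<phi> k M (x \<otimes>\<^bsub>G k\<^esub> y)"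
      using a b x y m1 m2 M by (simp add: trans_map_mult)
    then show ?thesis
      using a b x y m1 m2 M by (subst cls_eq_iff) (auto intro!: exI[of _ M])
  qed
  have "cls k x \<otimes>\<^bsub>D\<^esub> cls k y = (\<Union>(i, a)\<in>cls k x. \<Union>(j, b)\<in>cls k y.
     cls (max i j) (trans_map \<phi> i (max i j) a \<otimes>\<^bsub>G (max i j)\<^esub> trans_map \<phi> j (max i j) b))"
    by (simp add: dlim_def cls_def)
  also have "\<dots> = (\<Union>(i, a)\<in>cls k x. \<Union>(j, b)\<in>cls k y. cls k (x \<otimes>\<^bsub>G k\<^esub> y))"
    using const by (intro SUP_cong refl) (auto split: prod.splits)
  also have "\<dots> = cls k (x \<otimes>\<^bsub>G k\<^esub> y)"
  proof -
    \<comment> \<open>A union of a constant family is that constant only over a nonempty index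
      set.\<close>
    have "(k, x) \<in> cls k x" "(k, y) \<in> cls k y"
      using x y by (auto simp: cls_def dlim_rel_def)
    then show ?thesis by auto
  qed
  finally show ?thesis .
qed

lemma one_dlim: "\<one>\<^bsub>D\<^esub> = cls k \<one>\<^bsub>G k\<^esub>"
proof -
  have "\<one>\<^bsub>D\<^esub> = cls 0 \<one>\<^bsub>G 0\<^esub>" by (simp add: dlim_def cls_def)
  also have "\<dots> = cls k \<one>\<^bsub>G k\<^esub>"
    using cls_trans_map[of 0 k "\<one>\<^bsub>G 0\<^esub>"] by (simp add: trans_map_one)
  finally show ?thesis .
qed

lemma dlim_cases:
  assumes "a \<in> carrier D"
  obtains k x where "x \<in> carrier (G k)" "a = cls k x"
  using assms by (auto simp: carrier_dlim)

lemma cls_lift: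
  assumes "x \<in> carrier (G k)" "k \<le> m"
  obtains y where "y \<in> carrier (G m)" "cls k x = cls m y"
  using assms cls_trans_map by (metis trans_map_closed)

lemma dlim_cases2:
  assumes "a \<in> carrier D" "b \<in> carrier D"
  obtains k x y where "x \<in> carrier (G k)" "y \<in> carrier (G k)" "a = cls k x" "b = cls k y"
proof -
  obtain k x l y where *: "x \<in> carrier (G k)" "a = cls k x" "y \<in> carrier (G l)" "b = cls l y"
    using assms by (auto simp: carrier_dlim)
  obtain x' where "x' \<in> carrier (G (max k l))" "cls k x = cls (max k l) x'"
    using * by (rule_tac cls_lift[of x k "max k l"]) auto
  moreover obtain y' where "y' \<in> carrier (G (max k l))" "cls l y = cls (max k l) y'"
    using * by (rule_tac cls_lift[of y l "max k l"]) auto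
  ultimately show ?thesis using that * by metis
qed

lemma comm_group_dlim: "comm_group D"
proof (rule comm_groupI)
  fix a b assume "a \<in> carrier D" "b \<in> carrier D"
  then obtain k x y where *: "x \<in> carrier (G k)" "y \<in> carrier (G k)" "a = cls k x" "b = cls k y"
    by (rule dlim_cases2)
  then show "a \<otimes>\<^bsub>D\<^esub> b \<in> carrier D" "a \<otimes>\<^bsub>D\<^esub> b = b \<otimes>\<^bsub>D\<^esub> a"
    by (auto simp: cls_mult G.m_comm)
next
  fix a b c assume "a \<in> carrier D" "b \<in> carrier D" and c: "c \<in> carrier D"
  then obtain k x y where *: "x \<in> carrier (G k)" "y \<in> carrier (G k)" "a = cls k x" "b = cls k y"
    by (rule_tac dlim_cases2)
  obtain l z where z: "z \<in> carrier (G l)" "c = cls l z"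
    using c by (rule dlim_cases)
  define m where "m = max k l"
  have m: "k \<le> m" "l \<le> m" by (auto simp: m_def)
  obtain x' where "x' \<in> carrier (G m)" "a = cls m x'" using * m cls_lift by metis
  moreover obtain y' where "y' \<in> carrier (G m)" "b = cls m y'" using * m cls_lift by metis
  moreover obtain z' where "z' \<in> carrier (G m)" "c = cls m z'" using z m cls_lift by metis
  ultimately show "a \<otimes>\<^bsub>D\<^esub> b \<otimes>\<^bsub>D\<^esub> c = a \<otimes>\<^bsub>D\<^esub> (b \<otimes>\<^bsub>D\<^esub> c)"
    by (auto simp: cls_mult G.m_assoc)
next
  fix a assume "a \<in> carrier D"
  then obtain k x where *: "x \<in> carrier (G k)" "a = cls k x" by (rule dlim_cases)
  then show "\<one>\<^bsub>D\<^esub> \<otimes>\<^bsub>D\<^esub> a = a" by (simp add: one_dlim[of k] cls_mult)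
  show "\<exists>b\<in>carrier D. b \<otimes>\<^bsub>D\<^esub> a = \<one>\<^bsub>D\<^esub>"
    using * by (intro bexI[of _ "cls k (inv\<^bsub>G k\<^esub> x)"]) (auto simp: one_dlim[of k] cls_mult)
qed (simp add: one_dlim[of 0])

sublocale D: comm_group D
  by (rule comm_group_dlim)

lemma cls_inv: "x \<in> carrier (G k) \<Longrightarrow> inv\<^bsub>D\<^esub> (cls k x) = cls k (inv\<^bsub>G k\<^esub> x)"
  by (intro D.inv_equality) (auto simp: cls_mult one_dlim[of k])

lemma cls_pow: "x \<in> carrier (G k) \<Longrightarrow> cls k x [^]\<^bsub>D\<^esub> (n::nat) = cls k (x [^]\<^bsub>G k\<^esub> n)"
  by (induction n) (auto simp: cls_mult one_dlim[of k])

end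

text \<open>\<open>P_diff\<close> is the generation requirement of a preordered group written as
  differences, a form that passes to the limit one element at a time.\<close>

locale ordered_system = direct_system +
  fixes P :: "nat \<Rightarrow> 'a set"
  assumes submonoid_P: "\<And>k. submonoid (P k) (G k)"
    and P_step: "\<And>k x. x \<in> P k \<Longrightarrow> \<phi> k x \<in> P (Suc k)"
    and P_diff: "\<And>k x. x \<in> carrier (G k) \<Longrightarrow> \<exists>a\<in>P k. \<exists>b\<in>P k. x = a \<otimes>\<^bsub>G k\<^esub> inv\<^bsub>G k\<^esub> b"
begin

abbreviation "DP \<equiv> dlim_cone G \<phi> P"

lemma P_carrier: "x \<in> P k \<Longrightarrow> x \<in> carrier (G k)"
  using submonoid.subset[OF submonoid_P] by blast

lemma trans_map_P: "k \<le> m \<Longrightarrow> x \<in> P k \<Longrightarrow> trans_map \<phi> k m x \<in> P m"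
  by (induction m rule: dec_induct) (auto simp: trans_map_Suc P_step)

lemma dlim_cone_eq: "DP = {cls k x | k x. x \<in> P k}"
  by (auto simp: dlim_cone_def cls_def)

lemma cls_in_cone: "x \<in> P k \<Longrightarrow> cls k x \<in> DP"
  by (auto simp: dlim_cone_eq)

lemma cone_cases:
  assumes "a \<in> DP" obtains k x where "x \<in> P k" "a = cls k x"
  using assms by (auto simp: dlim_cone_eq)

lemma cone_cases2:
  assumes "a \<in> DP" "b \<in> DP"
  obtains k x y where "x \<in> P k" "y \<in> P k" "a = cls k x" "b = cls k y"
proof -
  obtain k x l y where *: "x \<in> P k" "a = cls k x" "y \<in> P l" "b = cls l y"
    using assms by (auto simp: dlim_cone_eq)
  show ?thesis
    by (rule that[of "trans_map \<phi> k (max k l) x" "max k l" "trans_map \<phi> l (max k l) y"])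
      (use * in \<open>auto simp: cls_trans_map trans_map_P P_carrier\<close>)
qed

lemma cone_carrier: "DP \<subseteq> carrier D"
  by (auto simp: dlim_cone_eq P_carrier)

lemma preordered_dlim: "preordered_group D DP"
  unfolding preordered_group_def
proof (intro conjI comm_group_dlim)
  show "submonoid DP D"
  proof
    show "DP \<subseteq> carrier D" by (rule cone_carrier)
    show "\<one>\<^bsub>D\<^esub> \<in> DP"
      using one_dlim[of 0] submonoid.one_closed[OF submonoid_P] by (auto simp: cls_in_cone)
    fix a b assume "a \<in> DP" "b \<in> DP"
    then obtain k x y where "x \<in> P k" "y \<in> P k" "a = cls k x" "b = cls k y"
      by (rule cone_cases2)
    then show "a \<otimes>\<^bsub>D\<^esub> b \<in> DP"
      using submonoid.m_closed[OF submonoid_P] by (auto simp: cls_mult P_carrier intro!: cls_in_cone)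
  qed
  show "generate D DP = carrier D"
  proof
    show "generate D DP \<subseteq> carrier D"
      by (rule D.generate_incl[OF cone_carrier])
    show "carrier D \<subseteq> generate D DP"
    proof
      fix a assume "a \<in> carrier D"
      then obtain k x where *: "x \<in> carrier (G k)" "a = cls k x" by (rule dlim_cases)
      then obtain b c where "b \<in> P k" "c \<in> P k" "x = b \<otimes>\<^bsub>G k\<^esub> inv\<^bsub>G k\<^esub> c"
        using P_diff by blast
      then show "a \<in> generate D DP"
        using * generate.eng[OF generate.incl[of "cls k b" DP D] generate.inv[of "cls k c" DP D]]
        by (auto simp: cls_in_cone P_carrier cls_inv cls_mult)
    qed
  qed
qed

text \<open>An equation between classes already holds between representatives at some later stage,
  where pointedness of that level applies.\<close>

lemma ordered_dlim:
  assumes pointed: "\<And>k x y. x \<in> P k \<Longrightarrow> y \<in> P k \<Longrightarrow> x = inv\<^bsub>G k\<^esub> y \<Longrightarrow> x = \<one>\<^bsub>G k\<^esub>"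
  shows "ordered_group D DP"
proof -
  have *: "cls k x = \<one>\<^bsub>D\<^esub>" if x: "x \<in> P k" and y: "y \<in> P k" and eq: "cls k x = inv\<^bsub>D\<^esub> (cls k y)" for k x y
  proof -
    obtain m where m: "k \<le> m" "trans_map \<phi> k m x = trans_map \<phi> k m (inv\<^bsub>G k\<^esub> y)"
      using x y eq by (auto simp: cls_inv P_carrier cls_eq_iff)
    interpret h: group_hom "G k" "G m" "trans_map \<phi> k m"
      using trans_map_hom[OF m(1)] by unfold_locales
    have "trans_map \<phi> k m x = inv\<^bsub>G m\<^esub> (trans_map \<phi> k m y)"
      using m y by (simp add: P_carrier)
    then have "trans_map \<phi> k m x = \<one>\<^bsub>G m\<^esub>"
      using pointed trans_map_P x y m by metis
    then show ?thesis
      using cls_trans_map[OF m(1)] x P_carrier one_dlim by metis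
  qed
  then have "DP \<inter> (\<lambda>a. inv\<^bsub>D\<^esub> a) ` DP \<subseteq> {\<one>\<^bsub>D\<^esub>}"
  proof (intro subsetI, elim IntE imageE)
    fix a b assume "a \<in> DP" "b \<in> DP" "a = inv\<^bsub>D\<^esub> b"
    then show "a \<in> {\<one>\<^bsub>D\<^esub>}"
      using cone_cases2[of a b] * by (metis singletonI)
  qed
  moreover have "\<one>\<^bsub>D\<^esub> \<in> DP"
    using preordered_dlim submonoid.one_closed by (auto simp: preordered_group_def)
  ultimately show ?thesis
    using preordered_dlim by (force simp: ordered_group_def)
qed

end

section \<open>Transport of orders and a criterion for simplicity\<close>

lemma ordered_group_transfer:
  assumes G: "preordered_group G P" and H: "ordered_group H Q" and iso: "order_isomorphic G P H Q"
  shows "ordered_group G P"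
proof -
  obtain h where h: "h \<in> iso G H" "h ` P = Q"
    using iso by (auto simp: order_isomorphic_def)
  interpret G: comm_group G using G by (simp add: preordered_group_def)
  interpret H: comm_group H using H by (simp add: ordered_group_def preordered_group_def)
  interpret h: group_hom G H h
    using h by unfold_locales (auto simp: iso_def)
  have P: "submonoid P G" using G by (simp add: preordered_group_def)
  then have sub: "P \<subseteq> carrier G" by (rule submonoid.subset)
  have inj: "inj_on h (carrier G)" using h by (auto simp: iso_def bij_betw_def)
  have "a = \<one>\<^bsub>G\<^esub>" if "a \<in> P" "b \<in> P" "a = inv\<^bsub>G\<^esub> b" for a b
  proof -
    have "h a \<in> Q" "h b \<in> Q" using h(2) that by auto
    moreover have "h a = inv\<^bsub>H\<^esub> (h b)" using that sub by (auto simp: subset_eq)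
    ultimately have "h a = \<one>\<^bsub>H\<^esub>" using H unfolding ordered_group_def by blast
    then have "h a = h \<one>\<^bsub>G\<^esub>" by simp
    then show ?thesis using inj that sub by (meson G.one_closed inj_onD subsetD)
  qed
  then have "P \<inter> (\<lambda>a. inv\<^bsub>G\<^esub> a) ` P \<subseteq> {\<one>\<^bsub>G\<^esub>}" by auto
  moreover have "\<one>\<^bsub>G\<^esub> \<in> P" by (rule submonoid.one_closed[OF P])
  ultimately show ?thesis using G by (force simp: ordered_group_def)
qed

text \<open>The hypothesis makes every nonzero positive element an order unit. An ideal containing
  one contains the whole cone by convexity, hence the group.\<close>

lemma simple_if_order_units:
  assumes G: "ordered_group G P"
    and unit: "\<And>a b. a \<in> P \<Longrightarrow> b \<in> P \<Longrightarrow> a \<noteq> \<one>\<^bsub>G\<^esub> \<Longrightarrow> \<exists>n::nat. inv\<^bsub>G\<^esub> b \<otimes>\<^bsub>G\<^esub> a [^]\<^bsub>G\<^esub> n \<in> P"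
    and H: "order_ideal G P H"
  shows "H = {\<one>\<^bsub>G\<^esub>} \<or> H = carrier G"
proof (rule disjCI)
  assume nt: "H \<noteq> carrier G"
  interpret G: comm_group G using G by (simp add: ordered_group_def preordered_group_def)
  interpret H: subgroup H G using H by (simp add: order_ideal_def)
  have P: "P \<subseteq> carrier G"
    using G submonoid.subset by (auto simp: ordered_group_def preordered_group_def)
  have "a = \<one>\<^bsub>G\<^esub>" if a: "a \<in> H" "a \<in> P" for a
  proof (rule ccontr)
    assume "a \<noteq> \<one>\<^bsub>G\<^esub>"
    have "P \<subseteq> H"
    proof
      fix b assume b: "b \<in> P"
      then obtain n :: nat where "inv\<^bsub>G\<^esub> b \<otimes>\<^bsub>G\<^esub> a [^]\<^bsub>G\<^esub> n \<in> P"
        using unit a \<open>a \<noteq> \<one>\<^bsub>G\<^esub>\<close> by blast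
      moreover have "a [^]\<^bsub>G\<^esub> n \<in> H"
        by (induction n) (use a in auto)
      ultimately show "b \<in> H"
        using H b P unfolding order_ideal_def by blast
    qed
    then have "generate G P \<subseteq> H"
      by (rule G.generate_subgroup_incl[OF _ H.subgroup_axioms])
    then have "H = carrier G"
      using G H.subset by (auto simp: ordered_group_def preordered_group_def)
    with nt show False ..
  qed
  then have "H \<inter> P \<subseteq> {\<one>\<^bsub>G\<^esub>}" by auto
  interpret K: group "G\<lparr>carrier := H\<rparr>"
    by (rule H.subgroup_is_group[OF G.is_group])
  \<comment> \<open>An order ideal is an ordered group in its own right, so it is generated by its
    positive part, which is trivial here.\<close>
  have "generate (G\<lparr>carrier := H\<rparr>) (H \<inter> P) = H"
    using H by (simp add: order_ideal_def ordered_group_def preordered_group_def)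
  moreover have "generate (G\<lparr>carrier := H\<rparr>) (H \<inter> P) \<subseteq> {\<one>\<^bsub>G\<^esub>}"
    using K.generate_subgroup_incl[OF \<open>H \<inter> P \<subseteq> {\<one>\<^bsub>G\<^esub>}\<close>] K.triv_subgroup by simp
  ultimately show "H = {\<one>\<^bsub>G\<^esub>}" using H.one_closed by auto
qed

text \<open>The ladder argument: \<open>\<beta>\<close> and \<open>\<sigma>\<close> zigzag between
  \<open>H\<close> and a cofinal part of \<open>G\<close>. The triangle
  \<open>\<sigma>\<beta>\<close> makes the map induced by \<open>\<beta>\<close> injective, the
  triangle \<open>\<beta>\<sigma>\<close> makes it surjective, and positivity of both matches the
  cones.\<close>

lemma order_isomorphic_intertwine:
  assumes G: "ordered_system G \<phi> P" and H: "ordered_system H \<psi> Q" and \<kappa>: "strict_mono \<kappa>"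
    and \<beta>: "\<And>i. \<beta> i \<in> hom (H i) (G (\<kappa> i))" and \<sigma>: "\<And>i. \<sigma> i \<in> hom (G (\<kappa> i)) (H (Suc i))"
    and \<sigma>\<beta>: "\<And>i x. x \<in> carrier (H i) \<Longrightarrow> \<sigma> i (\<beta> i x) = \<psi> i x"
    and \<beta>\<sigma>: "\<And>i y. y \<in> carrier (G (\<kappa> i)) \<Longrightarrow> \<beta> (Suc i) (\<sigma> i y) = trans_map \<phi> (\<kappa> i) (\<kappa> (Suc i)) y"
    and \<beta>_pos: "\<And>i x. x \<in> Q i \<Longrightarrow> \<beta> i x \<in> P (\<kappa> i)"
    and \<sigma>_pos: "\<And>i y. y \<in> P (\<kappa> i) \<Longrightarrow> \<sigma> i y \<in> Q (Suc i)"
  shows "order_isomorphic (dlim G \<phi>) (dlim_cone G \<phi> P) (dlim H \<psi>) (dlim_cone H \<psi> Q)"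
proof -
  interpret G: ordered_system G \<phi> P by fact
  interpret H: ordered_system H \<psi> Q by fact
  have \<kappa>_le: "\<kappa> i \<le> \<kappa> j" if "i \<le> j" for i j
    using \<kappa> that by (simp add: strict_mono_less_eq)
  \<comment> \<open>Cofinality of the chosen levels.\<close>
  have \<kappa>_ge: "i \<le> \<kappa> i" for i using \<kappa> by (rule strict_mono_imp_increasing)
  have \<beta>_carrier [simp]: "\<beta> i x \<in> carrier (G (\<kappa> i))" if "x \<in> carrier (H i)" for i x
    using hom_in_carrier[OF \<beta>] that .
  have \<sigma>_carrier [simp]: "\<sigma> i y \<in> carrier (H (Suc i))" if "y \<in> carrier (G (\<kappa> i))" for i y
    using hom_in_carrier[OF \<sigma>] that .
  have \<beta>_trans: "\<beta> m (trans_map \<psi> i m x) = trans_map \<phi> (\<kappa> i) (\<kappa> m) (\<beta> i x)"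
    if "i \<le> m" "x \<in> carrier (H i)" for i m x
    using that
  proof (induction m rule: dec_induct)
    case (step m)
    have "\<beta> (Suc m) (trans_map \<psi> i (Suc m) x) = \<beta> (Suc m) (\<sigma> m (\<beta> m (trans_map \<psi> i m x)))"
      using step.hyps step.prems by (simp add: trans_map_Suc \<sigma>\<beta>)
    also have "\<dots> = trans_map \<phi> (\<kappa> m) (\<kappa> (Suc m)) (\<beta> m (trans_map \<psi> i m x))"
      using step.hyps step.prems by (intro \<beta>\<sigma>) auto
    finally show ?case
      using step by (simp add: trans_map_trans \<kappa>_le)
  qed auto
  have cls_iff: "H.cls i x = H.cls j y \<longleftrightarrow> G.cls (\<kappa> i) (\<beta> i x) = G.cls (\<kappa> j) (\<beta> j y)"
    if x: "x \<in> carrier (H i)" and y: "y \<in> carrier (H j)" for i j x y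
  proof
    assume "H.cls i x = H.cls j y"
    then obtain m where m: "i \<le> m" "j \<le> m" "trans_map \<psi> i m x = trans_map \<psi> j m y"
      using x y by (auto simp: H.cls_eq_iff)
    then have "trans_map \<phi> (\<kappa> i) (\<kappa> m) (\<beta> i x) = trans_map \<phi> (\<kappa> j) (\<kappa> m) (\<beta> j y)"
      using \<beta>_trans x y by metis
    then show "G.cls (\<kappa> i) (\<beta> i x) = G.cls (\<kappa> j) (\<beta> j y)"
      using x y m \<kappa>_le by (subst G.cls_eq_iff) auto
  next
    assume "G.cls (\<kappa> i) (\<beta> i x) = G.cls (\<kappa> j) (\<beta> j y)"
    then obtain n where n: "\<kappa> i \<le> n" "\<kappa> j \<le> n"
      "trans_map \<phi> (\<kappa> i) n (\<beta> i x) = trans_map \<phi> (\<kappa> j) n (\<beta> j y)"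
      using x y by (auto simp: G.cls_eq_iff)
    \<comment> \<open>The equality is known at a level \<open>n\<close> that need not be a value of
      \<open>\<kappa>\<close>. It is pushed up to \<open>\<kappa> m\<close> and then into
      \<open>H\<close> by \<open>\<sigma> m\<close>, which costs one more level.\<close>
    define m where "m = max n (max i j)"
    have m: "i \<le> m" "j \<le> m" "n \<le> \<kappa> m"
      using \<kappa>_ge[of m] by (auto simp: m_def)
    have "\<beta> m (trans_map \<psi> i m x) = \<beta> m (trans_map \<psi> j m y)"
      using n m x y trans_map_trans[of "\<kappa> i" n "\<kappa> m" \<phi> "\<beta> i x"]
        trans_map_trans[of "\<kappa> j" n "\<kappa> m" \<phi> "\<beta> j y"] by (simp add: \<beta>_trans)
    then have "\<sigma> m (\<beta> m (trans_map \<psi> i m x)) = \<sigma> m (\<beta> m (trans_map \<psi> j m y))"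
      by simp
    then have "trans_map \<psi> i (Suc m) x = trans_map \<psi> j (Suc m) y"
      using m x y by (simp add: \<sigma>\<beta> trans_map_Suc)
    then show "H.cls i x = H.cls j y"
      using m x y by (subst H.cls_eq_iff) (auto intro!: exI[of _ "Suc m"])
  qed
  \<comment> \<open>A representative is picked arbitrarily; \<open>cls_iff\<close> shows that the
    choice does not matter.\<close>
  define h where "h A = (let (i, x) = (SOME p. p \<in> A) in G.cls (\<kappa> i) (\<beta> i x))" for A
  have h: "h (H.cls i x) = G.cls (\<kappa> i) (\<beta> i x)" if x: "x \<in> carrier (H i)" for i x
  proof -
    obtain j y where jy: "(SOME p. p \<in> H.cls i x) = (j, y)" by fastforce
    have "(i, x) \<in> H.cls i x"
      using x by (auto simp: H.cls_def dlim_rel_def)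
    then have "(j, y) \<in> H.cls i x"
      unfolding jy[symmetric] by (rule someI)
    from H.mem_clsD[OF this] show ?thesis
      using jy cls_iff x by (simp add: h_def)
  qed
  \<comment> \<open>Surjectivity: a class is pushed to the next chosen level, sent across by
    \<open>\<sigma>\<close>, and \<open>\<beta>\<sigma>\<close> returns it unchanged in the
    limit.\<close>
  have G_cls: "G.cls l y = h (H.cls (Suc l) (\<sigma> l (trans_map \<phi> l (\<kappa> l) y)))"
    if y: "y \<in> carrier (G l)" for l y
  proof -
    have *: "trans_map \<phi> l (\<kappa> l) y \<in> carrier (G (\<kappa> l))"
      using y \<kappa>_ge by simp
    then have "h (H.cls (Suc l) (\<sigma> l (trans_map \<phi> l (\<kappa> l) y)))
        = G.cls (\<kappa> (Suc l)) (trans_map \<phi> (\<kappa> l) (\<kappa> (Suc l)) (trans_map \<phi> l (\<kappa> l) y))"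
      by (simp add: h \<beta>\<sigma>)
    also have "\<dots> = G.cls l y"
      using * y by (simp add: G.cls_trans_map \<kappa>_le \<kappa>_ge)
    finally show ?thesis ..
  qed
  have hom: "h \<in> hom H.D G.D"
  proof (rule homI)
    fix a assume "a \<in> carrier H.D"
    then show "h a \<in> carrier G.D" by (auto elim!: H.dlim_cases simp: h)
  next
    fix a b assume "a \<in> carrier H.D" "b \<in> carrier H.D"
    then obtain k x y where *: "x \<in> carrier (H k)" "y \<in> carrier (H k)" "a = H.cls k x" "b = H.cls k y"
      by (rule H.dlim_cases2)
    then show "h (a \<otimes>\<^bsub>H.D\<^esub> b) = h a \<otimes>\<^bsub>G.D\<^esub> h b"
      by (simp add: H.cls_mult h G.cls_mult hom_mult[OF \<beta>])
  qed
  have inj: "inj_on h (carrier H.D)"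
  proof (rule inj_onI)
    fix a b assume ab: "a \<in> carrier H.D" "b \<in> carrier H.D" "h a = h b"
    obtain k x l y where "x \<in> carrier (H k)" "a = H.cls k x" "y \<in> carrier (H l)" "b = H.cls l y"
      using ab H.dlim_cases by metis
    with ab show "a = b" by (simp add: h cls_iff)
  qed
  have "h ` carrier H.D = carrier G.D"
  proof
    show "h ` carrier H.D \<subseteq> carrier G.D" using hom by (auto simp: hom_def)
    show "carrier G.D \<subseteq> h ` carrier H.D"
      using \<kappa>_ge by (auto elim!: G.dlim_cases simp: G_cls)
  qed
  with hom inj have iso: "h \<in> iso H.D G.D"
    by (auto simp: iso_def bij_betw_def)
  have "h ` H.DP = G.DP"
  proof
    show "h ` H.DP \<subseteq> G.DP"
      by (auto elim!: H.cone_cases simp: h H.P_carrier intro!: G.cls_in_cone \<beta>_pos)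
    show "G.DP \<subseteq> h ` H.DP"
    proof
      fix a assume "a \<in> G.DP"
      then obtain l y where y: "y \<in> P l" "a = G.cls l y" by (rule G.cone_cases)
      then have "H.cls (Suc l) (\<sigma> l (trans_map \<phi> l (\<kappa> l) y)) \<in> H.DP"
        by (intro H.cls_in_cone \<sigma>_pos G.trans_map_P \<kappa>_ge)
      then show "a \<in> h ` H.DP"
        using y by (auto simp: G_cls G.P_carrier)
    qed
  qed
  \<comment> \<open>The map was built from \<open>H\<close> to \<open>G\<close>; the claim asks for
    the opposite direction.\<close>
  then have "inv_into (carrier H.D) h ` G.DP = H.DP"
    using inj H.cone_carrier by (metis inv_into_image_cancel)
  then show ?thesis
    unfolding order_isomorphic_def
    using H.D.iso_set_sym[OF iso] by blast
qed

section \<open>Edge words\<close>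

text \<open>Directed walks: edges are traversed forwards only, whereas \<open>is_edge_word\<close>
  allows either direction.\<close>

fun edge_path :: "'x digraph \<Rightarrow> 'x \<Rightarrow> (real \<Rightarrow> 'x) list \<Rightarrow> 'x \<Rightarrow> bool" where
  "edge_path X u [] v \<longleftrightarrow> u = v"
| "edge_path X u (e # es) v \<longleftrightarrow> e \<in> edges X \<and> e 0 = u \<and> edge_path X (e 1) es v"

lemma edge_path_append:
  "edge_path X u (es @ es') v \<longleftrightarrow> (\<exists>w. edge_path X u es w \<and> edge_path X w es' v)"
  by (induction es arbitrary: u) auto

lemma edge_path_edges: "edge_path X u es v \<Longrightarrow> set es \<subseteq> edges X"
  by (induction es arbitrary: u) auto

lemma edge_path_nthI:
  assumes "length ts = Suc (length es)"
    and "\<And>i. i < length es \<Longrightarrow> es ! i \<in> edges X \<and> (es ! i) 0 = q (ts ! i) \<and> (es ! i) 1 = q (ts ! Suc i)"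
  shows "edge_path X (q (ts ! 0)) es (q (ts ! length es))"
  using assms
proof (induction es arbitrary: ts)
  case (Cons e es)
  obtain t ts' where ts: "ts = t # ts'" using Cons.prems(1) by (cases ts) auto
  have "edge_path X (q (ts' ! 0)) es (q (ts' ! length es))"
  proof (rule Cons.IH)
    fix i assume "i < length es"
    then show "es ! i \<in> edges X \<and> (es ! i) 0 = q (ts' ! i) \<and> (es ! i) 1 = q (ts' ! Suc i)"
      using Cons.prems(2)[of "Suc i"] ts by simp
  qed (use Cons.prems ts in simp)
  then show ?case
    using Cons.prems(2)[of 0] ts by simp
qed simp

text \<open>A homeomorphism of compact intervals is strictly monotone, so ends go to ends. Which end
  goes where stays open, because \<open>is_edge_word\<close> permits reversal.\<close>

lemma homeomorphic_map_interval:
  fixes \<phi> :: "real \<Rightarrow> real"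
  assumes h: "homeomorphic_map (top_of_set {a..b}) (top_of_set {0..1}) \<phi>" and ab: "a < b"
  shows "\<phi> a \<in> {0, 1}" "\<phi> b \<in> {0, 1}" "\<phi> ` {a<..<b} = {0<..<1}"
proof -
  have cont: "continuous_on {a..b} \<phi>" and inj: "inj_on \<phi> {a..b}" and im: "\<phi> ` {a..b} = {0..1}"
    using homeomorphic_imp_continuous_map[OF h] homeomorphic_imp_injective_map[OF h]
      homeomorphic_imp_surjective_map[OF h] by auto
  have "{a..b} = insert a (insert b {a<..<b})" using ab by auto
  then have *: "insert (\<phi> a) (insert (\<phi> b) (\<phi> ` {a<..<b})) = {0..1}" using im by (metis image_insert)
  have notin: "\<phi> a \<notin> \<phi> ` {a<..<b}" "\<phi> b \<notin> \<phi> ` {a<..<b}" "\<phi> a \<noteq> \<phi> b"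
    using ab inj_onD[OF inj] by fastforce+
  have ends: "\<phi> a \<in> {0, 1} \<and> \<phi> b \<in> {0, 1}"
  proof -
    have "strict_mono_on {a..b} \<phi> \<or> strict_antimono_on {a..b} \<phi>"
      using injective_eq_monotone_map[of "{a..b}" \<phi>] cont inj by simp
    moreover obtain s t where st: "s \<in> {a..b}" "t \<in> {a..b}" "\<phi> s = 0" "\<phi> t = 1"
      using im by (metis imageE atLeastAtMost_iff order_refl zero_le_one)
    moreover have "\<phi> a \<in> {0..1}" "\<phi> b \<in> {0..1}" using * by auto
    ultimately show ?thesis
    proof (elim disjE)
      assume "strict_mono_on {a..b} \<phi>"
      then have "\<phi> a \<le> \<phi> s" "\<phi> t \<le> \<phi> b"
        using st ab strict_mono_on_leD by fastforce+
      then show ?thesis using \<open>\<phi> a \<in> {0..1}\<close> \<open>\<phi> b \<in> {0..1}\<close> st by auto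
    next
      assume m: "strict_antimono_on {a..b} \<phi>"
      have "\<phi> t \<le> \<phi> a"
        using m st(2) ab by (cases "a = t") (auto simp: monotone_on_def intro: less_imp_le)
      moreover have "\<phi> b \<le> \<phi> s"
        using m st(1) ab by (cases "b = s") (auto simp: monotone_on_def intro: less_imp_le)
      ultimately show ?thesis using \<open>\<phi> a \<in> {0..1}\<close> \<open>\<phi> b \<in> {0..1}\<close> st by auto
    qed
  qed
  then show "\<phi> a \<in> {0, 1}" "\<phi> b \<in> {0, 1}" by auto
  show "\<phi> ` {a<..<b} = {0<..<1}"
  proof -
    have "\<phi> ` {a<..<b} = {0..1} - {\<phi> a, \<phi> b}"
      unfolding *[symmetric] using notin by blast
    also have "{\<phi> a, \<phi> b} = {0, 1}" using ends notin(3) by auto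
    also have "{0..1} - {0, 1} = {0<..<1::real}" by auto
    finally show ?thesis .
  qed
qed

section \<open>Topology of a finite directed graph\<close>

locale digraph =
  fixes X :: "'x digraph"
  assumes graph: "is_graph X"
begin

lemma Hausdorff: "Hausdorff_space (gtop X)"
  and finite_verts: "finite (verts X)"
  and finite_edges: "finite (edges X)"
  using graph by (auto simp: is_graph_def)

lemma
  assumes "e \<in> edges X"
  shows edge_pathin: "pathin (gtop X) e"
    and edge_source: "e 0 \<in> verts X" and edge_target: "e 1 \<in> verts X"
    and edge_inj: "inj_on e {0<..<1}"
  using graph assms by (auto simp: is_graph_def)

lemma edge_interior: "e \<in> edges X \<Longrightarrow> t \<in> {0<..<1} \<Longrightarrow> e t \<notin> verts X"
  using graph unfolding is_graph_def by blast

lemma edge_topspace: "e \<in> edges X \<Longrightarrow> t \<in> {0..1} \<Longrightarrow> e t \<in> topspace (gtop X)"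
  using graph unfolding is_graph_def by blast

lemma outgoing_edge: "v \<in> verts X \<Longrightarrow> \<exists>e\<in>edges X. e 0 = v"
  using graph by (auto simp: is_graph_def)

lemma verts_topspace: "verts X \<subseteq> topspace (gtop X)"
  using graph by (auto simp: is_graph_def)

lemma topspace_cases:
  assumes "x \<in> topspace (gtop X)"
  shows "x \<in> verts X \<or> (\<exists>e\<in>edges X. x \<in> e ` {0<..<1})"
proof -
  have "x \<in> verts X \<or> (\<exists>e\<in>edges X. \<exists>t\<in>{0..1}. x = e t)"
    using assms graph by (auto simp: is_graph_def)
  then show ?thesis
  proof (elim disjE bexE)
    fix e t assume *: "e \<in> edges X" "t \<in> {0..1::real}" "x = e t"
    then consider "t = 0" | "t = 1" | "t \<in> {0<..<1}" by fastforce
    then show ?thesis using * edge_source edge_target by cases blast+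
  qed simp
qed

text \<open>Only one parameter is assumed interior: the other cannot be an end, since ends are
  vertices and interior points are not. This identifies edges from their midpoints later on.\<close>

lemma edge_point_unique:
  assumes "e \<in> edges X" "e' \<in> edges X" "s \<in> {0<..<1}" "t \<in> {0..1}" "e s = e' t"
  shows "e = e' \<and> s = t"
proof -
  have "e' t \<notin> verts X" using edge_interior assms by metis
  then have "t \<noteq> 0" "t \<noteq> 1" using edge_source edge_target assms(2) by metis+
  then have t: "t \<in> {0<..<1}" using assms by auto
  then have "e = e'"
    using graph assms unfolding is_graph_def by blast
  then show ?thesis
    using inj_onD[OF edge_inj[OF assms(1)], of s t] t assms by auto
qed

lemma edge_params_inj: "e \<in> edges X \<Longrightarrow> inj_on e (edge_params e)"
proof (rule inj_onI)
  fix s t assume *: "e \<in> edges X" "s \<in> edge_params e" "t \<in> edge_params e" "e s = e t"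
  then consider "s \<in> {0<..<1}" "t \<in> {0..1}" | "t \<in> {0<..<1}" "s \<in> {0..1}"
    | "e 0 \<noteq> e 1" "s \<in> {0, 1}" "t \<in> {0, 1}"
    by (fastforce simp: edge_params_def split: if_splits)
  then show "s = t"
  proof cases
    case 1 then show ?thesis using edge_point_unique * by blast
  next
    case 2 then show ?thesis using edge_point_unique[of e e t s] * by simp
  next
    case 3 then show ?thesis using * by auto
  qed
qed

lemma closedin_finite: "finite S \<Longrightarrow> S \<subseteq> topspace (gtop X) \<Longrightarrow> closedin (gtop X) S"
  using Hausdorff Hausdorff_imp_t1_space t1_space_closedin_finite by metis

lemma closedin_edge_image:
  assumes "e \<in> edges X" "compact K" "K \<subseteq> {0..1}"
  shows "closedin (gtop X) (e ` K)"
proof -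
  have "compactin (top_of_set {0..1}) K"
    using assms by (simp add: compactin_subtopology)
  then have "compactin (gtop X) (e ` K)"
    using image_compactin edge_pathin[OF assms(1)] unfolding pathin_def by blast
  then show ?thesis
    using compactin_imp_closedin Hausdorff by blast
qed

text \<open>The complement is a finite union of compact arcs and vertices, closed by the Hausdorff
  property. This is what gives the graph its expected topology.\<close>

lemma openin_edge_image:
  assumes e: "e \<in> edges X" and U: "open U" "U \<subseteq> {0<..<1}"
  shows "openin (gtop X) (e ` U)"
proof -
  have comp: "compact ({0..1} - U)" using U by (simp add: compact_diff)
  define C where "C = e ` ({0..1} - U) \<union> verts X \<union> (\<Union>e'\<in>edges X - {e}. e' ` {0..1})"
  have "closedin (gtop X) C"
    unfolding C_def
  proof (intro closedin_Un)
    show "closedin (gtop X) (\<Union>e'\<in>edges X - {e}. e' ` {0..1})"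
      using finite_edges by (intro closedin_Union) (auto intro: closedin_edge_image)
  qed (use e comp finite_verts verts_topspace in \<open>auto intro: closedin_edge_image closedin_finite\<close>)
  moreover have "e ` U = topspace (gtop X) - C"
  proof (intro equalityI subsetI)
    fix x assume "x \<in> e ` U"
    then obtain s where s: "s \<in> U" "x = e s" by auto
    then have s01: "s \<in> {0<..<1}" using U by auto
    have "x \<noteq> e' t" if "e' \<in> edges X" "t \<in> {0..1}" "e' \<noteq> e \<or> t \<notin> U" for e' t
      using edge_point_unique[OF e that(1) s01 that(2)] that s by auto
    then have "x \<notin> C"
      using s s01 edge_interior e unfolding C_def by blast
    then show "x \<in> topspace (gtop X) - C"
      using s s01 edge_topspace e by auto
  next
    fix x assume "x \<in> topspace (gtop X) - C"
    then show "x \<in> e ` U"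
      using topspace_cases[of x] U unfolding C_def by fastforce
  qed
  ultimately show ?thesis by (simp add: openin_diff)
qed

lemma pathin_openin_vimage:
  assumes p: "pathin (gtop X) p" and U: "openin (gtop X) U"
  shows "openin (top_of_set {0..1}) {t\<in>{0..1}. p t \<in> U}"
  using openin_continuous_map_preimage[of "top_of_set {0..1}" "gtop X" p U] assms
  by (simp add: pathin_def)

lemma pathin_near:
  assumes p: "pathin (gtop X) p" and U: "openin (gtop X) U" and s: "s \<in> {0..1}" "p s \<in> U"
  obtains \<delta> where "\<delta> > 0" "\<And>t. t \<in> {0..1} \<Longrightarrow> \<bar>t - s\<bar> < \<delta> \<Longrightarrow> p t \<in> U"
proof -
  have "s \<in> {t\<in>{0..1}. p t \<in> U}" using s by simp
  then obtain \<delta> where "\<delta> > 0" "ball s \<delta> \<inter> {0..1} \<subseteq> {t\<in>{0..1}. p t \<in> U}"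
    using pathin_openin_vimage[OF p U] unfolding openin_contains_ball by blast
  then show thesis
    using that by (auto simp: ball_def dist_real_def abs_minus_commute subset_eq)
qed

text \<open>Away from vertices the graph is a disjoint union of open edges, and the connected image
  of an interval stays in one of them.\<close>

lemma edge_of_segment:
  assumes p: "pathin (gtop X) p" and ab: "0 \<le> a" "a < b" "b \<le> 1"
    and free: "\<And>t. t \<in> {a<..<b} \<Longrightarrow> p t \<notin> verts X"
  obtains e where "e \<in> edges X" "p ` {a<..<b} \<subseteq> e ` {0<..<1}"
proof -
  have top: "p t \<in> topspace (gtop X)" if "t \<in> {0..1}" for t
    using continuous_map_image_subset_topspace[of "top_of_set {0..1}" "gtop X" p] p that
    by (auto simp: pathin_def)
  have ex: "\<exists>e\<in>edges X. p t \<in> e ` {0<..<1}" if "t \<in> {a<..<b}" for t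
    using topspace_cases[OF top, of t] free[OF that] that ab by auto
  define m where "m = (a + b) / 2"
  have m: "m \<in> {a<..<b}" using ab by (auto simp: m_def)
  obtain e where e: "e \<in> edges X" "p m \<in> e ` {0<..<1}" using ex[OF m] by blast
  define U where "U = (\<Union>e'\<in>edges X - {e}. e' ` {0<..<1})"
  have conn: "connectedin (gtop X) (p ` {a<..<b})"
  proof (rule connectedin_continuous_map_image)
    show "continuous_map (top_of_set {0..1}) (gtop X) p" using p by (simp add: pathin_def)
    show "connectedin (top_of_set {0..1}) {a<..<b}"
      using ab by (auto simp: connectedin_subtopology connected_Ioo)
  qed
  have "openin (gtop X) (e ` {0<..<1})" "openin (gtop X) U"
    unfolding U_def using e by (auto intro!: openin_edge_image)
  moreover have "p ` {a<..<b} \<subseteq> e ` {0<..<1} \<union> U"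
    using ex by (fastforce simp: U_def)
  moreover have "e ` {0<..<1} \<inter> U = {}"
  proof -
    have False if "e' \<in> edges X" "e' \<noteq> e" "s \<in> {0<..<1}" "t \<in> {0<..<1}" "e s = e' t" for e' s t
      using edge_point_unique[of e e' s t] e that by auto
    then show ?thesis unfolding U_def by blast
  qed
  moreover have "e ` {0<..<1} \<inter> p ` {a<..<b} \<noteq> {}" using e m by blast
  ultimately have "U \<inter> p ` {a<..<b} = {}"
    using conn unfolding connectedin by (metis inf_assoc inf_bot_left)
  then have "p ` {a<..<b} \<subseteq> e ` {0<..<1}"
    using \<open>p ` {a<..<b} \<subseteq> e ` {0<..<1} \<union> U\<close> by blast
  then show thesis using that e by blast
qed

end

text \<open>The properties of an edge followed by one bonding map. Local injectivity is asked on the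
  open interval only, because a bonding map is constrained away from the vertices.\<close>

locale vertex_path = digraph +
  fixes p :: "real \<Rightarrow> 'a"
  assumes op: "op_path X p"
    and p0: "p 0 \<in> verts X" and p1: "p 1 \<in> verts X"
    and loc_inj: "locally_one_to_one euclideanreal {0<..<1} p"
begin

lemma pathin_p: "pathin (gtop X) p"
  using op by (simp add: op_path_def)

definition vtimes :: "real set" where
  "vtimes = {t\<in>{0..1}. p t \<in> verts X}"

lemma loc_injE:
  assumes "s \<in> {0<..<1}"
  obtains \<epsilon> where "\<epsilon> > 0" "inj_on p ({s - \<epsilon><..<s + \<epsilon>} \<inter> {0<..<1})"
proof -
  obtain W where W: "openin (top_of_set {0<..<1}) W" "s \<in> W" "inj_on p W"
    using loc_inj assms unfolding locally_one_to_one_def by blast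
  then obtain \<epsilon> where "\<epsilon> > 0" "ball s \<epsilon> \<inter> {0<..<1} \<subseteq> W"
    unfolding openin_contains_ball by blast
  then show thesis
    using that[of \<epsilon>] inj_on_subset[OF W(3)] by (simp add: ball_eq_greaterThanLessThan)
qed

text \<open>On an interval between consecutive visits to vertices the path runs once through one edge, and
  it does so increasingly because it is orientation preserving.\<close>

lemma segment:
  assumes ab: "a \<in> vtimes" "b \<in> vtimes" "a < b"
    and free: "\<And>t. t \<in> {a<..<b} \<Longrightarrow> t \<notin> vtimes"
  obtains e \<phi> where "e \<in> edges X" "homeomorphic_map (top_of_set {a..b}) (top_of_set {0..1}) \<phi>"
    "\<And>t. t \<in> {a..b} \<Longrightarrow> p t = e (\<phi> t)" "\<phi> a = 0" "\<phi> b = 1"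
proof -
  have ab01: "0 \<le> a" "b \<le> 1" and pab: "p a \<in> verts X" "p b \<in> verts X"
    using ab by (auto simp: vtimes_def)
  have freev: "p t \<notin> verts X" if "t \<in> {a<..<b}" for t
    using free[OF that] that ab01 by (auto simp: vtimes_def)
  obtain e where e: "e \<in> edges X" "p ` {a<..<b} \<subseteq> e ` {0<..<1}"
    using edge_of_segment[OF pathin_p ab01(1) ab(3) ab01(2) freev] by blast
  \<comment> \<open>The open parameter interval is used because \<open>e\<close> is injective there
    even when it is a loop.\<close>
  define \<psi> where "\<psi> = inv_into {0<..<1} e \<circ> p"
  have \<psi>: "\<psi> t \<in> {0<..<1}" "e (\<psi> t) = p t" if "t \<in> {a<..<b}" for t
  proof -
    have "p t \<in> e ` {0<..<1}" using e that by blast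
    then show "\<psi> t \<in> {0<..<1}" "e (\<psi> t) = p t"
      unfolding \<psi>_def comp_def by (rule inv_into_into, rule f_inv_into_f)
  qed
  have params: "{0<..<1} \<subseteq> edge_params e"
    by (auto simp: edge_params_def)
  have "mono_on {a<..<b} (inv_into (edge_params e) e \<circ> p)"
  proof -
    have "p ` {a<..<b} \<subseteq> e ` edge_params e" using e params by blast
    moreover have "{a<..<b} \<subseteq> {0..1}" using ab01 by auto
    ultimately show ?thesis
      using op e(1) unfolding op_path_def by (meson is_interval_oo)
  qed
  \<comment> \<open>For an edge that is not a loop \<open>op_path\<close> inverts \<open>e\<close>
    on the closed interval; both inverses agree on interior points.\<close>
  moreover have "inv_into (edge_params e) e (p t) = \<psi> t" if "t \<in> {a<..<b}" for t
    using \<psi>[OF that] inv_into_f_f[OF edge_params_inj[OF e(1)], of "\<psi> t"] params by auto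
  ultimately have mono: "\<psi> s \<le> \<psi> t" if "s \<in> {a<..<b}" "t \<in> {a<..<b}" "s \<le> t" for s t
    using that by (force simp: monotone_on_def)
  \<comment> \<open>Equal values at two times would make the monotone \<open>\<psi>\<close> constant
    in between, and then \<open>p\<close> would be constant just after \<open>s\<close>, against
    local injectivity.\<close>
  have strict: "\<psi> s < \<psi> t" if "s \<in> {a<..<b}" "t \<in> {a<..<b}" "s < t" for s t
  proof (rule ccontr)
    assume "\<not> \<psi> s < \<psi> t"
    then have eq: "\<psi> s = \<psi> t" using mono that by force
    have "s \<in> {0<..<1}" using that ab01 by auto
    then obtain \<epsilon> where \<epsilon>: "\<epsilon> > 0" "inj_on p ({s - \<epsilon><..<s + \<epsilon>} \<inter> {0<..<1})"
      by (rule loc_injE)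
    define u where "u = min t (s + \<epsilon> / 2)"
    have u: "s < u" "u \<le> t" "u < s + \<epsilon>" using \<epsilon> that by (auto simp: u_def min_def)
    have "\<psi> s \<le> \<psi> u" "\<psi> u \<le> \<psi> t" using u that by (auto intro!: mono)
    then have "\<psi> s = \<psi> u" using eq by simp
    then have "p s = p u" using \<psi>(2)[of s] \<psi>(2)[of u] that u by auto
    then have "s = u"
      using inj_onD[OF \<epsilon>(2), of s u] u that ab01 \<epsilon>(1) by auto
    then show False using u by simp
  qed
  \<comment> \<open>Continuity is inherited from \<open>p\<close>: a preimage under
    \<open>\<psi>\<close> is the set of times in the segment when \<open>p\<close> lies in an open
    part of \<open>e\<close>.\<close>
  have cont: "continuous_on {a<..<b} \<psi>"
  proof (subst continuous_on_open_vimage)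
    show "\<forall>B. open B \<longrightarrow> open (\<psi> -` B \<inter> {a<..<b})"
    proof (intro allI impI)
      fix B :: "real set" assume "open B"
      then have U: "openin (gtop X) (e ` (B \<inter> {0<..<1}))"
        using e by (intro openin_edge_image) auto
      have iff: "\<psi> t \<in> B \<longleftrightarrow> p t \<in> e ` (B \<inter> {0<..<1})" if t: "t \<in> {a<..<b}" for t
      proof
        assume "\<psi> t \<in> B"
        then show "p t \<in> e ` (B \<inter> {0<..<1})" using \<psi>[OF t] by (metis IntI imageI)
      next
        assume "p t \<in> e ` (B \<inter> {0<..<1})"
        then obtain s where "s \<in> B" "s \<in> {0<..<1}" "e s = e (\<psi> t)" using \<psi>[OF t] by auto
        then show "\<psi> t \<in> B" using edge_inj[OF e(1)] \<psi>[OF t] by (metis inj_onD)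
      qed
      have "\<psi> -` B \<inter> {a<..<b} = {t\<in>{0..1}. p t \<in> e ` (B \<inter> {0<..<1})} \<inter> {a<..<b}"
        using iff ab01 by fastforce
      moreover have "openin (top_of_set {a<..<b}) ({t\<in>{0..1}. p t \<in> e ` (B \<inter> {0<..<1})} \<inter> {a<..<b})"
      proof -
        obtain T where "open T" "{t\<in>{0..1}. p t \<in> e ` (B \<inter> {0<..<1})} = {0..1} \<inter> T"
          using pathin_openin_vimage[OF pathin_p U] unfolding openin_open by blast
        moreover have "{0..1} \<inter> T \<inter> {a<..<b} = {a<..<b} \<inter> T" using ab01 by auto
        ultimately show ?thesis unfolding openin_open by blast
      qed
      ultimately show "open (\<psi> -` B \<inter> {a<..<b})"
        by (metis open_greaterThanLessThan openin_open_eq)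
    qed
  qed simp
  \<comment> \<open>At \<open>s\<close> the path is at a vertex, hence off the closed interior arc
    of \<open>e\<close> over \<open>{c..d}\<close>, and it stays off for nearby times.\<close>
  have near: "\<exists>\<delta>>0. \<forall>t\<in>{a<..<b}. \<bar>t - s\<bar> < \<delta> \<longrightarrow> \<psi> t \<notin> {c..d}"
    if s: "s \<in> {a, b}" and cd: "0 < c" "d < 1" for s c d
  proof -
    have "openin (gtop X) (topspace (gtop X) - e ` {c..d})"
      using cd e by (intro openin_diff closedin_edge_image) auto
    moreover have "p s \<in> topspace (gtop X) - e ` {c..d}"
      using s pab verts_topspace edge_interior[OF e(1)] cd by force
    moreover have "s \<in> {0..1}" using s ab01 ab by auto
    ultimately obtain \<delta> where \<delta>: "\<delta> > 0"
      "\<And>t. t \<in> {0..1} \<Longrightarrow> \<bar>t - s\<bar> < \<delta> \<Longrightarrow> p t \<in> topspace (gtop X) - e ` {c..d}"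
      using pathin_near[OF pathin_p] by blast
    have "\<psi> t \<notin> {c..d}" if t: "t \<in> {a<..<b}" "\<bar>t - s\<bar> < \<delta>" for t
    proof
      assume "\<psi> t \<in> {c..d}"
      then have "p t \<in> e ` {c..d}" using \<psi>(2)[OF t(1)] by (metis imageI)
      then show False using \<delta>(2)[of t] t ab01 by auto
    qed
    then show ?thesis using \<delta>(1) by blast
  qed
  define m where "m = (a + b) / 2"
  have m: "m \<in> {a<..<b}" using ab by (auto simp: m_def)
  define \<phi> where "\<phi> t = (if t = a then 0 else if t = b then 1 else \<psi> t)" for t
  have \<phi>_int: "\<phi> t = \<psi> t" if "t \<in> {a<..<b}" for t using that by (auto simp: \<phi>_def)
  have \<phi>_ab: "\<phi> a = 0" "\<phi> b = 1" using ab by (auto simp: \<phi>_def)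
  \<comment> \<open>The avoided arc ends at \<open>\<psi> m\<close>. Before \<open>m\<close>
    monotonicity excludes larger values, so only values below \<open>\<epsilon>\<close>
    remain.\<close>
  have at_a: "\<exists>\<delta>>0. \<forall>t\<in>{a<..<b}. t - a < \<delta> \<longrightarrow> \<psi> t < \<epsilon>" if \<epsilon>: "\<epsilon> > 0" for \<epsilon>
  proof -
    obtain \<delta> where \<delta>: "\<delta> > 0" "\<And>t. t \<in> {a<..<b} \<Longrightarrow> \<bar>t - a\<bar> < \<delta> \<Longrightarrow> \<psi> t \<notin> {\<epsilon>..\<psi> m}"
      using near[of a \<epsilon> "\<psi> m"] \<psi>(1)[OF m] \<epsilon> by auto
    show ?thesis
    proof (intro exI[of _ "min \<delta> (m - a)"] conjI ballI impI)
      fix t assume t: "t \<in> {a<..<b}" "t - a < min \<delta> (m - a)"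
      then have "\<psi> t \<le> \<psi> m" by (intro mono m) auto
      then show "\<psi> t < \<epsilon>" using \<delta>(2)[OF t(1)] t by auto
    qed (use \<delta> m in auto)
  qed
  have at_b: "\<exists>\<delta>>0. \<forall>t\<in>{a<..<b}. b - t < \<delta> \<longrightarrow> \<psi> t > 1 - \<epsilon>" if \<epsilon>: "\<epsilon> > 0" for \<epsilon>
  proof -
    obtain \<delta> where \<delta>: "\<delta> > 0" "\<And>t. t \<in> {a<..<b} \<Longrightarrow> \<bar>t - b\<bar> < \<delta> \<Longrightarrow> \<psi> t \<notin> {\<psi> m..1 - \<epsilon>}"
      using near[of b "\<psi> m" "1 - \<epsilon>"] \<psi>(1)[OF m] \<epsilon> by auto
    show ?thesis
    proof (intro exI[of _ "min \<delta> (b - m)"] conjI ballI impI)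
      fix t assume t: "t \<in> {a<..<b}" "b - t < min \<delta> (b - m)"
      then have "\<psi> m \<le> \<psi> t" by (intro mono m) auto
      then show "\<psi> t > 1 - \<epsilon>" using \<delta>(2)[OF t(1)] t by auto
    qed (use \<delta> m in auto)
  qed
  have \<phi>01: "\<phi> t \<in> {0..1}" if "t \<in> {a..b}" for t
    using \<psi>(1)[of t] that by (auto simp: \<phi>_def)
  have "continuous_on {a..b} \<phi>"
    unfolding continuous_on_iff
  proof (intro ballI allI impI)
    fix x \<epsilon> :: real assume x: "x \<in> {a..b}" and \<epsilon>: "\<epsilon> > 0"
    consider "x = a" | "x = b" | "x \<in> {a<..<b}" using x by fastforce
    then show "\<exists>d>0. \<forall>x'\<in>{a..b}. dist x' x < d \<longrightarrow> dist (\<phi> x') (\<phi> x) < \<epsilon>"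
    proof cases
      case 1
      obtain \<delta> where \<delta>: "\<delta> > 0" "\<And>t. t \<in> {a<..<b} \<Longrightarrow> t - a < \<delta> \<Longrightarrow> \<psi> t < \<epsilon>"
        using at_a[OF \<epsilon>] by blast
      show ?thesis
      proof (intro exI[of _ "min \<delta> (b - a)"] conjI ballI impI)
        fix t assume t: "t \<in> {a..b}" "dist t x < min \<delta> (b - a)"
        then consider "t = a" | "t \<in> {a<..<b}" "t - a < \<delta>"
          using 1 by (fastforce simp: dist_real_def)
        then show "dist (\<phi> t) (\<phi> x) < \<epsilon>"
        proof cases
          case 2
          then show ?thesis
            using \<open>x = a\<close> \<phi>_ab \<phi>_int[OF 2(1)] \<delta>(2)[OF 2] \<psi>(1)[OF 2(1)] by (simp add: dist_real_def)
        qed (use 1 \<epsilon> in auto)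
      qed (use \<delta> ab in auto)
    next
      case 2
      obtain \<delta> where \<delta>: "\<delta> > 0" "\<And>t. t \<in> {a<..<b} \<Longrightarrow> b - t < \<delta> \<Longrightarrow> \<psi> t > 1 - \<epsilon>"
        using at_b[OF \<epsilon>] by blast
      show ?thesis
      proof (intro exI[of _ "min \<delta> (b - a)"] conjI ballI impI)
        fix t assume t: "t \<in> {a..b}" "dist t x < min \<delta> (b - a)"
        then consider "t = b" | "t \<in> {a<..<b}" "b - t < \<delta>"
          using 2 by (fastforce simp: dist_real_def)
        then show "dist (\<phi> t) (\<phi> x) < \<epsilon>"
        proof cases
          case 2
          then show ?thesis
            using \<open>x = b\<close> \<phi>_ab \<phi>_int[OF 2(1)] \<delta>(2)[OF 2] \<psi>(1)[OF 2(1)] by (simp add: dist_real_def)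
        qed (use 2 \<epsilon> in auto)
      qed (use \<delta> ab in auto)
    next
      case 3
      then obtain \<delta> where \<delta>: "\<delta> > 0" "\<And>t. t \<in> {a<..<b} \<Longrightarrow> dist t x < \<delta> \<Longrightarrow> dist (\<psi> t) (\<psi> x) < \<epsilon>"
        using cont \<epsilon> unfolding continuous_on_iff by blast
      show ?thesis
      proof (intro exI[of _ "min \<delta> (min (b - x) (x - a))"] conjI ballI impI)
        fix t assume "t \<in> {a..b}" "dist t x < min \<delta> (min (b - x) (x - a))"
        then have "t \<in> {a<..<b}" "dist t x < \<delta>" by (auto simp: dist_real_def)
        then show "dist (\<phi> t) (\<phi> x) < \<epsilon>" using \<delta> 3 \<phi>_int by simp
      qed (use \<delta> 3 in auto)
    qed
  qed
  moreover have "\<phi> ` {a..b} = {0..1}"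
  proof
    show "{0..1} \<subseteq> \<phi> ` {a..b}"
      using IVT'[of \<phi> a _ b] \<phi>_ab ab \<open>continuous_on {a..b} \<phi>\<close> by fastforce
  qed (use \<phi>01 in auto)
  moreover have "inj_on \<phi> {a..b}"
  proof (rule linorder_inj_onI')
    fix s t assume st: "s \<in> {a..b}" "t \<in> {a..b}" "s < t"
    consider "s = a" "t = b" | "s = a" "t \<in> {a<..<b}" | "s \<in> {a<..<b}" "t = b"
      | "s \<in> {a<..<b}" "t \<in> {a<..<b}"
      using st by fastforce
    then show "\<phi> s \<noteq> \<phi> t"
      using \<phi>_ab \<phi>_int \<psi>(1)[of s] \<psi>(1)[of t] strict[of s t] st by cases auto
  qed
  ultimately have "homeomorphic_map (top_of_set {a..b}) (top_of_set {0..1}) \<phi>"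
    by (intro continuous_imp_homeomorphic_map)
      (auto simp: compact_space_subtopology Hausdorff_space_subtopology)
  moreover have "p t = e (\<phi> t)" if t: "t \<in> {a..b}" for t
  proof -
    \<comment> \<open>Both sides are continuous and agree on the open interval, so different values
      at an end would contradict separation by disjoint open sets.\<close>
    have lim: "p s = e (\<phi> s)" if s: "s \<in> {a, b}" for s
    proof (rule ccontr)
      assume ne: "p s \<noteq> e (\<phi> s)"
      have s01: "s \<in> {0..1}" "s \<in> {a..b}" using s ab01 ab by auto
      obtain U V where UV: "openin (gtop X) U" "openin (gtop X) V" "p s \<in> U" "e (\<phi> s) \<in> V" "disjnt U V"
        using Hausdorff ne edge_topspace[OF e(1) \<phi>01[OF s01(2)]] s pab verts_topspace
        unfolding Hausdorff_space_def by (metis insertE singletonD subsetD)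
      obtain d1 where d1: "d1 > 0" "\<And>t. t \<in> {0..1} \<Longrightarrow> \<bar>t - s\<bar> < d1 \<Longrightarrow> p t \<in> U"
        using pathin_near[OF pathin_p UV(1) s01(1) UV(3)] by blast
      obtain d2 where d2: "d2 > 0" "\<And>t. t \<in> {0..1} \<Longrightarrow> \<bar>t - \<phi> s\<bar> < d2 \<Longrightarrow> e t \<in> V"
        using pathin_near[OF edge_pathin[OF e(1)] UV(2) \<phi>01[OF s01(2)] UV(4)] by blast
      obtain d3 where d3: "d3 > 0" "\<And>t. t \<in> {a..b} \<Longrightarrow> \<bar>t - s\<bar> < d3 \<Longrightarrow> \<bar>\<phi> t - \<phi> s\<bar> < d2"
        using \<open>continuous_on {a..b} \<phi>\<close> s01(2) d2(1) unfolding continuous_on_iff dist_real_def by blast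
      obtain t where t: "t \<in> {a<..<b}" "\<bar>t - s\<bar> < min d1 d3"
      proof -
        define d where "d = min (min d1 d3) (b - a) / 2"
        have d: "d > 0" "d < min d1 d3" "d < b - a" using d1 d3 ab by (auto simp: d_def)
        show thesis
        proof (cases "s = a")
          case True then show ?thesis using that[of "a + d"] d by auto
        next
          case False then show ?thesis using that[of "b - d"] d s by auto
        qed
      qed
      have "p t \<in> U" using t ab01 by (intro d1) auto
      moreover have "e (\<phi> t) \<in> V"
        using t by (intro d2(2) d3(2) \<phi>01) auto
      moreover have "p t = e (\<phi> t)" using t \<psi> \<phi>_int by simp
      ultimately show False using UV(5) by (auto simp: disjnt_def)
    qed
    show ?thesis
    proof (cases "t \<in> {a<..<b}")
      case False
      then have "t \<in> {a, b}" using t by auto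
      then show ?thesis by (rule lim)
    qed (simp add: \<psi> \<phi>_int)
  qed
  ultimately show thesis
    using that[OF e(1)] \<phi>_ab by blast
qed

text \<open>Near an interior time \<open>p\<close> is injective, and it has only finitely many
  vertices to visit.\<close>

lemma not_islimpt_vtimes_interior:
  assumes "s \<in> {0<..<1}"
  shows "\<not> s islimpt vtimes"
proof
  assume lim: "s islimpt vtimes"
  obtain \<epsilon> where \<epsilon>: "\<epsilon> > 0" "inj_on p ({s - \<epsilon><..<s + \<epsilon>} \<inter> {0<..<1})"
    using loc_injE[OF assms] .
  define d where "d = min \<epsilon> (min s (1 - s))"
  have d: "d > 0" "d \<le> \<epsilon>" "d \<le> s" "d \<le> 1 - s" using \<epsilon> assms by (auto simp: d_def)
  have "ball s d \<subseteq> {s - \<epsilon><..<s + \<epsilon>} \<inter> {0<..<1}"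
    using d by (auto simp: dist_real_def)
  then have "inj_on p (vtimes \<inter> ball s d)"
    using \<epsilon>(2) by (meson inf_le2 inj_on_subset)
  moreover have "finite (p ` (vtimes \<inter> ball s d))"
    by (rule finite_subset[OF _ finite_verts]) (auto simp: vtimes_def)
  ultimately have "finite (vtimes \<inter> ball s d)" by (simp add: finite_image_iff)
  then show False using lim d(1) by (auto simp: islimpt_eq_infinite_ball)
qed

lemma finite_vtimes_Icc:
  assumes "0 < c" "d < 1"
  shows "finite (vtimes \<inter> {c..d})"
proof (rule ccontr)
  assume "infinite (vtimes \<inter> {c..d})"
  then obtain s where "s \<in> {c..d}" "s islimpt vtimes \<inter> {c..d}"
    using compact_Icc[of c d] unfolding compact_eq_Bolzano_Weierstrass by (meson inf_le2)
  then show False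
    using not_islimpt_vtimes_interior[of s] assms islimpt_subset[of s "vtimes \<inter> {c..d}" vtimes] by auto
qed

text \<open>Two visits to vertices near a limit point would enclose a full edge, hence its midpoint, which
  continuity keeps away from the vertex at the limit point.\<close>

lemma not_islimpt_vtimes:
  assumes s: "s \<in> vtimes"
  shows "\<not> s islimpt vtimes"
proof
  assume lim: "s islimpt vtimes"
  have s01: "s \<in> {0..1}" and ps: "p s \<in> verts X" using s by (auto simp: vtimes_def)
  define N where "N = topspace (gtop X) - (\<lambda>e. e (1 / 2)) ` edges X"
  have "openin (gtop X) N"
    unfolding N_def using finite_edges by (intro openin_diff closedin_finite) (auto intro: edge_topspace)
  moreover have "p s \<in> N"
  proof -
    have "e (1 / 2) \<notin> verts X" if "e \<in> edges X" for e using edge_interior[OF that] by simp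
    then show ?thesis using ps verts_topspace unfolding N_def by fastforce
  qed
  ultimately obtain \<delta> where \<delta>: "\<delta> > 0" "\<And>t. t \<in> {0..1} \<Longrightarrow> \<bar>t - s\<bar> < \<delta> \<Longrightarrow> p t \<in> N"
    using pathin_near[OF pathin_p _ s01] by blast
  \<comment> \<open>Removing 0 and 1 keeps the two visits chosen next inside the open interval,
    where finiteness between them is already known.\<close>
  have "infinite (vtimes \<inter> ball s \<delta> - {0, 1})"
    using lim \<delta>(1) by (simp add: islimpt_eq_infinite_ball)
  then obtain x y where xy: "x \<in> vtimes \<inter> ball s \<delta> - {0, 1}" "y \<in> vtimes \<inter> ball s \<delta> - {0, 1}" "x < y"
  proof -
    obtain x where x: "x \<in> vtimes \<inter> ball s \<delta> - {0, 1}"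
      using \<open>infinite _\<close> by (metis ex_in_conv finite.emptyI)
    obtain y where "y \<in> vtimes \<inter> ball s \<delta> - {0, 1} - {x}"
      using infinite_remove[OF \<open>infinite _\<close>, of x] by (metis ex_in_conv finite.emptyI)
    then show ?thesis using that[of x y] that[of y x] x by (cases "x < y") auto
  qed
  then have xy01: "0 < x" "y < 1" by (auto simp: vtimes_def)
  \<comment> \<open>The first visit after \<open>x\<close>, so that \<open>segment\<close> applies
    to the gap between \<open>x\<close> and \<open>b\<close>.\<close>
  define b where "b = Min (vtimes \<inter> {x<..y})"
  have fin: "finite (vtimes \<inter> {x<..y})"
    by (rule finite_subset[OF _ finite_vtimes_Icc[OF xy01]]) auto
  have ne: "vtimes \<inter> {x<..y} \<noteq> {}" using xy by auto
  have b: "b \<in> vtimes" "x < b" "b \<le> y"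
    using Min_in[OF fin ne] by (auto simp: b_def)
  have free: "t \<notin> vtimes" if "t \<in> {x<..<b}" for t
    using Min_le[OF fin, of t] that b by (auto simp: b_def)
  obtain e \<phi> where e: "e \<in> edges X" "homeomorphic_map (top_of_set {x..b}) (top_of_set {0..1}) \<phi>"
    "\<And>t. t \<in> {x..b} \<Longrightarrow> p t = e (\<phi> t)"
    using segment[OF _ b(1,2) free] xy by blast
  have "\<phi> ` {x..b} = {0..1}"
    using homeomorphic_imp_surjective_map[OF e(2)] by simp
  then have "1 / 2 \<in> \<phi> ` {x..b}" by simp
  then obtain t where t: "t \<in> {x..b}" "\<phi> t = 1 / 2" by (metis imageE)
  have "p t \<in> N" using t xy xy01 b by (intro \<delta>(2)) (auto simp: dist_real_def)
  moreover have "p t = e (1 / 2)" using e(3)[OF t(1)] t(2) by (simp only:)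
  ultimately show False using e(1) by (simp add: N_def)
qed

lemma finite_vtimes: "finite vtimes"
proof (rule ccontr)
  assume "infinite vtimes"
  moreover have "vtimes \<subseteq> {0..1}" by (auto simp: vtimes_def)
  ultimately obtain s where s: "s \<in> {0..1}" "s islimpt vtimes"
    using compact_Icc[of 0 1] unfolding compact_eq_Bolzano_Weierstrass by meson
  \<comment> \<open>The two ends are themselves visits, so the lemma about limit points that are
    visits covers them.\<close>
  have "0 \<in> vtimes" "1 \<in> vtimes" using p0 p1 by (auto simp: vtimes_def)
  then have "s \<in> {0<..<1} \<or> s \<in> vtimes" 
    using s(1) by (cases "s = 0 \<or> s = 1") auto
  then show False using s(2) not_islimpt_vtimes not_islimpt_vtimes_interior by blast
qed

text \<open>The subdivision of a word is forced: each piece starts and ends at a vertex and stays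
  inside an open edge in between, so the cut points are exactly the visits.\<close>

lemma edge_word_times:
  assumes es: "set es \<subseteq> edges X" and len: "length ts = Suc (length es)" and srt: "sorted_wrt (<) ts"
    and hd: "hd ts = 0" and last: "last ts = 1"
    and seg: "\<And>i. i < length es \<Longrightarrow> \<exists>\<phi>. homeomorphic_map (top_of_set {ts ! i..ts ! Suc i}) (top_of_set {0..1}) \<phi> \<and>
           (\<forall>t\<in>{ts ! i..ts ! Suc i}. p t = (es ! i) (\<phi> t))"
  shows "ts = sorted_list_of_set vtimes"
    and "\<And>i t. i < length es \<Longrightarrow> t \<in> {ts ! i<..<ts ! Suc i} \<Longrightarrow> p t \<in> (es ! i) ` {0<..<1}"
proof -
  have step: "ts ! i < ts ! Suc i" if "i < length es" for i
    using srt len that by (simp add: sorted_wrt_nth_less)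
  have ends: "p (ts ! i) \<in> verts X" "p (ts ! Suc i) \<in> verts X"
    and inner: "\<And>t. t \<in> {ts ! i<..<ts ! Suc i} \<Longrightarrow> p t \<in> (es ! i) ` {0<..<1}" if i: "i < length es" for i
  proof -
    have e: "es ! i \<in> edges X" using es i by auto
    obtain \<phi> where \<phi>: "homeomorphic_map (top_of_set {ts ! i..ts ! Suc i}) (top_of_set {0..1}) \<phi>"
      "\<And>t. t \<in> {ts ! i..ts ! Suc i} \<Longrightarrow> p t = (es ! i) (\<phi> t)"
      using seg[OF i] by blast
    note hi = homeomorphic_map_interval[OF \<phi>(1) step[OF i]]
    show "p (ts ! i) \<in> verts X" "p (ts ! Suc i) \<in> verts X"
      using \<phi>(2) hi(1,2) step[OF i] edge_source[OF e] edge_target[OF e] by auto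
    fix t assume t: "t \<in> {ts ! i<..<ts ! Suc i}"
    then have "\<phi> t \<in> {0<..<1}" using hi(3) by blast
    then show "p t \<in> (es ! i) ` {0<..<1}" using \<phi>(2) t by auto
  qed
  show "\<And>i t. i < length es \<Longrightarrow> t \<in> {ts ! i<..<ts ! Suc i} \<Longrightarrow> p t \<in> (es ! i) ` {0<..<1}"
    by (rule inner)
  have ts0: "ts ! 0 = 0" and tsn: "ts ! length es = 1"
  proof -
    have "ts \<noteq> []" using len by auto
    then show "ts ! 0 = 0" "ts ! length es = 1"
      using hd last len hd_conv_nth[of ts] last_conv_nth[of ts] by auto
  qed
  have mono: "ts ! i \<le> ts ! j" if "i \<le> j" "j \<le> length es" for i j
    using that srt len by (cases "i = j") (auto simp: less_le intro: less_imp_le dest: sorted_wrt_nth_less)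
  have "set ts = vtimes"
  proof (intro equalityI subsetI)
    fix t assume "t \<in> set ts"
    then obtain i where i: "i \<le> length es" "t = ts ! i"
      using len by (metis in_set_conv_nth less_Suc_eq_le)
    have "p t \<in> verts X"
      using i ends(2)[of "i - 1"] p0 ts0 by (cases i) auto
    moreover have "0 \<le> t" "t \<le> 1"
      using mono[of 0 i] mono[of i "length es"] i ts0 tsn by auto
    ultimately show "t \<in> vtimes" by (simp add: vtimes_def)
  next
    fix t assume t: "t \<in> vtimes"
    then have t01: "0 \<le> t" "t \<le> 1" and pt: "p t \<in> verts X" by (auto simp: vtimes_def)
    show "t \<in> set ts"
    proof (rule ccontr)
      assume nt: "t \<notin> set ts"
      \<comment> \<open>The last cut point not after \<open>t\<close>; a visit that is no cut point
        would lie strictly inside the piece starting there.\<close>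
      define i where "i = (GREATEST i. i \<le> length es \<and> ts ! i \<le> t)"
      have i: "i \<le> length es" "ts ! i \<le> t"
        unfolding i_def using GreatestI_nat[of "\<lambda>i. i \<le> length es \<and> ts ! i \<le> t" 0 "length es"] t01 ts0 by auto
      have ne: "ts ! j \<noteq> t" if "j \<le> length es" for j
        using nt that len by (metis less_Suc_eq_le nth_mem)
      have "i < length es" using i ne[of i] tsn t01 by (cases "i = length es") auto
      moreover have "t < ts ! Suc i"
      proof (rule ccontr)
        assume "\<not> t < ts ! Suc i"
        then have "Suc i \<le> i"
          unfolding i_def[symmetric]
          using Greatest_le_nat[of "\<lambda>i. i \<le> length es \<and> ts ! i \<le> t" "Suc i" "length es"] \<open>i < length es\<close>
          by (auto simp: i_def)
        then show False by simp
      qed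
      moreover have "ts ! i < t" using i ne[of i] by simp
      ultimately have "p t \<in> (es ! i) ` {0<..<1}" using inner[of i t] by auto
      moreover have "es ! i \<in> edges X" using es \<open>i < length es\<close> by auto
      ultimately show False using pt edge_interior by auto
    qed
  qed
  moreover have "sorted_wrt (<) (sorted_list_of_set vtimes)" by simp
  ultimately show "ts = sorted_list_of_set vtimes"
    using srt finite_vtimes by (intro strict_sorted_equal) auto
qed

text \<open>Needed because \<open>edge_word\<close> is a definite description. With the subdivisions
  equal, the edges are compared at the middle of each piece.\<close>

lemma edge_word_unique:
  assumes "is_edge_word X p es" "is_edge_word X p es'"
  shows "es = es'"
proof -
  obtain ts where ts: "set es \<subseteq> edges X" "length ts = Suc (length es)" "sorted_wrt (<) ts"
    "hd ts = 0" "last ts = 1"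
    "\<And>i. i < length es \<Longrightarrow> \<exists>\<phi>. homeomorphic_map (top_of_set {ts ! i..ts ! Suc i}) (top_of_set {0..1}) \<phi> \<and>
           (\<forall>t\<in>{ts ! i..ts ! Suc i}. p t = (es ! i) (\<phi> t))"
    using assms(1) unfolding is_edge_word_def by blast
  obtain ts' where ts': "set es' \<subseteq> edges X" "length ts' = Suc (length es')" "sorted_wrt (<) ts'"
    "hd ts' = 0" "last ts' = 1"
    "\<And>i. i < length es' \<Longrightarrow> \<exists>\<phi>. homeomorphic_map (top_of_set {ts' ! i..ts' ! Suc i}) (top_of_set {0..1}) \<phi> \<and>
           (\<forall>t\<in>{ts' ! i..ts' ! Suc i}. p t = (es' ! i) (\<phi> t))"
    using assms(2) unfolding is_edge_word_def by blast
  have eq: "ts' = ts"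
    using edge_word_times(1)[OF ts] edge_word_times(1)[OF ts'] by simp
  show ?thesis
  proof (rule nth_equalityI)
    show len: "length es = length es'" using ts(2) ts'(2) eq by simp
    fix i assume i: "i < length es"
    then have i': "i < length es'" using len by simp
    define t where "t = (ts ! i + ts ! Suc i) / 2"
    have "ts ! i < ts ! Suc i" using ts(2,3) i by (simp add: sorted_wrt_nth_less)
    then have t: "t \<in> {ts ! i<..<ts ! Suc i}" by (auto simp: t_def)
    obtain x y where "p t = (es ! i) x" "x \<in> {0<..<1}" "p t = (es' ! i) y" "y \<in> {0<..<1}"
      using edge_word_times(2)[OF ts i t] edge_word_times(2)[OF ts' i'] t unfolding eq by blast
    moreover have "es ! i \<in> edges X" "es' ! i \<in> edges X" using ts(1) ts'(1) i i' by auto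
    ultimately show "es ! i = es' ! i"
      using edge_point_unique[of "es ! i" "es' ! i" x y] by auto
  qed
qed

text \<open>The path is cut at its finitely many visits and \<open>segment\<close> handles each
  gap.\<close>

lemma edge_word_exists:
  obtains es where "is_edge_word X p es" "es \<noteq> []" "edge_path X (p 0) es (p 1)"
    "p ` {0..1} \<subseteq> (\<Union>e\<in>set es. e ` {0..1})"
proof -
  define ts where "ts = sorted_list_of_set vtimes"
  have set_ts: "set ts = vtimes" and srt: "sorted_wrt (<) ts"
    using finite_vtimes by (auto simp: ts_def)
  have mem: "0 \<in> set ts" "1 \<in> set ts" using p0 p1 by (auto simp: set_ts vtimes_def)
  \<comment> \<open>The distinct visits 0 and 1 guarantee at least one gap, hence a nonempty
    word.\<close>
  then have "card {0, 1::real} \<le> card (set ts)" by (intro card_mono) auto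
  then have len2: "2 \<le> length ts" using card_length[of ts] by simp
  define n where "n = length ts - 1"
  have n: "length ts = Suc n" "n \<ge> 1" using len2 by (auto simp: n_def)
  have bounds: "ts ! i \<in> {0..1}" if "i \<le> n" for i
  proof -
    have "ts ! i \<in> set ts" using n that by simp
    then show ?thesis unfolding set_ts vtimes_def by simp
  qed
  have less: "ts ! i < ts ! j" if "i < j" "j \<le> n" for i j
    using srt n that by (simp add: sorted_wrt_nth_less)
  have ts0: "ts ! 0 = 0"
  proof -
    obtain j where j: "j \<le> n" "ts ! j = 0" using mem n by (metis in_set_conv_nth less_Suc_eq_le)
    show ?thesis using less[of 0 j] bounds[of 0] j by (cases "j = 0") auto
  qed
  have tsn: "ts ! n = 1"
  proof -
    obtain j where j: "j \<le> n" "ts ! j = 1" using mem n by (metis in_set_conv_nth less_Suc_eq_le)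
    show ?thesis using less[of j n] bounds[of n] j by (cases "j = n") auto
  qed
  have free: "t \<notin> vtimes" if i: "i < n" and t: "t \<in> {ts ! i<..<ts ! Suc i}" for i t
  proof
    assume "t \<in> vtimes"
    then obtain j where j: "j \<le> n" "ts ! j = t"
      using set_ts n by (metis in_set_conv_nth less_Suc_eq_le)
    have "i < j" using less[of j i] j i t by (cases "j = i"; cases "j < i") auto
    then have "ts ! Suc i \<le> ts ! j" using less[of "Suc i" j] j by (cases "Suc i = j") auto
    then show False using j t by simp
  qed
  \<comment> \<open>Packaged so that edge and reparameterization can be chosen together for all
    gaps. The two end values record that the edge is run through forwards.\<close>
  define Q where "Q i e \<phi> \<longleftrightarrow> e \<in> edges X
      \<and> homeomorphic_map (top_of_set {ts ! i..ts ! Suc i}) (top_of_set {0..1}) \<phi>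
      \<and> (\<forall>t\<in>{ts ! i..ts ! Suc i}. p t = e (\<phi> t)) \<and> \<phi> (ts ! i) = 0 \<and> \<phi> (ts ! Suc i) = 1" for i e \<phi>
  have "\<exists>e \<phi>. i < n \<longrightarrow> Q i e \<phi>" for i
  proof (cases "i < n")
    case i: True
    have v: "ts ! i \<in> vtimes" "ts ! Suc i \<in> vtimes"
      unfolding set_ts[symmetric] using n i by auto
    obtain e \<phi> where "e \<in> edges X"
      "homeomorphic_map (top_of_set {ts ! i..ts ! Suc i}) (top_of_set {0..1}) \<phi>"
      "\<And>t. t \<in> {ts ! i..ts ! Suc i} \<Longrightarrow> p t = e (\<phi> t)" "\<phi> (ts ! i) = 0" "\<phi> (ts ! Suc i) = 1"
      using segment[OF v _ free[OF i]] less[of i "Suc i"] i by auto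
    then have "Q i e \<phi>" by (simp add: Q_def)
    then show ?thesis by blast
  qed simp
  then obtain E \<Phi> where "\<And>i. i < n \<Longrightarrow> Q i (E i) (\<Phi> i)" by metis
  then have E: "\<And>i. i < n \<Longrightarrow> E i \<in> edges X"
    and \<Phi>: "\<And>i. i < n \<Longrightarrow> homeomorphic_map (top_of_set {ts ! i..ts ! Suc i}) (top_of_set {0..1}) (\<Phi> i)"
    and p: "\<And>i t. i < n \<Longrightarrow> t \<in> {ts ! i..ts ! Suc i} \<Longrightarrow> p t = E i (\<Phi> i t)"
    and \<Phi>01: "\<And>i. i < n \<Longrightarrow> \<Phi> i (ts ! i) = 0 \<and> \<Phi> i (ts ! Suc i) = 1"
    by (simp_all add: Q_def)
  define es where "es = map E [0..<n]"
  have es: "length es = n" "\<And>i. i < n \<Longrightarrow> es ! i = E i" by (auto simp: es_def)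
  show thesis
  proof
    show word: "is_edge_word X p es"
      unfolding is_edge_word_def
    proof (intro conjI exI[of _ ts] allI impI)
      show "set es \<subseteq> edges X" using E by (auto simp: es_def)
      show "hd ts = 0" "last ts = 1"
        using ts0 tsn n(1) hd_conv_nth[of ts] last_conv_nth[of ts] by (cases "ts = []"; simp)+
      show "\<exists>\<phi>. homeomorphic_map (top_of_set {ts ! i..ts ! Suc i}) (top_of_set {0..1}) \<phi> \<and>
           (\<forall>t\<in>{ts ! i..ts ! Suc i}. p t = (es ! i) (\<phi> t))" if "i < length es" for i
        using \<Phi> p es that by (intro exI[of _ "\<Phi> i"]) simp
    qed (use es n srt in auto)
    show "es \<noteq> []" using es n by auto
    have "edge_path X (p (ts ! 0)) es (p (ts ! length es))"
    proof (rule edge_path_nthI)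
      fix i assume "i < length es"
      then have i: "i < n" using es by simp
      have "ts ! i < ts ! Suc i" using less[of i "Suc i"] i by simp
      then show "es ! i \<in> edges X \<and> (es ! i) 0 = p (ts ! i) \<and> (es ! i) 1 = p (ts ! Suc i)"
        using E[OF i] p[OF i] \<Phi>01[OF i] es(2)[OF i] by simp
    qed (use es n in simp)
    then show "edge_path X (p 0) es (p 1)" using ts0 tsn es by simp
    show "p ` {0..1} \<subseteq> (\<Union>e\<in>set es. e ` {0..1})"
    proof
      fix x assume "x \<in> p ` {0..1}"
      then obtain t where t: "t \<in> {0..1}" "x = p t" by auto
      have "\<exists>i<n. t \<in> {ts ! i..ts ! Suc i}"
      proof -
        \<comment> \<open>The first gap whose right end is not before \<open>t\<close>; minimality
          puts its left end at or before \<open>t\<close>.\<close>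
        define i where "i = (LEAST i. t \<le> ts ! Suc i)"
        have ex: "t \<le> ts ! Suc (n - 1)" using tsn t n by simp
        have "t \<le> ts ! Suc i" unfolding i_def by (rule LeastI[of _ "n - 1"]) (rule ex)
        moreover have "i \<le> n - 1" unfolding i_def by (rule Least_le) (rule ex)
        moreover have "ts ! i \<le> t"
        proof (cases i)
          case (Suc j)
          then have "\<not> t \<le> ts ! Suc j" using not_less_Least[of j "\<lambda>i. t \<le> ts ! Suc i"] by (simp add: i_def)
          then show ?thesis using Suc by simp
        qed (use ts0 t in simp)
        ultimately show ?thesis using n by (intro exI[of _ i]) auto
      qed
      then obtain i where i: "i < n" "t \<in> {ts ! i..ts ! Suc i}" by blast
      have "\<Phi> i t \<in> {0..1}"
        using homeomorphic_imp_surjective_map[OF \<Phi>[OF i(1)]] i(2) by auto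
      then have "x \<in> E i ` {0..1}" using p[OF i] t by auto
      then show "x \<in> (\<Union>e\<in>set es. e ` {0..1})" using i(1) by (auto simp: es_def)
    qed
  qed
qed

lemma
  shows edge_word_nonempty: "edge_word X p \<noteq> []"
    and edge_path_edge_word: "edge_path X (p 0) (edge_word X p) (p 1)"
    and edge_word_covers: "p ` {0..1} \<subseteq> (\<Union>e\<in>set (edge_word X p). e ` {0..1})"
proof -
  obtain es where es: "is_edge_word X p es" "es \<noteq> []" "edge_path X (p 0) es (p 1)"
    "p ` {0..1} \<subseteq> (\<Union>e\<in>set es. e ` {0..1})"
    by (rule edge_word_exists)
  have "edge_word X p = es"
    unfolding edge_word_def using es(1) edge_word_unique by blast
  with es show "edge_word X p \<noteq> []" "edge_path X (p 0) (edge_word X p) (p 1)"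
    "p ` {0..1} \<subseteq> (\<Union>e\<in>set (edge_word X p). e ` {0..1})"
    by auto
qed

end

section \<open>Groups of integer-valued functions\<close>

lemma fun_group_simps:
  "carrier (fun_group I) = extensional I"
  "x \<otimes>\<^bsub>fun_group I\<^esub> y = (\<lambda>i\<in>I. x i + y i)"
  "\<one>\<^bsub>fun_group I\<^esub> = (\<lambda>i\<in>I. 0)"
  by (simp_all add: fun_group_def extensional_def PiE_def)

lemma comm_group_fun_group: "comm_group (fun_group I)"
proof (rule comm_groupI)
  fix x assume "x \<in> carrier (fun_group I)"
  then show "\<exists>y\<in>carrier (fun_group I). y \<otimes>\<^bsub>fun_group I\<^esub> x = \<one>\<^bsub>fun_group I\<^esub>"
    by (intro bexI[of _ "\<lambda>i\<in>I. - x i"]) (auto simp: fun_group_simps extensional_def fun_eq_iff)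
qed (auto simp: fun_group_simps extensional_def fun_eq_iff)

interpretation fun_group: comm_group "fun_group I" for I
  by (rule comm_group_fun_group)

lemma inv_fun_group:
  "x \<in> extensional I \<Longrightarrow> inv\<^bsub>fun_group I\<^esub> x = (\<lambda>i\<in>I. - x i)"
  by (intro fun_group.inv_equality) (auto simp: fun_group_simps fun_eq_iff)

lemma pow_fun_group:
  "x \<in> extensional I \<Longrightarrow> x [^]\<^bsub>fun_group I\<^esub> (n::nat) = (\<lambda>i\<in>I. int n * x i)"
proof (induction n)
  case (Suc n)
  then show ?case by (auto simp: fun_group_simps algebra_simps fun_eq_iff)
qed (auto simp: fun_group_simps)

lemma fun_cone_iff: "x \<in> fun_cone I \<longleftrightarrow> x \<in> extensional I \<and> (\<forall>i\<in>I. 0 \<le> x i)"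
  by (auto simp: fun_cone_def fun_group_simps)

lemma submonoid_fun_cone: "submonoid (fun_cone I) (fun_group I)"
  by standard (auto simp: fun_cone_iff fun_group_simps)

text \<open>The witnesses are the positive and negative parts.\<close>

lemma fun_group_diff:
  assumes "x \<in> carrier (fun_group I)"
  shows "\<exists>a\<in>fun_cone I. \<exists>b\<in>fun_cone I. x = a \<otimes>\<^bsub>fun_group I\<^esub> inv\<^bsub>fun_group I\<^esub> b"
  using assms
  by (intro bexI[of _ "\<lambda>i\<in>I. max (x i) 0"] bexI[of _ "\<lambda>i\<in>I. max (- x i) 0"])
    (auto simp: fun_group_simps inv_fun_group fun_cone_iff extensional_def fun_eq_iff)

lemma fun_cone_pointed:
  assumes "x \<in> fun_cone I" "y \<in> fun_cone I" "x = inv\<^bsub>fun_group I\<^esub> y"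
  shows "x = \<one>\<^bsub>fun_group I\<^esub>"
proof -
  have "x = (\<lambda>i\<in>I. - y i)" using assms by (simp add: inv_fun_group fun_cone_iff)
  moreover from this have "x i = 0" if "i \<in> I" for i
    using that assms(1,2) by (force simp: fun_cone_iff)
  ultimately show ?thesis by (auto simp: fun_group_simps fun_eq_iff)
qed

lemma ordered_system_fun_group:
  assumes "\<And>k. \<phi> k \<in> hom (fun_group (I k)) (fun_group (I (Suc k)))"
    and "\<And>k x. x \<in> fun_cone (I k) \<Longrightarrow> \<phi> k x \<in> fun_cone (I (Suc k))"
  shows "ordered_system (\<lambda>k. fun_group (I k)) \<phi> (\<lambda>k. fun_cone (I k))"
  using assms
  by (intro ordered_system.intro direct_system.intro ordered_system_axioms.intro
      comm_group_fun_group submonoid_fun_cone fun_group_diff)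

lemma ordered_group_fun_dlim:
  assumes "ordered_system (\<lambda>k. fun_group (I k)) \<phi> (\<lambda>k. fun_cone (I k))"
  shows "ordered_group (dlim (\<lambda>k. fun_group (I k)) \<phi>)
    (dlim_cone (\<lambda>k. fun_group (I k)) \<phi> (\<lambda>k. fun_cone (I k)))"
  using assms fun_cone_pointed by (rule ordered_system.ordered_dlim)

lemma mat_map_hom: "mat_map m n M \<in> hom (Zgroup n) (Zgroup m)"
  by (rule homI) (auto simp: mat_map_def fun_group_simps algebra_simps sum.distrib)

lemma mat_map_pos:
  assumes "\<And>i j. i < m \<Longrightarrow> j < n \<Longrightarrow> 0 \<le> M i j" and "x \<in> Zcone n"
  shows "mat_map m n M x \<in> Zcone m"
  using assms by (auto simp: mat_map_def fun_cone_iff intro!: sum_nonneg)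

lemma ordered_system_mat_map:
  assumes "\<And>k i j. i < r (Suc k) \<Longrightarrow> j < r k \<Longrightarrow> 0 \<le> A k i j"
  shows "ordered_system (\<lambda>k. Zgroup (r k)) (\<lambda>k. mat_map (r (Suc k)) (r k) (A k)) (\<lambda>k. Zcone (r k))"
  using assms by (intro ordered_system_fun_group mat_map_hom mat_map_pos)

section \<open>Functions on an enumerated set as integer vectors\<close>

definition enum :: "nat \<Rightarrow> (nat \<Rightarrow> 'i) \<Rightarrow> ('i \<Rightarrow> int) \<Rightarrow> nat \<Rightarrow> int" where
  "enum n a g = (\<lambda>j\<in>{..<n}. g (a j))"

text \<open>The inverse renaming. Its domain is the range of \<open>a\<close>, which is the index
  set once \<open>a\<close> is a bijection.\<close>

definition denum :: "nat \<Rightarrow> (nat \<Rightarrow> 'i) \<Rightarrow> (nat \<Rightarrow> int) \<Rightarrow> 'i \<Rightarrow> int" where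
  "denum n a x = (\<lambda>i\<in>a ` {..<n}. x (inv_into {..<n} a i))"

lemma
  assumes a: "bij_betw a {..<n} I"
  shows enum_hom: "enum n a \<in> hom (fun_group I) (Zgroup n)"
    and denum_hom: "denum n a \<in> hom (Zgroup n) (fun_group I)"
    and denum_enum: "g \<in> carrier (fun_group I) \<Longrightarrow> denum n a (enum n a g) = g"
    and enum_pos: "g \<in> fun_cone I \<Longrightarrow> enum n a g \<in> Zcone n"
    and denum_pos: "x \<in> Zcone n \<Longrightarrow> denum n a x \<in> fun_cone I"
proof -
  have I: "a ` {..<n} = I" using a by (auto simp: bij_betw_def)
  have inv': "a (inv_into {..<n} a i) = i" "inv_into {..<n} a i < n" if "i \<in> I" for i
    using that I f_inv_into_f[of i a "{..<n}"] inv_into_into[of i a "{..<n}"] by auto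
  have mem: "a j \<in> I" if "j < n" for j using I that by auto
  show "enum n a \<in> hom (fun_group I) (Zgroup n)"
    by (rule homI) (auto simp: enum_def fun_group_simps mem)
  show "denum n a \<in> hom (Zgroup n) (fun_group I)"
    unfolding denum_def I by (rule homI) (auto simp: fun_group_simps inv')
  show "g \<in> carrier (fun_group I) \<Longrightarrow> denum n a (enum n a g) = g"
    unfolding denum_def I by (auto simp: enum_def inv' fun_group_simps extensional_def fun_eq_iff)
  show "g \<in> fun_cone I \<Longrightarrow> enum n a g \<in> Zcone n"
    by (auto simp: enum_def fun_cone_iff mem)
  show "x \<in> Zcone n \<Longrightarrow> denum n a x \<in> fun_cone I"
    unfolding denum_def I by (auto simp: fun_cone_iff inv')
qed

text \<open>An integer kernel \<open>z\<close> becomes a matrix once both index sets are enumerated.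
  It serves for adjacency numbers and for the coefficients of cycles.\<close>

lemma enum_sum_eq_mat_map:
  assumes a: "bij_betw a {..<n} I" and b: "bij_betw b {..<m} J" and x: "x \<in> carrier (Zgroup n)"
  shows "enum m b (\<lambda>j\<in>J. \<Sum>i\<in>I. z j i * denum n a x i) = mat_map m n (\<lambda>j i. z (b j) (a i)) x"
proof -
  have I: "a ` {..<n} = I" and inj: "inj_on a {..<n}" using a by (auto simp: bij_betw_def)
  have "(\<Sum>i\<in>I. z (b j) i * denum n a x i) = (\<Sum>i<n. z (b j) (a i) * x i)" for j
    unfolding I[symmetric] using inj by (subst sum.reindex) (auto simp: denum_def intro!: sum.cong)
  moreover have "b j \<in> J" if "j < m" for j using b that by (auto simp: bij_betw_def)
  ultimately show ?thesis by (auto simp: enum_def mat_map_def fun_eq_iff)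
qed

text \<open>Passes from a sum along a word to multiplicities, the form in which matrix entries
  occur.\<close>

lemma sum_list_eq_count_sum:
  fixes g :: "'i \<Rightarrow> int"
  assumes "finite I" "set es \<subseteq> I"
  shows "sum_list (map g es) = (\<Sum>i\<in>I. int (count_list es i) * g i)"
  using assms(2)
proof (induction es)
  case (Cons e es)
  have "(\<Sum>i\<in>I. int (count_list (e # es) i) * g i)
      = (\<Sum>i\<in>I. (if i = e then g i else 0) + int (count_list es i) * g i)"
    by (intro sum.cong) (auto simp: algebra_simps)
  also have "\<dots> = g e + (\<Sum>i\<in>I. int (count_list es i) * g i)"
    using Cons.prems assms(1) by (simp add: sum.distrib)
  finally show ?case using Cons by simp
qed simp

section \<open>Coboundaries\<close>

lemma edge_group_simps:
  "carrier (edge_group X) = extensional (edges X)"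
  "x \<otimes>\<^bsub>edge_group X\<^esub> y = (\<lambda>e\<in>edges X. x e + y e)"
  "\<one>\<^bsub>edge_group X\<^esub> = (\<lambda>e\<in>edges X. 0)"
  by (simp_all add: edge_group_def fun_group_simps)

interpretation edge_group: comm_group "edge_group X" for X :: "'x digraph"
  unfolding edge_group_def by (rule comm_group_fun_group)

lemma inv_edge_group: "x \<in> extensional (edges X) \<Longrightarrow> inv\<^bsub>edge_group X\<^esub> x = (\<lambda>e\<in>edges X. - x e)"
  by (simp add: edge_group_def inv_fun_group)

lemma pow_edge_group:
  "x \<in> extensional (edges X) \<Longrightarrow> x [^]\<^bsub>edge_group X\<^esub> (n::nat) = (\<lambda>e\<in>edges X. int n * x e)"
  by (simp add: edge_group_def pow_fun_group)

text \<open>Source minus target, the sign for which a vertex function is the coboundary of the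
  indicator of its vertex; on loops both vanish.\<close>

definition coboundary :: "'x digraph \<Rightarrow> ('x \<Rightarrow> int) \<Rightarrow> (real \<Rightarrow> 'x) \<Rightarrow> int" where
  "coboundary X c = (\<lambda>e\<in>edges X. c (e 0) - c (e 1))"

lemma vertex_fun_eq_coboundary: "vertex_fun X v = coboundary X (\<lambda>u. of_bool (u = v))"
  by (auto simp: vertex_fun_def coboundary_def fun_eq_iff)

lemma vertex_fun_closed: "vertex_fun X ` verts X \<subseteq> carrier (edge_group X)"
  by (auto simp: vertex_fun_def edge_group_simps)

lemma subgroup_vertex_subgroup: "subgroup (vertex_subgroup X) (edge_group X)"
  unfolding vertex_subgroup_def
  by (rule edge_group.generate_is_subgroup[OF vertex_fun_closed])

text \<open>The sum telescopes, so only the ends of the path matter.\<close>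

lemma sum_list_coboundary:
  "edge_path X u es v \<Longrightarrow> sum_list (map (coboundary X c) es) = c u - c v"
  by (induction es arbitrary: u) (auto simp: coboundary_def)

lemma int_pow_fun_group:
  assumes "x \<in> extensional I"
  shows "x [^]\<^bsub>fun_group I\<^esub> (z::int) = (\<lambda>i\<in>I. z * x i)"
proof (cases z rule: int_cases2)
  case (nonneg n)
  then show ?thesis
    using assms by (simp only: int_pow_int pow_fun_group)
next
  case (nonpos n)
  then have "x [^]\<^bsub>fun_group I\<^esub> z = inv\<^bsub>fun_group I\<^esub> (\<lambda>i\<in>I. int n * x i)"
    using assms by (simp only: fun_group.int_pow_neg_int fun_group_simps pow_fun_group)
  also have "\<dots> = (\<lambda>i\<in>I. - (\<lambda>i\<in>I. int n * x i) i)"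
    by (rule inv_fun_group) simp
  also have "\<dots> = (\<lambda>i\<in>I. z * x i)"
    using nonpos by (intro restrict_ext) simp
  finally show ?thesis .
qed

section \<open>Functions modulo coboundaries\<close>

context digraph begin

text \<open>A coboundary is the combination of vertex functions with coefficients
  \<open>c v\<close>, a finite sum since there are finitely many vertices.\<close>

lemma vertex_subgroup_eq: "vertex_subgroup X = range (coboundary X)"
proof
  have "x \<in> range (coboundary X)" if "x \<in> generate (edge_group X) (vertex_fun X ` verts X)" for x
    using that
  proof (induction rule: generate.induct)
    case one
    have "\<one>\<^bsub>edge_group X\<^esub> = coboundary X (\<lambda>_. 0)"
      by (auto simp: edge_group_simps coboundary_def)
    then show ?case by blast
  next
    case (incl h)
    then show ?case by (auto simp: vertex_fun_eq_coboundary)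
  next
    case (inv h)
    then obtain v where "h = coboundary X (\<lambda>u. of_bool (u = v))"
      by (auto simp: vertex_fun_eq_coboundary)
    then have "inv\<^bsub>edge_group X\<^esub> h = coboundary X (\<lambda>u. - of_bool (u = v))"
      by (simp add: coboundary_def inv_edge_group) (auto simp: fun_eq_iff)
    then show ?case by blast
  next
    case (eng h1 h2)
    then obtain c d where "h1 = coboundary X c" "h2 = coboundary X d" by blast
    then have "h1 \<otimes>\<^bsub>edge_group X\<^esub> h2 = coboundary X (\<lambda>u. c u + d u)"
      by (auto simp: edge_group_simps coboundary_def fun_eq_iff)
    then show ?case by blast
  qed
  then show "vertex_subgroup X \<subseteq> range (coboundary X)"
    by (auto simp: vertex_subgroup_def)
  interpret V: subgroup "vertex_subgroup X" "edge_group X"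
    by (rule subgroup_vertex_subgroup)
  \<comment> \<open>Cutting \<open>c\<close> off outside \<open>S\<close> allows adding one vertex
    function at a time.\<close>
  have "coboundary X (\<lambda>u. if u \<in> S then c u else 0) \<in> vertex_subgroup X"
    if "finite S" "S \<subseteq> verts X" for S and c :: "'x \<Rightarrow> int"
    using that
  proof (induction S)
    case empty
    have "coboundary X (\<lambda>u. if u \<in> {} then c u else 0) = \<one>\<^bsub>edge_group X\<^esub>"
      by (auto simp: coboundary_def edge_group_simps)
    then show ?case using V.one_closed by metis
  next
    case (insert v S)
    have "vertex_fun X v [^]\<^bsub>edge_group X\<^esub> c v \<in> vertex_subgroup X"
      using edge_group.int_pow_closed insert.prems
      by (intro edge_group.subgroup_int_pow_closed[OF subgroup_vertex_subgroup])
        (auto simp: vertex_subgroup_def intro: generate.incl)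
    moreover have "vertex_fun X v [^]\<^bsub>edge_group X\<^esub> c v = (\<lambda>e\<in>edges X. c v * vertex_fun X v e)"
      unfolding edge_group_def by (rule int_pow_fun_group) (simp add: vertex_fun_def)
    moreover have "coboundary X (\<lambda>u. if u \<in> insert v S then c u else 0)
      = (\<lambda>e\<in>edges X. c v * vertex_fun X v e) \<otimes>\<^bsub>edge_group X\<^esub> coboundary X (\<lambda>u. if u \<in> S then c u else 0)"
      using insert.hyps
      by (auto simp: vertex_fun_eq_coboundary coboundary_def edge_group_simps fun_eq_iff)
    ultimately show ?case using insert V.m_closed by auto
  qed
  from this[OF finite_verts order_refl]
  have "coboundary X (\<lambda>u. if u \<in> verts X then c u else 0) \<in> vertex_subgroup X" for c .
  \<comment> \<open>Edges begin and end at vertices, so values of \<open>c\<close> elsewhere have no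
    effect.\<close>
  moreover have "coboundary X (\<lambda>u. if u \<in> verts X then c u else 0) = coboundary X c" for c
    using edge_source edge_target by (auto simp: coboundary_def fun_eq_iff)
  ultimately show "range (coboundary X) \<subseteq> vertex_subgroup X" by auto
qed

definition coset :: "((real \<Rightarrow> 'x) \<Rightarrow> int) \<Rightarrow> ((real \<Rightarrow> 'x) \<Rightarrow> int) set" where
  "coset g = vertex_subgroup X #>\<^bsub>edge_group X\<^esub> g"

lemma normal_vertex_subgroup: "vertex_subgroup X \<lhd> edge_group X"
  by (rule edge_group.subgroup_imp_normal[OF subgroup_vertex_subgroup])

lemma coset_eq: "coset g = {\<lambda>e\<in>edges X. g e + coboundary X c e | c. True}"
  by (auto simp: coset_def r_coset_def vertex_subgroup_eq edge_group_simps add.commute)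

lemma coset_self: "g \<in> carrier (edge_group X) \<Longrightarrow> g \<in> coset g"
  unfolding coset_def by (rule edge_group.rcos_self[OF _ subgroup_vertex_subgroup])

lemma coset_eqI:
  assumes "g \<in> carrier (edge_group X)" "h \<in> carrier (edge_group X)"
    "\<And>e. e \<in> edges X \<Longrightarrow> g e = h e + coboundary X c e"
  shows "coset g = coset h"
proof -
  have "g = (\<lambda>e\<in>edges X. h e + coboundary X c e)"
    using assms by (auto simp: edge_group_simps extensional_def fun_eq_iff)
  then have "g \<in> coset h" unfolding coset_eq by blast
  then show ?thesis
    unfolding coset_def
    using edge_group.repr_independence[OF _ _ subgroup_vertex_subgroup] assms(2) by blast
qed

lemma carrier_graph_group: "carrier (graph_group X) = coset ` carrier (edge_group X)"
  by (auto simp: graph_group_def FactGroup_def RCOSETS_def coset_def)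

lemma coset_mult:
  "g \<in> carrier (edge_group X) \<Longrightarrow> h \<in> carrier (edge_group X) \<Longrightarrow>
   coset g \<otimes>\<^bsub>graph_group X\<^esub> coset h = coset (g \<otimes>\<^bsub>edge_group X\<^esub> h)"
  unfolding graph_group_def coset_def FactGroup_def
  by (simp add: normal.rcos_sum[OF normal_vertex_subgroup])

lemma coset_hom: "coset \<in> hom (edge_group X) (graph_group X)"
  by (rule homI) (auto simp: carrier_graph_group coset_mult)

lemma comm_group_graph_group: "comm_group (graph_group X)"
proof -
  interpret Q: group "graph_group X"
    unfolding graph_group_def by (rule normal.factorgroup_is_group[OF normal_vertex_subgroup])
  show ?thesis
  proof (rule Q.group_comm_groupI)
    fix a b assume "a \<in> carrier (graph_group X)" "b \<in> carrier (graph_group X)"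
    then obtain g h where "g \<in> carrier (edge_group X)" "a = coset g"
      "h \<in> carrier (edge_group X)" "b = coset h"
      by (auto simp: carrier_graph_group)
    then show "a \<otimes>\<^bsub>graph_group X\<^esub> b = b \<otimes>\<^bsub>graph_group X\<^esub> a"
      using edge_group.m_comm[of g X h] by (simp add: coset_mult)
  qed
qed

lemma graph_cone_eq: "graph_cone X = coset ` edge_cone X"
  by (simp add: graph_cone_def coset_def)

lemma edge_cone_carrier: "edge_cone X \<subseteq> carrier (edge_group X)"
  by (auto simp: edge_cone_def edge_group_def fun_cone_def)

lemma submonoid_edge_cone: "submonoid (edge_cone X) (edge_group X)"
  unfolding edge_cone_def edge_group_def by (rule submonoid_fun_cone)

lemma coset_group_hom: "group_hom (edge_group X) (graph_group X) coset"
  using coset_hom comm_group_graph_group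
  by (intro group_hom.intro group_hom_axioms.intro edge_group.is_group) (auto simp: comm_group_def)

lemma submonoid_graph_cone: "submonoid (graph_cone X) (graph_group X)"
proof -
  interpret h: group_hom "edge_group X" "graph_group X" coset
    by (rule coset_group_hom)
  show ?thesis
  proof
    show "graph_cone X \<subseteq> carrier (graph_group X)"
      using edge_cone_carrier by (auto simp: graph_cone_eq carrier_graph_group)
    show "\<one>\<^bsub>graph_group X\<^esub> \<in> graph_cone X"
      using submonoid.one_closed[OF submonoid_edge_cone] h.hom_one
      unfolding graph_cone_eq by (metis imageI)
    fix a b assume "a \<in> graph_cone X" "b \<in> graph_cone X"
    then obtain g h where gh: "g \<in> edge_cone X" "a = coset g" "h \<in> edge_cone X" "b = coset h"
      unfolding graph_cone_eq by blast
    then have "g \<in> carrier (edge_group X)" "h \<in> carrier (edge_group X)"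
      using edge_cone_carrier by blast+
    then have "a \<otimes>\<^bsub>graph_group X\<^esub> b = coset (g \<otimes>\<^bsub>edge_group X\<^esub> h)"
      using gh by (simp only: coset_mult)
    then show "a \<otimes>\<^bsub>graph_group X\<^esub> b \<in> graph_cone X"
      using submonoid.m_closed[OF submonoid_edge_cone gh(1,3)] unfolding graph_cone_eq by blast
  qed
qed

lemma graph_group_diff:
  assumes "x \<in> carrier (graph_group X)"
  shows "\<exists>a\<in>graph_cone X. \<exists>b\<in>graph_cone X. x = a \<otimes>\<^bsub>graph_group X\<^esub> inv\<^bsub>graph_group X\<^esub> b"
proof -
  interpret h: group_hom "edge_group X" "graph_group X" coset
    by (rule coset_group_hom)
  obtain g where g: "g \<in> carrier (edge_group X)" "x = coset g"
    using assms by (auto simp: carrier_graph_group)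
  then obtain a b where ab: "a \<in> edge_cone X" "b \<in> edge_cone X" "g = a \<otimes>\<^bsub>edge_group X\<^esub> inv\<^bsub>edge_group X\<^esub> b"
    using fun_group_diff unfolding edge_cone_def edge_group_def by blast
  then have "a \<in> carrier (edge_group X)" "b \<in> carrier (edge_group X)"
    using edge_cone_carrier by blast+
  then have "x = coset a \<otimes>\<^bsub>graph_group X\<^esub> inv\<^bsub>graph_group X\<^esub> (coset b)"
    using ab(3) g(2) h.hom_mult[of a "inv\<^bsub>edge_group X\<^esub> b"] h.hom_inv[of b] by simp
  then show ?thesis using ab unfolding graph_cone_eq by blast
qed

end

section \<open>Systems of graphs\<close>

text \<open>Makes \<open>op_map\<close> applicable to the edges themselves, which is how direction
  enters their images.\<close>

lemma (in digraph) op_path_edge: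
  assumes e: "e \<in> edges X"
  shows "op_path X e"
  unfolding op_path_def
proof (intro conjI ballI allI impI edge_pathin[OF e])
  fix e' J assume e': "e' \<in> edges X" and J: "J \<subseteq> {0..1} \<and> is_interval J \<and> e ` J \<subseteq> e' ` edge_params e'"
  have params: "edge_params e' \<subseteq> {0..1}" by (auto simp: edge_params_def)
  show "mono_on J (inv_into (edge_params e') e' \<circ> e)"
  proof (rule monotone_onI)
    fix s t assume st: "s \<in> J" "t \<in> J" "s \<le> t"
    show "(inv_into (edge_params e') e' \<circ> e) s \<le> (inv_into (edge_params e') e' \<circ> e) t"
    proof (cases "s = t")
      case False
      \<comment> \<open>A point strictly between two times is interior to \<open>e\<close> and lies
        on \<open>e'\<close>, which forces the two edges to coincide.\<close>
      define m where "m = (s + t) / 2"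
      have m: "s \<le> m" "m \<le> t" "s < m" "m < t" using st False by (auto simp: m_def)
      then have mJ: "m \<in> J" using J st mem_is_interval_1_I by blast
      have m01: "m \<in> {0<..<1}" using m st J by fastforce
      obtain u where u: "u \<in> edge_params e'" "e m = e' u" using J mJ by blast
      then have [simp]: "e' = e"
        using edge_point_unique[OF e e' m01] params by blast
      have "inv_into (edge_params e) e (e x) = x" if x: "x \<in> J" for x
      proof (rule inv_into_f_f[OF edge_params_inj[OF e]])
        obtain y where y: "y \<in> edge_params e" "e x = e y" using J x by auto
        show "x \<in> edge_params e"
        proof (cases "e 0 = e 1")
          case True
          \<comment> \<open>For a loop the inverse lives on the open interval; uniqueness of
            interior points shows that \<open>x\<close> itself lies there.\<close>
          then have "y \<in> {0<..<1}" using y by (simp add: edge_params_def)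
          then have "y = x" using edge_point_unique[OF e e, of y x] y J x by auto
          then show ?thesis using y by simp
        qed (use x J in \<open>auto simp: edge_params_def\<close>)
      qed
      then show ?thesis using st by simp
    qed simp
  qed
qed

text \<open>Between two occurrences of an edge the path returns to the start of that edge, so one
  occurrence and everything between can be cut out.\<close>

lemma edge_path_shorten:
  assumes "edge_path X u es v"
  obtains es' where "edge_path X u es' v" "distinct es'"
proof -
  have "\<exists>es'. edge_path X u es' v \<and> distinct es'"
    using assms
  proof (induction "length es" arbitrary: es rule: less_induct)
    case less
    show ?case
    proof (cases "distinct es")
      case False
      then obtain as bs cs e where "es = as @ [e] @ bs @ [e] @ cs"
        using not_distinct_decomp by blast
      then have "edge_path X u (as @ [e] @ cs) v" "length (as @ [e] @ cs) < length es"
        using less.prems by (auto simp: edge_path_append)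
      then show ?thesis using less.hyps by blast
    qed (use less.prems in blast)
  qed
  then show thesis using that by blast
qed

lemma bond_refl: "bond f k k = id"
  by (simp add: bond_def)

text \<open>\<open>bond\<close> is folded from the lowest level; inductions on the height need the
  topmost map split off.\<close>

lemma bond_Suc: "k \<le> l \<Longrightarrow> bond f k (Suc l) = bond f k l \<circ> f (Suc l)"
proof -
  have comp: "foldr (\<lambda>i. (\<circ>) (f i)) is g = foldr (\<lambda>i. (\<circ>) (f i)) is id \<circ> g" for "is" and g :: "'a \<Rightarrow> 'a"
    by (induction "is") (auto simp: comp_assoc)
  assume "k \<le> l"
  then have "bond f k (Suc l) = foldr (\<lambda>i. (\<circ>) (f i)) [Suc k..<Suc l] (f (Suc l))"
    by (simp add: bond_def upt_Suc_append del: upt_Suc)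
  also have "\<dots> = bond f k l \<circ> f (Suc l)"
    unfolding bond_def by (rule comp)
  finally show ?thesis .
qed

section \<open>Bonding maps and iterated edge words\<close>

locale graph_system =
  fixes X :: "nat \<Rightarrow> 'x digraph" and f :: "nat \<Rightarrow> 'x \<Rightarrow> 'x"
  assumes is_graph: "\<And>k. is_graph (X k)"
    and op_map: "\<And>k. op_map (X (Suc k)) (X k) (f (Suc k))"
    and verts_map: "\<And>k. f (Suc k) ` verts (X (Suc k)) \<subseteq> verts (X k)"
    and loc_inj_map: "\<And>k. locally_one_to_one (gtop (X (Suc k)))
          (topspace (gtop (X (Suc k))) - verts (X (Suc k))) (f (Suc k))"
begin

sublocale X: digraph "X k" for k
  by unfold_locales (rule is_graph)

text \<open>Interior points of an edge are no vertices, so local injectivity of the bonding map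
  applies along the open edge, where \<open>e\<close> is injective as well.\<close>

lemma vertex_path:
  assumes e: "e \<in> edges (X (Suc k))"
  shows "vertex_path (X k) (f (Suc k) \<circ> e)"
proof
  have cont: "continuous_map (top_of_set {0..1}) (gtop (X (Suc k))) e"
    using X.edge_pathin[OF e] by (simp add: pathin_def)
  show "op_path (X k) (f (Suc k) \<circ> e)"
    using op_map[of k] X.op_path_edge[OF e] by (auto simp: op_map_def)
  show "(f (Suc k) \<circ> e) 0 \<in> verts (X k)" "(f (Suc k) \<circ> e) 1 \<in> verts (X k)"
    using X.edge_source[OF e] X.edge_target[OF e] verts_map[of k] by auto
  show "locally_one_to_one euclideanreal {0<..<1} (f (Suc k) \<circ> e)"
    unfolding locally_one_to_one_def
  proof
    fix s :: real assume s: "s \<in> {0<..<1}"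
    define A where "A = topspace (gtop (X (Suc k))) - verts (X (Suc k))"
    have "e s \<in> A"
      using s X.edge_interior[OF e] X.edge_topspace[OF e] by (auto simp: A_def)
    then obtain W where W: "openin (subtopology (gtop (X (Suc k))) A) W" "e s \<in> W" "inj_on (f (Suc k)) W"
      using loc_inj_map[of k] unfolding locally_one_to_one_def A_def by blast
    have "continuous_map (top_of_set {0<..<1}) (subtopology (gtop (X (Suc k))) A) e"
    proof (rule continuous_map_into_subtopology)
      show "continuous_map (top_of_set {0<..<1}) (gtop (X (Suc k))) e"
        by (rule continuous_map_from_subtopology_mono[OF cont]) auto
      show "e \<in> topspace (top_of_set {0<..<1}) \<rightarrow> A"
        using X.edge_interior[OF e] X.edge_topspace[OF e] by (auto simp: A_def)
    qed
    then have "openin (top_of_set {0<..<1}) {t\<in>{0<..<1}. e t \<in> W}"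
      using openin_continuous_map_preimage[OF _ W(1)] by fastforce
    moreover have "inj_on (f (Suc k) \<circ> e) {t\<in>{0<..<1}. e t \<in> W}"
      using W(3) X.edge_inj[OF e] by (auto simp: inj_on_def)
    ultimately show "\<exists>W. openin (top_of_set {0<..<1}) W \<and> s \<in> W \<and> inj_on (f (Suc k) \<circ> e) W"
      using s W(2) by blast
  qed
qed

text \<open>The edge word in \<open>X k\<close> of the image of an edge of \<open>X (k + d)\<close>.\<close>

fun word :: "nat \<Rightarrow> nat \<Rightarrow> (real \<Rightarrow> 'x) \<Rightarrow> (real \<Rightarrow> 'x) list" where
  "word k 0 e = [e]"
| "word k (Suc d) e = concat (map (word k d) (edge_word (X (k + d)) (f (Suc (k + d)) \<circ> e)))"

lemma edge_word_edges:
  "e \<in> edges (X (Suc k)) \<Longrightarrow> set (edge_word (X k) (f (Suc k) \<circ> e)) \<subseteq> edges (X k)"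
  by (rule edge_path_edges[OF vertex_path.edge_path_edge_word[OF vertex_path]])

lemma word_nonempty: "e \<in> edges (X (k + d)) \<Longrightarrow> word k d e \<noteq> []"
proof (induction d arbitrary: e)
  case (Suc d)
  let ?w = "edge_word (X (k + d)) (f (Suc (k + d)) \<circ> e)"
  have e: "e \<in> edges (X (Suc (k + d)))" using Suc.prems by simp
  have "hd ?w \<in> set ?w"
    by (rule hd_in_set[OF vertex_path.edge_word_nonempty[OF vertex_path[OF e]]])
  moreover from this have "word k d (hd ?w) \<noteq> []"
    using edge_word_edges[OF e] by (intro Suc.IH) blast
  ultimately show ?case by auto
qed simp

lemma edge_path_word:
  "e \<in> edges (X (k + d)) \<Longrightarrow> edge_path (X k) (bond f k (k + d) (e 0)) (word k d e) (bond f k (k + d) (e 1))"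
proof (induction d arbitrary: e)
  case (Suc d)
  have *: "edge_path (X k) (bond f k (k + d) u) (concat (map (word k d) es)) (bond f k (k + d) v)"
    if "edge_path (X (k + d)) u es v" for u es v
    using that by (induction es arbitrary: u) (auto simp: edge_path_append intro: Suc.IH)
  show ?case
    using *[OF vertex_path.edge_path_edge_word[OF vertex_path, of e "k + d"]] Suc.prems
    by (simp add: bond_Suc)
qed (simp add: bond_refl)

lemma word_edges: "e \<in> edges (X (k + d)) \<Longrightarrow> set (word k d e) \<subseteq> edges (X k)"
  by (rule edge_path_edges[OF edge_path_word])

lemma word_covers:
  "e \<in> edges (X (k + d)) \<Longrightarrow> bond f k (k + d) ` e ` {0..1} \<subseteq> (\<Union>e'\<in>set (word k d e). e' ` {0..1})"
proof (induction d arbitrary: e)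
  case (Suc d)
  let ?w = "edge_word (X (k + d)) (f (Suc (k + d)) \<circ> e)"
  have "bond f k (k + Suc d) ` e ` {0..1} = bond f k (k + d) ` (f (Suc (k + d)) \<circ> e) ` {0..1}"
    by (simp add: bond_Suc image_comp)
  also have "\<dots> \<subseteq> bond f k (k + d) ` (\<Union>e'\<in>set ?w. e' ` {0..1})"
    using vertex_path.edge_word_covers[OF vertex_path] Suc.prems by (intro image_mono) simp
  also have "\<dots> = (\<Union>e'\<in>set ?w. bond f k (k + d) ` e' ` {0..1})" by blast
  also have "\<dots> \<subseteq> (\<Union>e'\<in>set ?w. \<Union>e''\<in>set (word k d e'). e'' ` {0..1})"
  proof (rule UN_mono[OF order_refl])
    fix e' assume "e' \<in> set ?w"
    then have "e' \<in> edges (X (k + d))"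
      using edge_word_edges[of e "k + d"] Suc.prems by auto
    then show "bond f k (k + d) ` e' ` {0..1} \<subseteq> (\<Union>e''\<in>set (word k d e'). e'' ` {0..1})"
      by (rule Suc.IH)
  qed
  also have "\<dots> = (\<Union>e'\<in>set (word k (Suc d) e). e' ` {0..1})" by simp
  finally show ?case .
qed (simp add: bond_refl)

text \<open>Turns covering the graph into a statement on words: the midpoint of an edge lies on no
  other edge, so a path reaching it must contain that edge.\<close>

lemma set_word_eq:
  assumes e: "e \<in> edges (X (k + d))" and onto: "bond f k (k + d) ` e ` {0..1} = topspace (gtop (X k))"
  shows "set (word k d e) = edges (X k)"
proof (intro equalityI subsetI)
  fix e' assume e': "e' \<in> edges (X k)"
  then have "e' (1 / 2) \<in> bond f k (k + d) ` e ` {0..1}"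
    unfolding onto by (intro X.edge_topspace) auto
  then have "e' (1 / 2) \<in> (\<Union>e''\<in>set (word k d e). e'' ` {0..1})"
    using word_covers[OF e] by blast
  then obtain e'' t where *: "e'' \<in> set (word k d e)" "t \<in> {0..1}" "e' (1 / 2) = e'' t" by blast
  then have "e'' \<in> edges (X k)" using word_edges[OF e] by blast
  then have "e' = e''" using X.edge_point_unique[of e' k e'' "1 / 2" t] e' * by simp
  then show "e' \<in> set (word k d e)" using * by simp
qed (use word_edges[OF e] in blast)

abbreviation pull :: "nat \<Rightarrow> nat \<Rightarrow> ((real \<Rightarrow> 'x) \<Rightarrow> int) \<Rightarrow> (real \<Rightarrow> 'x) \<Rightarrow> int" where
  "pull \<equiv> trans_map (pullback X f)"

text \<open>Summing along a concatenation adds the sums of its pieces, so pulling back level by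
  level amounts to evaluating along the iterated word.\<close>

lemma pull_eq_word:
  "e \<in> edges (X (k + d)) \<Longrightarrow> pull k (k + d) g e = sum_list (map g (word k d e))"
proof (induction d arbitrary: e)
  case (Suc d)
  let ?w = "edge_word (X (k + d)) (f (Suc (k + d)) \<circ> e)"
  have "pull k (k + Suc d) g e = sum_list (map (pull k (k + d) g) ?w)"
    using Suc.prems by (simp add: trans_map_Suc pullback_def)
  also have "map (pull k (k + d) g) ?w = map (\<lambda>e'. sum_list (map g (word k d e'))) ?w"
    using Suc edge_word_edges[of e "k + d"] by (intro map_cong) auto
  also have "sum_list \<dots> = sum_list (map g (concat (map (word k d) ?w)))"
  proof -
    have "sum_list (map (\<lambda>e'. sum_list (map g (F e'))) es) = sum_list (map g (concat (map F es)))"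
      for F :: "(real \<Rightarrow> 'x) \<Rightarrow> (real \<Rightarrow> 'x) list" and es
      by (induction es) auto
    then show ?thesis .
  qed
  finally show ?case by simp
qed simp

section \<open>The two direct systems of ordered groups\<close>

sublocale C: ordered_system "\<lambda>k. edge_group (X k)" "pullback X f" "\<lambda>k. edge_cone (X k)"
  unfolding edge_group_def edge_cone_def
proof (rule ordered_system_fun_group)
  show "pullback X f k \<in> hom (fun_group (edges (X k))) (fun_group (edges (X (Suc k))))" for k
  proof (rule homI)
    fix g h :: "(real \<Rightarrow> 'x) \<Rightarrow> int"
    have "sum_list (map (\<lambda>i\<in>edges (X k). g i + h i) (edge_word (X k) (f (Suc k) \<circ> e)))
       = sum_list (map g (edge_word (X k) (f (Suc k) \<circ> e))) + sum_list (map h (edge_word (X k) (f (Suc k) \<circ> e)))"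
      if "e \<in> edges (X (Suc k))" for e
    proof -
      have "map (\<lambda>i\<in>edges (X k). g i + h i) (edge_word (X k) (f (Suc k) \<circ> e))
          = map (\<lambda>i. g i + h i) (edge_word (X k) (f (Suc k) \<circ> e))"
        using edge_word_edges[OF that] by (intro map_cong) auto
      then show ?thesis by (simp only: sum_list_addf)
    qed
    then show "pullback X f k (g \<otimes>\<^bsub>fun_group (edges (X k))\<^esub> h)
        = pullback X f k g \<otimes>\<^bsub>fun_group (edges (X (Suc k)))\<^esub> pullback X f k h"
      by (auto simp: pullback_def fun_group_simps fun_eq_iff)
  qed (simp add: pullback_def fun_group_simps)
  show "pullback X f k g \<in> fun_cone (edges (X (Suc k)))" if "g \<in> fun_cone (edges (X k))" for k g
    using that edge_word_edges[of _ k]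
    by (fastforce simp: pullback_def fun_cone_iff intro!: sum_list_nonneg)
qed

text \<open>Telescoping along the image of an edge. Hence pulling back descends to the
  quotients.\<close>

lemma pullback_coboundary:
  "pullback X f k (coboundary (X k) c) = coboundary (X (Suc k)) (c \<circ> f (Suc k))"
  using sum_list_coboundary[OF vertex_path.edge_path_edge_word[OF vertex_path]]
  by (auto simp: pullback_def coboundary_def fun_eq_iff)

text \<open>Representatives differ by a coboundary, and its pullback is a coboundary again, so the
  union defining \<open>graph_map\<close> consists of a single coset.\<close>

lemma graph_map_coset:
  assumes g: "g \<in> carrier (edge_group (X k))"
  shows "graph_map X f k (X.coset k g) = X.coset (Suc k) (pullback X f k g)"
proof -
  have "X.coset (Suc k) (pullback X f k h) = X.coset (Suc k) (pullback X f k g)" if h: "h \<in> X.coset k g" for h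
  proof -
    obtain c where c: "h = (\<lambda>e\<in>edges (X k). g e + coboundary (X k) c e)"
      using h by (auto simp: X.coset_eq)
    have cob: "coboundary (X k) c \<in> carrier (edge_group (X k))"
      by (simp add: coboundary_def edge_group_simps)
    have "h = g \<otimes>\<^bsub>edge_group (X k)\<^esub> coboundary (X k) c" by (simp add: c edge_group_simps)
    then have "pullback X f k h
      = pullback X f k g \<otimes>\<^bsub>edge_group (X (Suc k))\<^esub> coboundary (X (Suc k)) (c \<circ> f (Suc k))"
      using hom_mult[OF C.hom_step g cob] by (simp only: pullback_coboundary)
    then show ?thesis
      by (intro X.coset_eqI[where c = "c \<circ> f (Suc k)"]) (simp_all add: edge_group_simps pullback_def)
  qed
  then show ?thesis
    using X.coset_self[OF g] unfolding graph_map_def X.coset_def by blast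
qed

sublocale G: ordered_system "\<lambda>k. graph_group (X k)" "graph_map X f" "\<lambda>k. graph_cone (X k)"
proof (intro ordered_system.intro direct_system.intro ordered_system_axioms.intro
    X.comm_group_graph_group X.submonoid_graph_cone X.graph_group_diff)
  show "graph_map X f k \<in> hom (graph_group (X k)) (graph_group (X (Suc k)))" for k
  proof (rule homI)
    fix a assume "a \<in> carrier (graph_group (X k))"
    then show "graph_map X f k a \<in> carrier (graph_group (X (Suc k)))"
      using hom_in_carrier[OF C.hom_step[of k]]
      by (auto simp: X.carrier_graph_group graph_map_coset)
  next
    fix a b assume "a \<in> carrier (graph_group (X k))" "b \<in> carrier (graph_group (X k))"
    then obtain g h where gh: "g \<in> carrier (edge_group (X k))" "a = X.coset k g"
      "h \<in> carrier (edge_group (X k))" "b = X.coset k h"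
      by (auto simp: X.carrier_graph_group)
    then show "graph_map X f k (a \<otimes>\<^bsub>graph_group (X k)\<^esub> b)
        = graph_map X f k a \<otimes>\<^bsub>graph_group (X (Suc k))\<^esub> graph_map X f k b"
      using hom_in_carrier[OF C.hom_step[of k]] hom_mult[OF C.hom_step[of k]]
      by (simp add: X.coset_mult graph_map_coset)
  qed
  show "graph_map X f k a \<in> graph_cone (X (Suc k))" if "a \<in> graph_cone (X k)" for k a
    using that C.P_carrier C.P_step by (auto simp: X.graph_cone_eq graph_map_coset)
qed

lemma trans_graph_map_coset:
  assumes "k \<le> m" "g \<in> carrier (edge_group (X k))"
  shows "trans_map (graph_map X f) k m (X.coset k g) = X.coset m (pull k m g)"
  using assms
proof (induction m rule: dec_induct)
  case (step m)
  then show ?case by (simp add: trans_map_Suc graph_map_coset)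
qed simp

end

section \<open>The direct limits of a presentation\<close>

text \<open>Only a preorder is assumed: pointedness of the cone is inherited from the limit of
  simplicially ordered groups.\<close>

lemma dimension_groupI:
  fixes r :: "nat \<Rightarrow> nat"
  assumes "preordered_group G P" and "\<And>k i j. i < r (Suc k) \<Longrightarrow> j < r k \<Longrightarrow> 0 \<le> A k i j"
    and "order_isomorphic G P (dlim (\<lambda>k. Zgroup (r k)) (\<lambda>k. mat_map (r (Suc k)) (r k) (A k)))
      (dlim_cone (\<lambda>k. Zgroup (r k)) (\<lambda>k. mat_map (r (Suc k)) (r k) (A k)) (\<lambda>k. Zcone (r k)))"
  shows "dimension_group G P"
proof -
  have "ordered_group G P"
    using ordered_group_transfer[OF assms(1) ordered_group_fun_dlim[OF ordered_system_mat_map] assms(3)]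
      assms(2) by blast
  then show ?thesis
    unfolding dimension_group_def Let_def using assms(2,3) by blast
qed

lemma count_list_distinct: "distinct xs \<Longrightarrow> count_list xs x \<le> 1"
  by (induction xs) (auto simp: count_list_0_iff)

context graph_system begin

lemma limC_dimension:
  assumes en: "\<And>k. bij_betw (en k) {..<card (edges (X k))} (edges (X k))"
  shows "dimension_group (limC X f) (limC_cone X f)"
    and "ordered_group (limZ X f en) (limZ_cone X f en)"
    and "order_isomorphic (limC X f) (limC_cone X f) (limZ X f en) (limZ_cone X f en)"
proof -
  let ?r = "\<lambda>k. card (edges (X k))"
  have nonneg: "0 \<le> adj_matrix X f en k i j" for k i j
    by (simp add: adj_matrix_def)
  have H: "ordered_system (\<lambda>k. Zgroup (?r k)) (\<lambda>k. mat_map (?r (Suc k)) (?r k) (adj_matrix X f en k))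
      (\<lambda>k. Zcone (?r k))"
    using nonneg by (rule ordered_system_mat_map)
  have adj: "adj_map X f en = (\<lambda>k. mat_map (?r (Suc k)) (?r k) (adj_matrix X f en k))"
    by (simp add: adj_map_def fun_eq_iff)
  show "ordered_group (limZ X f en) (limZ_cone X f en)"
    unfolding limZ_def limZ_cone_def adj by (rule ordered_group_fun_dlim[OF H])
  show iso: "order_isomorphic (limC X f) (limC_cone X f) (limZ X f en) (limZ_cone X f en)"
    unfolding limC_def limC_cone_def limZ_def limZ_cone_def adj
  proof (rule order_isomorphic_intertwine[OF C.ordered_system_axioms H])
    \<comment> \<open>The ladder without skipping levels: \<open>\<beta>\<close> renames indices,
      and \<open>\<sigma>\<close> pulls back and then renames, so \<open>\<sigma>\<beta>\<close> is
      the adjacency matrix.\<close>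
    show "strict_mono (\<lambda>i::nat. i)" by (simp add: strict_mono_def)
    show "denum (?r i) (en i) \<in> hom (Zgroup (?r i)) (edge_group (X i))" for i
      unfolding edge_group_def by (rule denum_hom[OF en])
    show "enum (?r (Suc i)) (en (Suc i)) \<circ> pullback X f i \<in> hom (edge_group (X i)) (Zgroup (?r (Suc i)))" for i
      using C.hom_step[of i] enum_hom[OF en, of "Suc i"] unfolding edge_group_def by (rule hom_compose)
    show "(enum (?r (Suc i)) (en (Suc i)) \<circ> pullback X f i) (denum (?r i) (en i) x)
        = mat_map (?r (Suc i)) (?r i) (adj_matrix X f en i) x"
      if "x \<in> carrier (Zgroup (?r i))" for i x
    proof -
      have "pullback X f i g = (\<lambda>e\<in>edges (X (Suc i)). \<Sum>j\<in>edges (X i).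
          int (count_list (edge_word (X i) (f (Suc i) \<circ> e)) j) * g j)" for g
        unfolding pullback_def
        by (intro restrict_ext sum_list_eq_count_sum X.finite_edges edge_word_edges)
      then show ?thesis
        using enum_sum_eq_mat_map[OF en en that, of "Suc i" "\<lambda>e j. int (count_list (edge_word (X i) (f (Suc i) \<circ> e)) j)"]
        by (simp add: adj_matrix_def[abs_def])
    qed
    show "denum (?r (Suc i)) (en (Suc i)) ((enum (?r (Suc i)) (en (Suc i)) \<circ> pullback X f i) y)
        = trans_map (pullback X f) i (Suc i) y" if "y \<in> carrier (edge_group (X i))" for i y
    proof -
      have "pullback X f i y \<in> carrier (fun_group (edges (X (Suc i))))"
        using hom_in_carrier[OF C.hom_step that] by (simp add: edge_group_def)
      then show ?thesis
        using denum_enum[OF en] by (simp add: trans_map_Suc)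
    qed
    show "denum (?r i) (en i) x \<in> edge_cone (X i)" if "x \<in> Zcone (?r i)" for i x
      unfolding edge_cone_def using denum_pos[OF en that] .
    show "(enum (?r (Suc i)) (en (Suc i)) \<circ> pullback X f i) y \<in> Zcone (?r (Suc i))"
      if "y \<in> edge_cone (X i)" for i y
      using enum_pos[OF en] C.P_step[OF that] by (simp add: edge_cone_def)
  qed
  show "dimension_group (limC X f) (limC_cone X f)"
  proof (rule dimension_groupI[OF _ nonneg])
    show "preordered_group (limC X f) (limC_cone X f)"
      unfolding limC_def limC_cone_def by (rule C.preordered_dlim)
    show "order_isomorphic (limC X f) (limC_cone X f)
        (dlim (\<lambda>k. Zgroup (?r k)) (\<lambda>k. mat_map (?r (Suc k)) (?r k) (adj_matrix X f en k)))
        (dlim_cone (\<lambda>k. Zgroup (?r k)) (\<lambda>k. mat_map (?r (Suc k)) (?r k) (adj_matrix X f en k)) (\<lambda>k. Zcone (?r k)))"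
      using iso by (simp add: limZ_def limZ_cone_def adj)
  qed
qed

text \<open>Correcting the path of an edge by short paths from its ends to a base vertex makes it a cycle, so
  that it pairs with functions modulo coboundaries; the correction keeps it nonnegative because the
  path covers every edge.\<close>

lemma cycle_lift:
  assumes cov: "\<And>e. e \<in> edges (X (k + d)) \<Longrightarrow> set (word k d e) = edges (X k)"
  obtains z :: "(real \<Rightarrow> 'x) \<Rightarrow> (real \<Rightarrow> 'x) \<Rightarrow> int"
  where "\<And>e j. e \<in> edges (X (k + d)) \<Longrightarrow> j \<in> edges (X k) \<Longrightarrow> 0 \<le> z e j"
    and "\<And>e c. e \<in> edges (X (k + d)) \<Longrightarrow> (\<Sum>j\<in>edges (X k). z e j * coboundary (X k) c j) = 0"
    and "\<And>g. \<exists>c. \<forall>e\<in>edges (X (k + d)).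
           (\<Sum>j\<in>edges (X k). z e j * g j) = pull k (k + d) g e + coboundary (X (k + d)) c e"
proof (cases "edges (X k) = {}")
  case True
  \<comment> \<open>An edge above would have a nonempty word in a graph without edges.\<close>
  then have "edges (X (k + d)) = {}" using cov word_nonempty by fastforce
  then show thesis using that[of "\<lambda>_ _. 0"] by simp
next
  case False
  then obtain e0 where e0: "e0 \<in> edges (X k)" by blast
  define w where "w = e0 0"
  let ?F = "bond f k (k + d)"
  have "\<exists>es. edge_path (X k) (?F v) es w \<and> distinct es" if v: "v \<in> verts (X (k + d))" for v
  proof -
    \<comment> \<open>The word of an edge leaving \<open>v\<close> contains \<open>e0\<close>; its
      part before \<open>e0\<close> is a path from the image of \<open>v\<close> to the base vertex
      \<open>w\<close>.\<close>
    obtain e where e: "e \<in> edges (X (k + d))" "e 0 = v"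
      using X.outgoing_edge[OF v] by blast
    have "e0 \<in> set (word k d e)" using cov[OF e(1)] e0 by simp
    then obtain as bs where "word k d e = as @ e0 # bs"
      by (meson split_list)
    then have "edge_path (X k) (?F v) as w"
      using edge_path_word[OF e(1)] unfolding e(2) w_def by (auto simp: edge_path_append)
    then obtain es where "edge_path (X k) (?F v) es w" "distinct es"
      by (rule edge_path_shorten)
    then show ?thesis by blast
  qed
  then obtain q where q: "\<And>v. v \<in> verts (X (k + d)) \<Longrightarrow> edge_path (X k) (?F v) (q v) w"
    and dist: "\<And>v. v \<in> verts (X (k + d)) \<Longrightarrow> distinct (q v)"
    by metis
  \<comment> \<open>Multiplicities of the closed chain that comes from \<open>w\<close> backwards
    along \<open>q (e 0)\<close>, follows the word of \<open>e\<close> and returns along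
    \<open>q (e 1)\<close>.\<close>
  define z where "z e j = int (count_list (word k d e) j) - int (count_list (q (e 0)) j)
    + int (count_list (q (e 1)) j)" for e j
  have pair: "(\<Sum>j\<in>edges (X k). z e j * g j)
      = sum_list (map g (word k d e)) - sum_list (map g (q (e 0))) + sum_list (map g (q (e 1)))"
    if e: "e \<in> edges (X (k + d))" for e g
  proof -
    have "set (q (e 0)) \<subseteq> edges (X k)" "set (q (e 1)) \<subseteq> edges (X k)"
      using edge_path_edges[OF q] X.edge_source[OF e] X.edge_target[OF e] by auto
    then show ?thesis
      using word_edges[OF e] X.finite_edges[of k]
      by (simp add: sum_list_eq_count_sum z_def algebra_simps sum.distrib sum_subtractf)
  qed
  show thesis
  proof (rule that[of z])
    fix e j assume e: "e \<in> edges (X (k + d))" and j: "j \<in> edges (X k)"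
    \<comment> \<open>At least one occurrence in the word pays for the at most one that is
      subtracted.\<close>
    have "count_list (word k d e) j \<noteq> 0"
      using cov[OF e] j by (simp add: count_list_0_iff)
    moreover have "count_list (q (e 0)) j \<le> 1"
      by (rule count_list_distinct[OF dist[OF X.edge_source[OF e]]])
    ultimately show "0 \<le> z e j" by (simp add: z_def)
  next
    fix e c assume e: "e \<in> edges (X (k + d))"
    \<comment> \<open>The three telescoped sums cancel, as both correcting paths end at
      \<open>w\<close>.\<close>
    show "(\<Sum>j\<in>edges (X k). z e j * coboundary (X k) c j) = 0"
      using sum_list_coboundary[OF edge_path_word[OF e]] sum_list_coboundary[OF q[OF X.edge_source[OF e]]]
        sum_list_coboundary[OF q[OF X.edge_target[OF e]]]
      by (simp add: pair[OF e])
  next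
    \<comment> \<open>The potential at \<open>v\<close> is minus the sum of \<open>g\<close> along
      \<open>q v\<close>; the sign matches source minus target in \<open>coboundary\<close>.\<close>
    fix g
    show "\<exists>c. \<forall>e\<in>edges (X (k + d)).
           (\<Sum>j\<in>edges (X k). z e j * g j) = pull k (k + d) g e + coboundary (X (k + d)) c e"
      by (intro exI[of _ "\<lambda>v. - sum_list (map g (q v))"] ballI)
        (simp add: pair pull_eq_word coboundary_def)
  qed
qed

end

section \<open>Consequences of the Simplicity Condition\<close>

locale simple_graph_system = graph_system +
  assumes simplicity: "simplicity_condition X f"
begin

lemma words_cover:
  assumes "k \<ge> 1"
  obtains m where "m \<ge> k"
    "\<And>l e. l \<ge> m \<Longrightarrow> e \<in> edges (X l) \<Longrightarrow> set (word k (l - k) e) = edges (X k)"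
proof -
  from simplicity assms obtain m where m: "m \<ge> k"
    "\<forall>l\<ge>m. \<forall>e\<in>edges (X l). bond f k l ` e ` {0..1} = topspace (gtop (X k))"
    by (auto simp: simplicity_condition_def)
  have "set (word k (l - k) e) = edges (X k)" if le: "l \<ge> m" "e \<in> edges (X l)" for l e
    using set_word_eq[of e k "l - k"] m(1) m(2)[rule_format, OF le] le by simp
  then show thesis using that m(1) by blast
qed

text \<open>A nonzero nonnegative integer function is at least 1 on some edge, and far enough up
  every word contains that edge.\<close>

lemma eventually_positive:
  assumes g: "g \<in> edge_cone (X k)"
  obtains m where "m \<ge> k" "(\<forall>e\<in>edges (X m). 1 \<le> pull k m g e) \<or> pull k m g = \<one>\<^bsub>edge_group (X m)\<^esub>"
proof -
  \<comment> \<open>The Simplicity Condition speaks of levels from 1 on, so level 0 is left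
    first.\<close>
  define l where "l = max k 1"
  have l: "k \<le> l" "1 \<le> l" by (auto simp: l_def)
  define h where "h = pull k l g"
  have h: "h \<in> edge_cone (X l)" unfolding h_def by (rule C.trans_map_P[OF l(1) g])
  then have ext: "h \<in> extensional (edges (X l))" and nonneg: "\<And>e. e \<in> edges (X l) \<Longrightarrow> 0 \<le> h e"
    by (auto simp: edge_cone_def fun_cone_iff)
  show thesis
  proof (cases "\<exists>e\<in>edges (X l). h e \<noteq> 0")
    case True
    then obtain e0 where e0: "e0 \<in> edges (X l)" "1 \<le> h e0" using nonneg by force
    obtain m where m: "m \<ge> l" "\<And>e. e \<in> edges (X m) \<Longrightarrow> set (word l (m - l) e) = edges (X l)"
      using words_cover[OF l(2)] by (metis order_refl)
    have "1 \<le> pull k m g e" if e: "e \<in> edges (X m)" for e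
    proof -
      obtain as bs where split: "word l (m - l) e = as @ e0 # bs"
        using m(2)[OF e] e0(1) by (metis in_set_conv_decomp)
      then have "set as \<subseteq> edges (X l)" "set bs \<subseteq> edges (X l)" using m(2)[OF e] by auto
      then have "0 \<le> sum_list (map h as)" "0 \<le> sum_list (map h bs)"
        by (auto intro!: sum_list_nonneg nonneg)
      moreover have "pull k m g e = sum_list (map h (word l (m - l) e))"
        using pull_eq_word[of e l "m - l" h] e m(1) trans_map_trans[OF l(1) m(1), of "pullback X f" g]
        by (simp add: h_def)
      ultimately show ?thesis using split e0 by simp
    qed
    then show thesis using that[of m] m l by auto
  next
    case False
    then have "h = \<one>\<^bsub>edge_group (X l)\<^esub>"
      using ext by (auto simp: edge_group_simps extensional_def fun_eq_iff)
    then show thesis using that[of l] l by (simp add: h_def)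
  qed
qed

lemma dominate:
  assumes "g \<in> carrier (edge_group (X m))" "\<And>e. e \<in> edges (X m) \<Longrightarrow> 1 \<le> g e" and h: "h \<in> edge_cone (X m)"
  obtains n :: nat where "inv\<^bsub>edge_group (X m)\<^esub> h \<otimes>\<^bsub>edge_group (X m)\<^esub> g [^]\<^bsub>edge_group (X m)\<^esub> n \<in> edge_cone (X m)"
proof
  have ext: "h \<in> extensional (edges (X m))" and nonneg: "\<And>e. e \<in> edges (X m) \<Longrightarrow> 0 \<le> h e"
    using h by (auto simp: edge_cone_def fun_cone_iff)
  \<comment> \<open>The total of \<open>h\<close> bounds each of its values, and \<open>g\<close> is
    at least 1 everywhere.\<close>
  define n where "n = nat (\<Sum>e\<in>edges (X m). h e)"
  have "h e \<le> int n * g e" if e: "e \<in> edges (X m)" for e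
  proof -
    have "h e \<le> (\<Sum>e\<in>edges (X m). h e)"
      using X.finite_edges nonneg by (intro member_le_sum e) auto
    then have "h e \<le> int n" by (simp add: n_def)
    also have "\<dots> \<le> int n * g e" using mult_left_mono[OF assms(2)[OF e], of "int n"] by simp
    finally show ?thesis .
  qed
  then show "inv\<^bsub>edge_group (X m)\<^esub> h \<otimes>\<^bsub>edge_group (X m)\<^esub> g [^]\<^bsub>edge_group (X m)\<^esub> n \<in> edge_cone (X m)"
    using assms(1) ext
    by (simp add: edge_cone_def fun_cone_iff inv_edge_group pow_edge_group edge_group_simps)
qed

text \<open>A nonzero class rules out the vanishing alternative of
  \<open>eventually_positive\<close>, so its representative becomes strictly positive and a multiple
  dominates any other one.\<close>

lemma limC_simple:
  assumes ord: "ordered_group (limC X f) (limC_cone X f)"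
    and H: "order_ideal (limC X f) (limC_cone X f) H"
  shows "H = {\<one>\<^bsub>limC X f\<^esub>} \<or> H = carrier (limC X f)"
proof (rule simple_if_order_units[OF ord _ H])
  fix a b assume a: "a \<in> limC_cone X f" and b: "b \<in> limC_cone X f" and ne: "a \<noteq> \<one>\<^bsub>limC X f\<^esub>"
  obtain k g h where *: "g \<in> edge_cone (X k)" "h \<in> edge_cone (X k)" "a = C.cls k g" "b = C.cls k h"
    using a b unfolding limC_cone_def by (rule C.cone_cases2)
  obtain m where m: "m \<ge> k" "(\<forall>e\<in>edges (X m). 1 \<le> pull k m g e) \<or> pull k m g = \<one>\<^bsub>edge_group (X m)\<^esub>"
    using eventually_positive[OF *(1)] .
  define g' h' where "g' = pull k m g" and "h' = pull k m h"
  have gh: "g' \<in> edge_cone (X m)" "h' \<in> edge_cone (X m)"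
    using * m C.trans_map_P by (auto simp: g'_def h'_def)
  then have carr: "g' \<in> carrier (edge_group (X m))" "h' \<in> carrier (edge_group (X m))"
    using C.P_carrier by auto
  have ab: "a = C.cls m g'" "b = C.cls m h'"
    using * m C.P_carrier by (auto simp: g'_def h'_def C.cls_trans_map)
  have "g' \<noteq> \<one>\<^bsub>edge_group (X m)\<^esub>"
    using ne ab C.one_dlim[of m] by (auto simp: limC_def)
  then obtain n :: nat where "inv\<^bsub>edge_group (X m)\<^esub> h' \<otimes>\<^bsub>edge_group (X m)\<^esub> g' [^]\<^bsub>edge_group (X m)\<^esub> n \<in> edge_cone (X m)"
    using m(2) dominate[OF carr(1) _ gh(2)] by (auto simp: g'_def)
  from C.cls_in_cone[OF this]
  show "\<exists>n::nat. inv\<^bsub>limC X f\<^esub> b \<otimes>\<^bsub>limC X f\<^esub> a [^]\<^bsub>limC X f\<^esub> n \<in> limC_cone X f"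
    unfolding ab limC_def limC_cone_def using carr
    by (intro exI[of _ n]) (simp add: C.cls_inv C.cls_pow C.cls_mult)
qed

text \<open>Positive cosets have nonnegative representatives. Domination is therefore obtained among
  functions and then carried over by the homomorphism to cosets.\<close>

lemma limG_simple:
  assumes ord: "ordered_group (limG X f) (limG_cone X f)"
    and H: "order_ideal (limG X f) (limG_cone X f) H"
  shows "H = {\<one>\<^bsub>limG X f\<^esub>} \<or> H = carrier (limG X f)"
proof (rule simple_if_order_units[OF ord _ H])
  fix a b assume a: "a \<in> limG_cone X f" and b: "b \<in> limG_cone X f" and ne: "a \<noteq> \<one>\<^bsub>limG X f\<^esub>"
  obtain k A B where "A \<in> graph_cone (X k)" "B \<in> graph_cone (X k)" "a = G.cls k A" "b = G.cls k B"
    using a b unfolding limG_cone_def by (rule G.cone_cases2)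
  then obtain g h where *: "g \<in> edge_cone (X k)" "h \<in> edge_cone (X k)"
    "a = G.cls k (X.coset k g)" "b = G.cls k (X.coset k h)"
    by (auto simp: X.graph_cone_eq)
  obtain m where m: "m \<ge> k" "(\<forall>e\<in>edges (X m). 1 \<le> pull k m g e) \<or> pull k m g = \<one>\<^bsub>edge_group (X m)\<^esub>"
    using eventually_positive[OF *(1)] .
  interpret h: group_hom "edge_group (X m)" "graph_group (X m)" "X.coset m"
    by (rule X.coset_group_hom)
  define g' h' where "g' = pull k m g" and "h' = pull k m h"
  have gh: "g' \<in> edge_cone (X m)" "h' \<in> edge_cone (X m)"
    using * m C.trans_map_P by (auto simp: g'_def h'_def)
  then have carr: "g' \<in> carrier (edge_group (X m))" "h' \<in> carrier (edge_group (X m))"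
    using C.P_carrier by auto
  have cls: "G.cls k (X.coset k x) = G.cls m (X.coset m (pull k m x))" if "x \<in> edge_cone (X k)" for x
  proof -
    have x: "x \<in> carrier (edge_group (X k))" using that by (rule C.P_carrier)
    then have "X.coset k x \<in> carrier (graph_group (X k))" by (simp add: X.carrier_graph_group)
    from G.cls_trans_map[OF m(1) this] show ?thesis
      using trans_graph_map_coset[OF m(1) x] by simp
  qed
  have ab: "a = G.cls m (X.coset m g')" "b = G.cls m (X.coset m h')"
    using * cls by (auto simp: g'_def h'_def)
  have "g' \<noteq> \<one>\<^bsub>edge_group (X m)\<^esub>"
  proof
    assume "g' = \<one>\<^bsub>edge_group (X m)\<^esub>"
    then have "a = \<one>\<^bsub>limG X f\<^esub>"
      unfolding ab(1) limG_def G.one_dlim[of m] by (simp only: h.hom_one)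
    with ne show False ..
  qed
  then obtain n :: nat where n: "inv\<^bsub>edge_group (X m)\<^esub> h' \<otimes>\<^bsub>edge_group (X m)\<^esub> g' [^]\<^bsub>edge_group (X m)\<^esub> n \<in> edge_cone (X m)"
    using m(2) dominate[OF carr(1) _ gh(2)] by (auto simp: g'_def)
  have "X.coset m (inv\<^bsub>edge_group (X m)\<^esub> h' \<otimes>\<^bsub>edge_group (X m)\<^esub> g' [^]\<^bsub>edge_group (X m)\<^esub> n) \<in> graph_cone (X m)"
    using n unfolding X.graph_cone_eq by (rule imageI)
  moreover have "X.coset m (inv\<^bsub>edge_group (X m)\<^esub> h' \<otimes>\<^bsub>edge_group (X m)\<^esub> g' [^]\<^bsub>edge_group (X m)\<^esub> n)
      = inv\<^bsub>graph_group (X m)\<^esub> X.coset m h' \<otimes>\<^bsub>graph_group (X m)\<^esub> X.coset m g' [^]\<^bsub>graph_group (X m)\<^esub> n"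
    using carr by (simp add: h.hom_nat_pow)
  ultimately have "G.cls m (inv\<^bsub>graph_group (X m)\<^esub> X.coset m h' \<otimes>\<^bsub>graph_group (X m)\<^esub>
      X.coset m g' [^]\<^bsub>graph_group (X m)\<^esub> n) \<in> G.DP"
    using G.cls_in_cone by metis
  then show "\<exists>n::nat. inv\<^bsub>limG X f\<^esub> b \<otimes>\<^bsub>limG X f\<^esub> a [^]\<^bsub>limG X f\<^esub> n \<in> limG_cone X f"
    unfolding ab limG_def limG_cone_def using carr
    by (intro exI[of _ n]) (simp add: G.cls_inv G.cls_pow G.cls_mult)
qed

text \<open>The ladder runs along levels so sparse that each word covers the whole graph at the
  previous chosen level. There \<open>\<beta>\<close> is the quotient map on enumerated functions
  and \<open>\<sigma>\<close> the pairing with the cycles of \<open>cycle_lift\<close>.\<close>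

lemma limG_dimension:
  assumes en: "\<And>k. bij_betw (en k) {..<card (edges (X k))} (edges (X k))"
  shows "dimension_group (limG X f) (limG_cone X f)"
proof -
  have "\<exists>\<kappa>. \<forall>i. 1 \<le> \<kappa> i \<and> \<kappa> i < \<kappa> (Suc i) \<and>
      (\<forall>e\<in>edges (X (\<kappa> (Suc i))). set (word (\<kappa> i) (\<kappa> (Suc i) - \<kappa> i) e) = edges (X (\<kappa> i)))"
  proof -
    have "\<exists>l\<ge>1. k < l \<and> (\<forall>e\<in>edges (X l). set (word k (l - k) e) = edges (X k))" if k: "1 \<le> k" for k
    proof -
      obtain m where "m \<ge> k"
        "\<And>l e. l \<ge> m \<Longrightarrow> e \<in> edges (X l) \<Longrightarrow> set (word k (l - k) e) = edges (X k)"
        by (rule words_cover[OF k]) blast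
      \<comment> \<open>The successor makes the chosen levels strictly increasing.\<close>
      then show ?thesis by (intro exI[of _ "Suc m"]) auto
    qed
    then show ?thesis
      using dependent_nat_choice[of "\<lambda>_ k. 1 \<le> k"
          "\<lambda>_ k l. k < l \<and> (\<forall>e\<in>edges (X l). set (word k (l - k) e) = edges (X k))"]
      by blast
  qed
  then obtain \<kappa> :: "nat \<Rightarrow> nat" where \<kappa>: "\<And>i. \<kappa> i < \<kappa> (Suc i)"
    and cov: "\<And>i e. e \<in> edges (X (\<kappa> (Suc i))) \<Longrightarrow> set (word (\<kappa> i) (\<kappa> (Suc i) - \<kappa> i) e) = edges (X (\<kappa> i))"
    by blast
  let ?E = "\<lambda>i. edges (X (\<kappa> i))"
  \<comment> \<open>Bundled so that one family of cycles per step has all three properties at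
    once.\<close>
  define lift where "lift i z \<longleftrightarrow>
      (\<forall>e\<in>?E (Suc i). \<forall>j\<in>?E i. 0 \<le> z e j) \<and>
      (\<forall>e\<in>?E (Suc i). \<forall>c. (\<Sum>j\<in>?E i. z e j * coboundary (X (\<kappa> i)) c j) = 0) \<and>
      (\<forall>g. \<exists>c. \<forall>e\<in>?E (Suc i). (\<Sum>j\<in>?E i. z e j * g j)
         = pull (\<kappa> i) (\<kappa> (Suc i)) g e + coboundary (X (\<kappa> (Suc i))) c e)"
    for i and z :: "(real \<Rightarrow> 'a) \<Rightarrow> (real \<Rightarrow> 'a) \<Rightarrow> int"
  have "\<exists>z. lift i z" for i
  proof -
    have d: "\<kappa> i + (\<kappa> (Suc i) - \<kappa> i) = \<kappa> (Suc i)" using \<kappa>[of i] by simp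
    show ?thesis
      unfolding lift_def
      by (rule cycle_lift[of "\<kappa> i" "\<kappa> (Suc i) - \<kappa> i"]; unfold d) (use cov in blast)+
  qed
  then obtain z where "\<And>i. lift i (z i)" by metis
  then have z_nonneg: "\<And>i e j. e \<in> ?E (Suc i) \<Longrightarrow> j \<in> ?E i \<Longrightarrow> 0 \<le> z i e j"
    and z_cob: "\<And>i e c. e \<in> ?E (Suc i) \<Longrightarrow> (\<Sum>j\<in>?E i. z i e j * coboundary (X (\<kappa> i)) c j) = 0"
    and z_pull: "\<And>i g. \<exists>c. \<forall>e\<in>?E (Suc i). (\<Sum>j\<in>?E i. z i e j * g j)
         = pull (\<kappa> i) (\<kappa> (Suc i)) g e + coboundary (X (\<kappa> (Suc i))) c e"
    by (auto simp: lift_def)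
  \<comment> \<open>Pairing with the cycles; since they annihilate coboundaries, it depends on the
    coset only.\<close>
  define \<tau> where "\<tau> i g = (\<lambda>e\<in>?E (Suc i). \<Sum>j\<in>?E i. z i e j * g j)" for i g
  define r where "r i = card (?E i)" for i
  have bij: "bij_betw (en (\<kappa> i)) {..<r i} (?E i)" for i
    using en by (simp add: r_def)
  define A where "A i = (\<lambda>a b. z i (en (\<kappa> (Suc i)) a) (en (\<kappa> i) b))" for i
  define \<beta> where "\<beta> i x = X.coset (\<kappa> i) (denum (r i) (en (\<kappa> i)) x)" for i x
  \<comment> \<open>The representative is arbitrary, which \<open>\<tau>_coset\<close> shows to be
    harmless.\<close>
  define \<sigma> where "\<sigma> i B = enum (r (Suc i)) (en (\<kappa> (Suc i))) (\<tau> i (SOME g. g \<in> B))" for i B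
  have \<tau>_closed: "\<tau> i g \<in> carrier (edge_group (X (\<kappa> (Suc i))))" for i g
    by (simp add: \<tau>_def edge_group_simps)
  have \<tau>_coset: "\<tau> i h = \<tau> i g" if h: "h \<in> X.coset (\<kappa> i) g" for i g h
  proof -
    obtain c where c: "h = (\<lambda>e\<in>?E i. g e + coboundary (X (\<kappa> i)) c e)"
      using h by (auto simp: X.coset_eq)
    show ?thesis
      unfolding \<tau>_def c
    proof (rule restrict_ext)
      fix e assume e: "e \<in> ?E (Suc i)"
      have "(\<Sum>j\<in>?E i. z i e j * (\<lambda>e\<in>?E i. g e + coboundary (X (\<kappa> i)) c e) j)
          = (\<Sum>j\<in>?E i. z i e j * g j) + (\<Sum>j\<in>?E i. z i e j * coboundary (X (\<kappa> i)) c j)"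
        by (simp add: algebra_simps sum.distrib)
      then show "(\<Sum>j\<in>?E i. z i e j * (\<lambda>e\<in>?E i. g e + coboundary (X (\<kappa> i)) c e) j)
          = (\<Sum>j\<in>?E i. z i e j * g j)" by (simp add: z_cob[OF e])
    qed
  qed
  have \<sigma>_coset: "\<sigma> i (X.coset (\<kappa> i) g) = enum (r (Suc i)) (en (\<kappa> (Suc i))) (\<tau> i g)"
    if g: "g \<in> carrier (edge_group (X (\<kappa> i)))" for i g
    unfolding \<sigma>_def using \<tau>_coset[OF someI[of "\<lambda>h. h \<in> X.coset (\<kappa> i) g", OF X.coset_self[OF g]]] by simp
  have denum_closed: "denum (r i) (en (\<kappa> i)) x \<in> carrier (edge_group (X (\<kappa> i)))"
    if "x \<in> carrier (Zgroup (r i))" for i x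
    using hom_in_carrier[OF denum_hom[OF bij] that] by (simp add: edge_group_def)
  have A_nonneg: "0 \<le> A i a b" if "a < r (Suc i)" "b < r i" for i a b
    unfolding A_def using that bij[of i] bij[of "Suc i"] by (intro z_nonneg) (auto simp: bij_betw_def)
  have "order_isomorphic G.D G.DP
      (dlim (\<lambda>k. Zgroup (r k)) (\<lambda>k. mat_map (r (Suc k)) (r k) (A k)))
      (dlim_cone (\<lambda>k. Zgroup (r k)) (\<lambda>k. mat_map (r (Suc k)) (r k) (A k)) (\<lambda>k. Zcone (r k)))"
  proof (rule order_isomorphic_intertwine[OF G.ordered_system_axioms ordered_system_mat_map])
    show "strict_mono \<kappa>" using \<kappa> by (simp add: strict_mono_Suc_iff)
    show "\<beta> i \<in> hom (Zgroup (r i)) (graph_group (X (\<kappa> i)))" for i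
    proof -
      have "denum (r i) (en (\<kappa> i)) \<in> hom (Zgroup (r i)) (edge_group (X (\<kappa> i)))"
        unfolding edge_group_def by (rule denum_hom[OF bij])
      from hom_compose[OF this X.coset_hom] show ?thesis
        by (simp add: \<beta>_def[abs_def] comp_def)
    qed
    show "\<sigma> i \<in> hom (graph_group (X (\<kappa> i))) (Zgroup (r (Suc i)))" for i
    proof (rule homI)
      have enum: "enum (r (Suc i)) (en (\<kappa> (Suc i))) \<in> hom (edge_group (X (\<kappa> (Suc i)))) (Zgroup (r (Suc i)))"
        unfolding edge_group_def by (rule enum_hom[OF bij])
      fix a assume "a \<in> carrier (graph_group (X (\<kappa> i)))"
      then show "\<sigma> i a \<in> carrier (Zgroup (r (Suc i)))"
        using hom_in_carrier[OF enum \<tau>_closed] by (auto simp: X.carrier_graph_group \<sigma>_coset)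
      fix b assume "b \<in> carrier (graph_group (X (\<kappa> i)))"
      then obtain g h where gh: "g \<in> carrier (edge_group (X (\<kappa> i)))" "a = X.coset (\<kappa> i) g"
        "h \<in> carrier (edge_group (X (\<kappa> i)))" "b = X.coset (\<kappa> i) h"
        using \<open>a \<in> _\<close> by (auto simp: X.carrier_graph_group)
      have "\<tau> i (g \<otimes>\<^bsub>edge_group (X (\<kappa> i))\<^esub> h) = \<tau> i g \<otimes>\<^bsub>edge_group (X (\<kappa> (Suc i)))\<^esub> \<tau> i h"
        by (auto simp: \<tau>_def edge_group_simps fun_eq_iff algebra_simps sum.distrib)
      then show "\<sigma> i (a \<otimes>\<^bsub>graph_group (X (\<kappa> i))\<^esub> b) = \<sigma> i a \<otimes>\<^bsub>Zgroup (r (Suc i))\<^esub> \<sigma> i b"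
        using gh hom_mult[OF enum \<tau>_closed \<tau>_closed] by (simp add: X.coset_mult \<sigma>_coset)
    qed
    show "\<sigma> i (\<beta> i x) = mat_map (r (Suc i)) (r i) (A i) x" if "x \<in> carrier (Zgroup (r i))" for i x
      using enum_sum_eq_mat_map[OF bij bij that, of "Suc i" "z i"]
      by (simp add: \<beta>_def \<sigma>_coset denum_closed[OF that] \<tau>_def A_def)
    show "\<beta> (Suc i) (\<sigma> i y) = trans_map (graph_map X f) (\<kappa> i) (\<kappa> (Suc i)) y"
      if y: "y \<in> carrier (graph_group (X (\<kappa> i)))" for i y
    proof -
      obtain g where g: "g \<in> carrier (edge_group (X (\<kappa> i)))" "y = X.coset (\<kappa> i) g"
        using y by (auto simp: X.carrier_graph_group)
      have le: "\<kappa> i \<le> \<kappa> (Suc i)" using \<kappa>[of i] by simp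
      have "\<beta> (Suc i) (\<sigma> i y) = X.coset (\<kappa> (Suc i)) (\<tau> i g)"
        using denum_enum[OF bij[of "Suc i"], of "\<tau> i g"] \<tau>_closed[of i g] g
        by (simp add: \<beta>_def \<sigma>_coset edge_group_def)
      also obtain c where c: "\<And>e. e \<in> ?E (Suc i) \<Longrightarrow> \<tau> i g e
         = pull (\<kappa> i) (\<kappa> (Suc i)) g e + coboundary (X (\<kappa> (Suc i))) c e"
        using z_pull[of i g] by (auto simp: \<tau>_def)
      \<comment> \<open>The pairing and the pullback differ by a coboundary, so modulo coboundaries
        this is the bonding homomorphism.\<close>
      have "X.coset (\<kappa> (Suc i)) (\<tau> i g) = X.coset (\<kappa> (Suc i)) (pull (\<kappa> i) (\<kappa> (Suc i)) g)"
        using c C.trans_map_closed[OF le g(1)] by (intro X.coset_eqI[OF \<tau>_closed]) auto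
      also have "\<dots> = trans_map (graph_map X f) (\<kappa> i) (\<kappa> (Suc i)) y"
        using trans_graph_map_coset[OF le g(1)] g(2) by simp
      finally show ?thesis .
    qed
    show "\<beta> i x \<in> graph_cone (X (\<kappa> i))" if "x \<in> Zcone (r i)" for i x
      using denum_pos[OF bij that] by (simp add: \<beta>_def X.graph_cone_eq edge_cone_def)
    show "\<sigma> i y \<in> Zcone (r (Suc i))" if y: "y \<in> graph_cone (X (\<kappa> i))" for i y
    proof -
      obtain g where g: "g \<in> edge_cone (X (\<kappa> i))" "y = X.coset (\<kappa> i) g"
        using y by (auto simp: X.graph_cone_eq)
      have "\<tau> i g \<in> fun_cone (?E (Suc i))"
        using g(1) z_nonneg
        by (auto simp: \<tau>_def fun_cone_iff edge_cone_def intro!: sum_nonneg mult_nonneg_nonneg)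
      then show ?thesis
        using enum_pos[OF bij] g C.P_carrier[OF g(1)] by (simp add: \<sigma>_coset)
    qed
  qed (rule A_nonneg)
  then show ?thesis
    unfolding limG_def limG_cone_def
    by (intro dimension_groupI[OF G.preordered_dlim A_nonneg])
qed

end

theorem proposition3p16:
  fixes Y :: "'y topology"
    and X :: "nat \<Rightarrow> 'x digraph"
    and f :: "nat \<Rightarrow> 'x \<Rightarrow> 'x"
    and en :: "nat \<Rightarrow> nat \<Rightarrow> real \<Rightarrow> 'x"
  assumes "branched_matchbox_manifold Y"
    and "compact_space Y" and "connected_space Y" and "orientable Y"
    and "is_presentation Y X f"
    and "\<And>k. bij_betw (en k) {..<card (edges (X k))} (edges (X k))"
  shows "(ordered_group (limC X f) (limC_cone X f) \<and>
          ordered_group (limZ X f en) (limZ_cone X f en) \<and>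
          order_isomorphic (limC X f) (limC_cone X f) (limZ X f en) (limZ_cone X f en)) \<and>
         (simplicity_condition X f \<longrightarrow>
            simple_dimension_group (limC X f) (limC_cone X f) \<and>
            simple_dimension_group (limG X f) (limG_cone X f))"
proof -
  interpret graph_system X f
    using assms(5) by unfold_locales (auto simp: is_presentation_def)
  note C = limC_dimension[OF assms(6)]
  have ordC: "ordered_group (limC X f) (limC_cone X f)"
    using C(1) by (simp add: dimension_group_def)
  show ?thesis
  proof (intro conjI impI ordC C(2,3))
    assume "simplicity_condition X f"
    then interpret simple_graph_system X f by unfold_locales
    show "simple_dimension_group (limC X f) (limC_cone X f)"
      using C(1) limC_simple[OF ordC] by (simp add: simple_dimension_group_def)
    have G: "dimension_group (limG X f) (limG_cone X f)"
      by (rule limG_dimension[OF assms(6)])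
    then show "simple_dimension_group (limG X f) (limG_cone X f)"
      using limG_simple by (simp add: simple_dimension_group_def dimension_group_def)
  qed
qed

end
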